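(* Let $f\in C^{1}(\mathbb{R})$ be such that $f'(s)\le\eta$ for all $s\in\mathbb{R}$, for some constant $\eta$. Assume that $h\in L^{2}(0,T;L^{2}(\Omega))$ for all $T>0$, that $a\in C(\mathbb{R}^{+},\mathbb{R}^{+})$ satisfies $a(s)\ge m$ for all $s\ge0$ with a constant $m>0$, and that $$-\kappa-\alpha_{2}|s|^{p}\le f(s)s\le\kappa-\alpha_{1}|s|^{p}\quad\forall s\in\mathbb{R},$$ with constants $\alpha_1,\alpha_2>0$, $\kappa\ge0$, $p\ge2$. Assume additionally that the function $s\mapsto a(s^{2})s$ is nondecreasing on $\mathbb{R}^+$. (i) If there are constants $M_1,M_2\ge0$ with $a(s)\le M_{1}+M_{2}s$ for all $s\ge0$, then for each $u_0\in L^2(\Omega)$ there exists at most one regular solution to problem (P) with initial datum $u_0$. (ii) If, moreover, $M_{2}=0$ in (i), then for each $u_0\in L^2(\Omega)$ there exists at most one weak solution to problem (P) with initial datum $u_0$. (iii) Without assuming the upper bound on $a$ in (i), for each $u_{0}\in H_{0}^{1}(\Omega)\cap L^{p}(\Omega)$ there exists at most one strong solution to problem (P) with initial datum $u_0$.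
   Context: $\Omega\subset\mathbb{R}^{n}$ ($n\ge1$) is a bounded open set with smooth boundary, $\mathbb{R}^{+}=[0,\infty)$, and $\|u\|_{H_0^1}=\|\nabla u\|_{L^2}$. Problem (P) is $$u_{t}-a(\|u\|_{H_{0}^{1}}^{2})\Delta u=f(u)+h(t)\ \text{in }\Omega\times(0,\infty),\qquad u=0\ \text{on }\partial\Omega\times(0,\infty),\qquad u(0,x)=u_{0}(x)\ \text{in }\Omega.$$ $(\cdot,\cdot)$ denotes the $L^2(\Omega)$ inner product and also the duality between $L^p(\Omega)$ and $L^q(\Omega)$, $1/p+1/q=1$. Let $A=-\Delta$ with $D(A)=H^{2}(\Omega)\cap H_{0}^{1}(\Omega)$. A weak solution is a function $u\in L^{\infty}(0,T;L^{2}(\Omega))\cap L^{2}(0,T;H_{0}^{1}(\Omega))\cap L^{p}(0,T;L^{p}(\Omega))$ for any $T>0$ such that, for every $v\in H_0^1(\Omega)\cap L^p(\Omega)$, in the sense of scalar distributions on $(0,\infty)$, $$\frac{d}{dt}(u,v)+a(\|u(t)\|_{H_{0}^{1}}^{2})(\nabla u(t),\nabla v)=(f(u(t)),v)+(h(t),v).$$ A regular solution is a weak solution such that also $u\in L^{\infty}(\varepsilon,T;H_{0}^{1}(\Omega))\cap L^{2}(\varepsilon,T;D(A))$ for any $0<\varepsilon<T$. A strong solution is a weak solution such that also $u\in L^{\infty}(0,T;H_{0}^{1}(\Omega)\cap L^{p}(\Omega))$, $u\in L^{2}(0,T;D(A))$ and $\frac{du}{dt}\in L^{2}(0,T;L^{2}(\Omega))$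 for any $T>0$. The initial condition $u(0)=u_0$ is required to hold and makes sense because regular solutions in (i) and weak solutions in (ii) belong to $C([0,T];L^2(\Omega))$, and strong solutions belong to $C([0,T];H_0^1(\Omega))$, for all $T>0$. *)

theory Defs
  imports "HOL-Analysis.Analysis"
begin

text \<open>Meaningful for open \<open>S\<close> only. Differentiability is demanded at each order below \<open>k\<close> and continuity
  only at order \<open>k\<close>, since the former implies continuity of the lower derivatives.\<close>

primrec Ck_on :: "nat \<Rightarrow> 'a::euclidean_space set \<Rightarrow> ('a \<Rightarrow> 'b::real_normed_vector) \<Rightarrow> bool" where
  "Ck_on 0 S f \<longleftrightarrow> continuous_on S f"
| "Ck_on (Suc k) S f \<longleftrightarrow> (\<forall>x\<in>S. f differentiable (at x)) \<and>
     (\<forall>b\<in>Basis. Ck_on k S (\<lambda>x. frechet_derivative f (at x) b))"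

definition smooth_on :: "'a::euclidean_space set \<Rightarrow> ('a \<Rightarrow> 'b::real_normed_vector) \<Rightarrow> bool" where
  "smooth_on S f \<longleftrightarrow> (\<forall>k. Ck_on k S f)"

text \<open>The boundary can be straightened locally by smooth diffeomorphisms mapping the open set
  to one side of a hyperplane.\<close>

definition smooth_boundary :: "'a::euclidean_space set \<Rightarrow> bool" where
  "smooth_boundary \<Omega> \<longleftrightarrow>
     (\<forall>x\<in>frontier \<Omega>. \<exists>U V \<psi> \<psi>'. \<exists>b\<in>Basis. open U \<and> x \<in> U \<and> open V \<and>
        homeomorphism U V \<psi> \<psi>' \<and> smooth_on U (\<psi> :: 'a \<Rightarrow> 'a) \<and> smooth_on V (\<psi>' :: 'a \<Rightarrow> 'a) \<and>
        \<psi> ` (U \<inter> \<Omega>) = {y \<in> V. y \<bullet> b > 0} \<and>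
        \<psi> ` (U \<inter> frontier \<Omega>) = {y \<in> V. y \<bullet> b = 0})"

definition test_fun :: "'a::euclidean_space set \<Rightarrow> ('a \<Rightarrow> real) \<Rightarrow> bool" where
  "test_fun S \<phi> \<longleftrightarrow> smooth_on UNIV \<phi> \<and>
     compact (closure {x. \<phi> x \<noteq> 0}) \<and> closure {x. \<phi> x \<noteq> 0} \<subseteq> S"

definition loc_integrable :: "'a::euclidean_space set \<Rightarrow> ('a \<Rightarrow> real) \<Rightarrow> bool" where
  "loc_integrable S g \<longleftrightarrow> (\<forall>K. compact K \<and> K \<subseteq> S \<longrightarrow> integrable (lebesgue_on K) g)"

text \<open>Elements of function spaces over \<open>\<Omega>\<close> are represented by functions on the whole space, of
  which only the values almost everywhere on \<open>\<Omega>\<close> matter. The norms below are therefore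
  seminorms, which identify functions that agree almost everywhere on \<open>\<Omega>\<close>.\<close>

definition Lp_space :: "real \<Rightarrow> 'a::euclidean_space set \<Rightarrow> ('a \<Rightarrow> real) set" where
  "Lp_space p \<Omega> = {v. v \<in> borel_measurable (lebesgue_on \<Omega>) \<and>
     integrable (lebesgue_on \<Omega>) (\<lambda>x. \<bar>v x\<bar> powr p)}"

definition Lp_norm :: "real \<Rightarrow> 'a::euclidean_space set \<Rightarrow> ('a \<Rightarrow> real) \<Rightarrow> real" where
  "Lp_norm p \<Omega> v = (LINT x|lebesgue_on \<Omega>. \<bar>v x\<bar> powr p) powr (1 / p)"

definition pairing :: "'a::euclidean_space set \<Rightarrow> ('a \<Rightarrow> real) \<Rightarrow> ('a \<Rightarrow> real) \<Rightarrow> real" where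
  "pairing \<Omega> u v = (LINT x|lebesgue_on \<Omega>. u x * v x)"

definition weak_partial ::
  "'a::euclidean_space set \<Rightarrow> 'a \<Rightarrow> ('a \<Rightarrow> real) \<Rightarrow> ('a \<Rightarrow> real) \<Rightarrow> bool" where
  "weak_partial \<Omega> b u g \<longleftrightarrow> loc_integrable \<Omega> u \<and> loc_integrable \<Omega> g \<and>
     (\<forall>\<phi>. test_fun \<Omega> \<phi> \<longrightarrow>
        (LINT x|lebesgue_on \<Omega>. u x * frechet_derivative \<phi> (at x) b) =
        - (LINT x|lebesgue_on \<Omega>. g x * \<phi> x))"

text \<open>Weak derivatives are unique up to null sets, so the choice is immaterial.\<close>

definition wderiv :: "'a::euclidean_space set \<Rightarrow> 'a \<Rightarrow> ('a \<Rightarrow> real) \<Rightarrow> 'a \<Rightarrow> real" where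
  "wderiv \<Omega> b u = (SOME g. weak_partial \<Omega> b u g)"

primrec sobolev :: "nat \<Rightarrow> 'a::euclidean_space set \<Rightarrow> ('a \<Rightarrow> real) \<Rightarrow> bool" where
  "sobolev 0 \<Omega> u \<longleftrightarrow> u \<in> Lp_space 2 \<Omega>"
| "sobolev (Suc k) \<Omega> u \<longleftrightarrow> u \<in> Lp_space 2 \<Omega> \<and>
     (\<forall>b\<in>Basis. \<exists>g. weak_partial \<Omega> b u g \<and> sobolev k \<Omega> g)"

definition grad_pairing :: "'a::euclidean_space set \<Rightarrow> ('a \<Rightarrow> real) \<Rightarrow> ('a \<Rightarrow> real) \<Rightarrow> real" where
  "grad_pairing \<Omega> u v = (\<Sum>b\<in>Basis. pairing \<Omega> (wderiv \<Omega> b u) (wderiv \<Omega> b v))"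

definition H1_norm :: "'a::euclidean_space set \<Rightarrow> ('a \<Rightarrow> real) \<Rightarrow> real" where
  "H1_norm \<Omega> u =
     sqrt ((Lp_norm 2 \<Omega> u)\<^sup>2 + (\<Sum>b\<in>Basis. (Lp_norm 2 \<Omega> (wderiv \<Omega> b u))\<^sup>2))"

definition H10 :: "'a::euclidean_space set \<Rightarrow> ('a \<Rightarrow> real) set" where
  "H10 \<Omega> = {u. sobolev 1 \<Omega> u \<and>
     (\<exists>\<phi>::nat \<Rightarrow> 'a \<Rightarrow> real. (\<forall>k. test_fun \<Omega> (\<phi> k)) \<and>
        (\<lambda>k. H1_norm \<Omega> (\<lambda>x. \<phi> k x - u x)) \<longlonglongrightarrow> 0)}"

definition H10_norm :: "'a::euclidean_space set \<Rightarrow> ('a \<Rightarrow> real) \<Rightarrow> real" where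
  "H10_norm \<Omega> u = sqrt (\<Sum>b\<in>Basis. (Lp_norm 2 \<Omega> (wderiv \<Omega> b u))\<^sup>2)"

definition wlaplacian :: "'a::euclidean_space set \<Rightarrow> ('a \<Rightarrow> real) \<Rightarrow> 'a \<Rightarrow> real" where
  "wlaplacian \<Omega> u = (\<lambda>x. \<Sum>b\<in>Basis. wderiv \<Omega> b (wderiv \<Omega> b u) x)"

text \<open>The domain of \<open>A = -\<Delta>\<close> carries the graph norm.\<close>

definition DA :: "'a::euclidean_space set \<Rightarrow> ('a \<Rightarrow> real) set" where
  "DA \<Omega> = {u. sobolev 2 \<Omega> u} \<inter> H10 \<Omega>"

definition DA_norm :: "'a::euclidean_space set \<Rightarrow> ('a \<Rightarrow> real) \<Rightarrow> real" where
  "DA_norm \<Omega> u = sqrt ((Lp_norm 2 \<Omega> u)\<^sup>2 + (Lp_norm 2 \<Omega> (wlaplacian \<Omega> u))\<^sup>2)"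

text \<open>Here \<open>X\<close> is a space of functions with seminorm \<open>N\<close>, and \<open>I\<close> is a time interval. The values
  of the functions of time are representatives, so that the library's Bochner integral, which
  needs a normed space as a type, is not applicable; the standard construction by simple
  functions is repeated.\<close>

definition step_fun :: "real set \<Rightarrow> ('a \<Rightarrow> real) set \<Rightarrow> (real \<Rightarrow> 'a \<Rightarrow> real) \<Rightarrow> bool" where
  "step_fun I X s \<longleftrightarrow> finite (s ` I) \<and> s ` I \<subseteq> X \<and> (\<forall>w. {t\<in>I. s t = w} \<in> sets lebesgue)"

definition step_integral :: "real set \<Rightarrow> (real \<Rightarrow> 'a \<Rightarrow> real) \<Rightarrow> 'a \<Rightarrow> real" where
  "step_integral I s = (\<lambda>x. \<Sum>w\<in>s ` I. measure lebesgue {t\<in>I. s t = w} * w x)"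

definition strongly_measurable ::
  "real set \<Rightarrow> ('a \<Rightarrow> real) set \<Rightarrow> (('a \<Rightarrow> real) \<Rightarrow> real) \<Rightarrow> (real \<Rightarrow> 'a \<Rightarrow> real) \<Rightarrow> bool" where
  "strongly_measurable I X N F \<longleftrightarrow>
     (\<exists>s::nat \<Rightarrow> real \<Rightarrow> 'a \<Rightarrow> real. (\<forall>k. step_fun I X (s k)) \<and>
        (AE t in lebesgue_on I. F t \<in> X \<and> (\<lambda>k. N (\<lambda>x. s k t x - F t x)) \<longlonglongrightarrow> 0))"

definition bochner_Lp ::
  "real \<Rightarrow> real set \<Rightarrow> ('a \<Rightarrow> real) set \<Rightarrow> (('a \<Rightarrow> real) \<Rightarrow> real) \<Rightarrow> (real \<Rightarrow> 'a \<Rightarrow> real) set" where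
  "bochner_Lp r I X N =
     {F. strongly_measurable I X N F \<and> integrable (lebesgue_on I) (\<lambda>t. N (F t) powr r)}"

definition bochner_Linf ::
  "real set \<Rightarrow> ('a \<Rightarrow> real) set \<Rightarrow> (('a \<Rightarrow> real) \<Rightarrow> real) \<Rightarrow> (real \<Rightarrow> 'a \<Rightarrow> real) set" where
  "bochner_Linf I X N =
     {F. strongly_measurable I X N F \<and> (\<exists>C. AE t in lebesgue_on I. N (F t) \<le> C)}"

definition has_integral_in ::
  "real set \<Rightarrow> ('a \<Rightarrow> real) set \<Rightarrow> (('a \<Rightarrow> real) \<Rightarrow> real) \<Rightarrow> (real \<Rightarrow> 'a \<Rightarrow> real) \<Rightarrow>
     ('a \<Rightarrow> real) \<Rightarrow> bool" where
  "has_integral_in I X N F J \<longleftrightarrow> J \<in> X \<and>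
     (\<exists>s::nat \<Rightarrow> real \<Rightarrow> 'a \<Rightarrow> real. (\<forall>k. step_fun I X (s k)) \<and>
        (AE t in lebesgue_on I. F t \<in> X \<and> (\<lambda>k. N (\<lambda>x. s k t x - F t x)) \<longlonglongrightarrow> 0) \<and>
        (\<forall>k. integrable (lebesgue_on I) (\<lambda>t. N (\<lambda>x. s k t x - F t x))) \<and>
        (\<lambda>k. LINT t|lebesgue_on I. N (\<lambda>x. s k t x - F t x)) \<longlonglongrightarrow> 0 \<and>
        (\<lambda>k. N (\<lambda>x. step_integral I (s k) x - J x)) \<longlonglongrightarrow> 0)"

text \<open>The derivative of \<open>u\<close> in the sense of \<open>X\<close>-valued distributions on \<open>I\<close> is \<open>w\<close>:
  the Bochner integrals of \<open>\<phi>' u\<close> and \<open>- \<phi> w\<close> agree.\<close>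

definition has_time_deriv ::
  "real set \<Rightarrow> ('a \<Rightarrow> real) set \<Rightarrow> (('a \<Rightarrow> real) \<Rightarrow> real) \<Rightarrow> (real \<Rightarrow> 'a \<Rightarrow> real) \<Rightarrow>
     (real \<Rightarrow> 'a \<Rightarrow> real) \<Rightarrow> bool" where
  "has_time_deriv I X N u w \<longleftrightarrow>
     (\<forall>\<phi>. test_fun I \<phi> \<longrightarrow>
        (\<exists>J. has_integral_in I X N (\<lambda>t x. deriv \<phi> t * u t x) J \<and>
             has_integral_in I X N (\<lambda>t x. - (\<phi> t * w t x)) J))"

text \<open>\<open>g' = k\<close> in the sense of scalar distributions on \<open>(0,\<infinity>)\<close>. Local integrability is what
  makes \<open>g\<close> and \<open>k\<close> distributions.\<close>

definition scalar_distr_deriv :: "(real \<Rightarrow> real) \<Rightarrow> (real \<Rightarrow> real) \<Rightarrow> bool" where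
  "scalar_distr_deriv g k \<longleftrightarrow> loc_integrable {0<..} g \<and> loc_integrable {0<..} k \<and>
     (\<forall>\<phi>. test_fun {0<..} \<phi> \<longrightarrow>
        (LINT t|lebesgue_on {0<..}. g t * deriv \<phi> t) = - (LINT t|lebesgue_on {0<..}. k t * \<phi> t))"

definition ae_equal_on ::
  "'a::euclidean_space set \<Rightarrow> (real \<Rightarrow> 'a \<Rightarrow> real) \<Rightarrow> (real \<Rightarrow> 'a \<Rightarrow> real) \<Rightarrow> bool" where
  "ae_equal_on \<Omega> u v \<longleftrightarrow>
     (AE t in lebesgue_on {0<..}. AE x in lebesgue_on \<Omega>. u t x = v t x)"

text \<open>The function \<open>u\<close> is only determined for almost every \<open>t\<close>; its value at time \<open>0\<close> is that of its
  representative in \<open>C([0,\<infinity>); X)\<close>.\<close>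

definition has_initial_value ::
  "'a::euclidean_space set \<Rightarrow> ('a \<Rightarrow> real) set \<Rightarrow> (('a \<Rightarrow> real) \<Rightarrow> real) \<Rightarrow>
     (real \<Rightarrow> 'a \<Rightarrow> real) \<Rightarrow> ('a \<Rightarrow> real) \<Rightarrow> bool" where
  "has_initial_value \<Omega> X N u u\<^sub>0 \<longleftrightarrow>
     (\<exists>U. (\<forall>t\<ge>0. U t \<in> X \<and> ((\<lambda>s. N (\<lambda>x. U s x - U t x)) \<longlongrightarrow> 0) (at t within {0..})) \<and>
          ae_equal_on \<Omega> U u \<and>
          (AE x in lebesgue_on \<Omega>. U 0 x = u\<^sub>0 x))"

text \<open>The elliptic term of the variational equation is written on the right-hand side, so that the
  requirement that it be a distribution in time is part of \<open>scalar_distr_deriv\<close>.\<close>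

definition weak_solution ::
  "'a::euclidean_space set \<Rightarrow> real \<Rightarrow> (real \<Rightarrow> real) \<Rightarrow> (real \<Rightarrow> real) \<Rightarrow> (real \<Rightarrow> 'a \<Rightarrow> real) \<Rightarrow>
     (real \<Rightarrow> 'a \<Rightarrow> real) \<Rightarrow> bool" where
  "weak_solution \<Omega> p a f h u \<longleftrightarrow>
     (\<forall>T>0. u \<in> bochner_Linf {0<..<T} (Lp_space 2 \<Omega>) (Lp_norm 2 \<Omega>) \<and>
            u \<in> bochner_Lp 2 {0<..<T} (H10 \<Omega>) (H10_norm \<Omega>) \<and>
            u \<in> bochner_Lp p {0<..<T} (Lp_space p \<Omega>) (Lp_norm p \<Omega>)) \<and>
     (\<forall>v \<in> H10 \<Omega> \<inter> Lp_space p \<Omega>.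
        scalar_distr_deriv
          (\<lambda>t. pairing \<Omega> (u t) v)
          (\<lambda>t. - a ((H10_norm \<Omega> (u t))\<^sup>2) * grad_pairing \<Omega> (u t) v
               + pairing \<Omega> (\<lambda>x. f (u t x)) v + pairing \<Omega> (h t) v))"

definition regular_solution ::
  "'a::euclidean_space set \<Rightarrow> real \<Rightarrow> (real \<Rightarrow> real) \<Rightarrow> (real \<Rightarrow> real) \<Rightarrow> (real \<Rightarrow> 'a \<Rightarrow> real) \<Rightarrow>
     (real \<Rightarrow> 'a \<Rightarrow> real) \<Rightarrow> bool" where
  "regular_solution \<Omega> p a f h u \<longleftrightarrow> weak_solution \<Omega> p a f h u \<and>
     (\<forall>\<epsilon> T. 0 < \<epsilon> \<and> \<epsilon> < T \<longrightarrow>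
        u \<in> bochner_Linf {\<epsilon><..<T} (H10 \<Omega>) (H10_norm \<Omega>) \<and>
        u \<in> bochner_Lp 2 {\<epsilon><..<T} (DA \<Omega>) (DA_norm \<Omega>))"

definition strong_solution ::
  "'a::euclidean_space set \<Rightarrow> real \<Rightarrow> (real \<Rightarrow> real) \<Rightarrow> (real \<Rightarrow> real) \<Rightarrow> (real \<Rightarrow> 'a \<Rightarrow> real) \<Rightarrow>
     (real \<Rightarrow> 'a \<Rightarrow> real) \<Rightarrow> bool" where
  "strong_solution \<Omega> p a f h u \<longleftrightarrow> weak_solution \<Omega> p a f h u \<and>
     (\<forall>T>0.
        u \<in> bochner_Linf {0<..<T} (H10 \<Omega> \<inter> Lp_space p \<Omega>) (\<lambda>w. H10_norm \<Omega> w + Lp_norm p \<Omega> w) \<and>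
        u \<in> bochner_Lp 2 {0<..<T} (DA \<Omega>) (DA_norm \<Omega>) \<and>
        (\<exists>w. w \<in> bochner_Lp 2 {0<..<T} (Lp_space 2 \<Omega>) (Lp_norm 2 \<Omega>) \<and>
             has_time_deriv {0<..<T} (Lp_space 2 \<Omega>) (Lp_norm 2 \<Omega>) u w))"

end

theory Submission
  imports Defs "HOL-Computational_Algebra.Polynomial"
begin

text \<open>
  Let \<open>u\<close> and \<open>v\<close> be two solutions with the same initial value, and let \<open>w = u - v\<close>. Formally, testing
  the difference of the two equations with \<open>w\<close> gives

  \<open>1/2 d/dt |w|\<^sup>2 + (a(|\<nabla>u|\<^sup>2) \<nabla>u - a(|\<nabla>v|\<^sup>2) \<nabla>v, \<nabla>w) = (f(u) - f(v), w)\<close>.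

  By Cauchy-Schwarz the elliptic term is at least
  \<open>(a(|\<nabla>u|\<^sup>2) |\<nabla>u| - a(|\<nabla>v|\<^sup>2) |\<nabla>v|) (|\<nabla>u| - |\<nabla>v|)\<close>, which is nonnegative because
  \<open>s \<mapsto> a(s\<^sup>2) s\<close> is nondecreasing; and the right-hand side is at most \<open>\<eta> |w|\<^sup>2\<close> because \<open>f' \<le> \<eta>\<close>
  (\<open>R_monotone\<close>). Gronwall's lemma then gives \<open>w = 0\<close> (\<open>Gronwall_zero\<close>).

  What has to be justified is the use of \<open>w\<close> as a test function: the equation holds in the sense of
  distributions in time, against test functions that do not depend on time. Here this is done with
  increments instead of derivatives. Let \<open>W\<close> be the representative of \<open>w\<close> that is continuous in \<open>L\<^sup>2\<close>.
  Expanding the square gives \<open>|W(t)|\<^sup>2 - |W(t - \<delta>)|\<^sup>2 \<le> 2 (W(t) - W(t - \<delta>), W(t))\<close>, and for almost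
  every \<open>t\<close> the fixed function \<open>w(t)\<close> is an admissible test function, so that the right-hand side is
  twice the integral over \<open>r\<close> from \<open>t - \<delta>\<close> to \<open>t\<close> of the weak form at time \<open>r\<close> tested with \<open>w(t)\<close>
  (\<open>pairing_increment\<close>, \<open>y_increment_le\<close>). Replacing \<open>w(t)\<close> by \<open>w(r)\<close> produces an error which Young's
  inequality bounds by a small multiple of an integrable function and a large multiple of powers of the
  distance of \<open>w(t)\<close> and \<open>w(r)\<close> in \<open>H\<^sub>0\<^sup>1\<close> and \<open>L\<^sup>p\<close> (\<open>R_gap_le\<close>). Like Lusin's theorem, strong measurability
  makes these powers at most \<open>b(t) + b(r) + e\<close> for small \<open>|t - r|\<close>, with a function \<open>b\<close> of small
  integral (\<open>bochner_Lp_quasi_continuous\<close>). Averaging over \<open>t\<close> and letting \<open>\<delta>\<close> tend to zero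
  (\<open>increment_le_integral\<close>) yields \<open>|W(\<tau>)|\<^sup>2 - |W(s)|\<^sup>2 \<le> 2 \<eta>\<^sup>+ \<integral> |W|\<^sup>2\<close> (\<open>energy_inequality\<close>), which
  is what Gronwall's lemma asks for.

  The same argument serves all three classes of solutions, because in each of them the coefficient
  \<open>a(|\<nabla>u(t)|\<^sup>2)\<close> is essentially bounded on compact subintervals of \<open>(0,\<infinity>)\<close>: for weak solutions
  because \<open>a\<close> itself is bounded, for regular and strong solutions because \<open>u\<close> is essentially bounded
  in \<open>H\<^sub>0\<^sup>1\<close> there and \<open>a\<close> is continuous. For strong solutions the initial value is attained in
  \<open>H\<^sub>0\<^sup>1\<close>, hence in \<open>L\<^sup>2\<close> by the Poincare inequality (\<open>Poincare\<close>).

  Gradients are chosen representatives of weak derivatives, so that even their linearity rests on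
  the uniqueness of weak derivatives (\<open>weak_partial_unique\<close>); it follows from the fundamental lemma
  of the calculus of variations and an ample supply of test functions, built from one smooth step.
\<close>

section \<open>Smooth functions\<close>

lemma Ck_on_imp_continuous_on: "Ck_on k S f \<Longrightarrow> continuous_on S f"
  by (cases k) (auto intro!: continuous_at_imp_continuous_on differentiable_imp_continuous_within)

lemma Ck_on_const: "Ck_on k UNIV (\<lambda>x. c)"
proof (induction k arbitrary: c)
  case (Suc k)
  then show ?case by (simp add: frechet_derivative_const)
qed simp

lemma Ck_on_add:
  fixes f g :: "'a::euclidean_space \<Rightarrow> 'b::real_normed_vector"
  shows "Ck_on k UNIV f \<Longrightarrow> Ck_on k UNIV g \<Longrightarrow> Ck_on k UNIV (\<lambda>x. f x + g x)"
proof (induction k arbitrary: f g)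
  case (Suc k)
  have "frechet_derivative (\<lambda>x. f x + g x) (at x) b
      = frechet_derivative f (at x) b + frechet_derivative g (at x) b" for x b
  proof -
    have "(f has_derivative frechet_derivative f (at x)) (at x)"
         "(g has_derivative frechet_derivative g (at x)) (at x)"
      using Suc.prems by (auto simp: frechet_derivative_works)
    from has_derivative_add[OF this] show ?thesis
      by (subst frechet_derivative_at[symmetric]) auto
  qed
  then show ?case
    using Suc.prems by (auto intro!: Suc.IH)
qed (auto intro!: continuous_intros)

lemma Ck_on_lower: "Ck_on (Suc k) S f \<Longrightarrow> Ck_on k S f"
proof (induction k arbitrary: f)
  case 0 then show ?case by (metis Ck_on.simps(1) Ck_on_imp_continuous_on)
next
  case (Suc k)
  then show ?case by (metis Ck_on.simps(2))
qed

lemma Ck_on_mult: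
  fixes f g :: "'a::euclidean_space \<Rightarrow> real"
  shows "Ck_on k UNIV f \<Longrightarrow> Ck_on k UNIV g \<Longrightarrow> Ck_on k UNIV (\<lambda>x. f x * g x)"
proof (induction k arbitrary: f g)
  case (Suc k)
  have *: "frechet_derivative (\<lambda>x. f x * g x) (at x) b
      = f x * frechet_derivative g (at x) b + frechet_derivative f (at x) b * g x" for x b
  proof -
    have "(f has_derivative frechet_derivative f (at x)) (at x)"
         "(g has_derivative frechet_derivative g (at x)) (at x)"
      using Suc.prems by (auto simp: frechet_derivative_works)
    from has_derivative_mult[OF this] show ?thesis
      by (subst frechet_derivative_at[symmetric]) auto
  qed
  have "Ck_on k UNIV f" "Ck_on k UNIV g" using Suc.prems Ck_on_lower by blast+
  then show ?case unfolding Ck_on.simps *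
    using Suc.prems by (auto intro!: Suc.IH Ck_on_add)
qed (auto intro!: continuous_intros)

lemma smooth_on_const: "smooth_on UNIV (\<lambda>x. c)"
  by (simp add: smooth_on_def Ck_on_const)

lemma smooth_on_add:
  fixes f g :: "'a::euclidean_space \<Rightarrow> 'b::real_normed_vector"
  shows "smooth_on UNIV f \<Longrightarrow> smooth_on UNIV g \<Longrightarrow> smooth_on UNIV (\<lambda>x. f x + g x)"
  by (simp add: smooth_on_def Ck_on_add)

lemma smooth_on_mult:
  fixes f g :: "'a::euclidean_space \<Rightarrow> real"
  shows "smooth_on UNIV f \<Longrightarrow> smooth_on UNIV g \<Longrightarrow> smooth_on UNIV (\<lambda>x. f x * g x)"
  by (simp add: smooth_on_def Ck_on_mult)

lemma smooth_on_diff: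
  fixes f g :: "'a::euclidean_space \<Rightarrow> real"
  assumes "smooth_on UNIV f" "smooth_on UNIV g"
  shows "smooth_on UNIV (\<lambda>x. f x - g x)"
  using smooth_on_add[OF assms(1) smooth_on_mult[OF smooth_on_const[of "-1"] assms(2)]] by simp

lemma smooth_on_prod:
  fixes f :: "'i \<Rightarrow> 'a::euclidean_space \<Rightarrow> real"
  assumes "\<And>i. i \<in> I \<Longrightarrow> smooth_on UNIV (f i)"
  shows "smooth_on UNIV (\<lambda>x. \<Prod>i\<in>I. f i x)"
  using assms
  by (induction I rule: infinite_finite_induct) (auto intro: smooth_on_mult smooth_on_const)

lemma smooth_on_imp_differentiable: "smooth_on S f \<Longrightarrow> x \<in> S \<Longrightarrow> f differentiable (at x)"
  unfolding smooth_on_def by (metis Ck_on.simps(2))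

lemma smooth_on_has_derivative:
  "smooth_on S f \<Longrightarrow> x \<in> S \<Longrightarrow> (f has_derivative frechet_derivative f (at x)) (at x)"
  using smooth_on_imp_differentiable frechet_derivative_works by blast

lemma smooth_on_frechet_derivative:
  "smooth_on S f \<Longrightarrow> b \<in> Basis \<Longrightarrow> smooth_on S (\<lambda>x. frechet_derivative f (at x) b)"
  unfolding smooth_on_def by (metis Ck_on.simps(2))

lemma smooth_on_imp_continuous_on: "smooth_on S f \<Longrightarrow> continuous_on S f"
  unfolding smooth_on_def using Ck_on_imp_continuous_on by blast

lemma frechet_derivative_real_1:
  assumes "(f has_real_derivative d) (at x)"
  shows "frechet_derivative f (at x) 1 = d"
  using frechet_derivative_at[of f _ x] assms unfolding has_field_derivative_def
  by (metis mult.right_neutral)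

lemma frechet_derivative_real_eq_deriv:
  assumes "f differentiable at (x::real)"
  shows "frechet_derivative f (at x) 1 = deriv f (x::real)"
  by (metis DERIV_deriv_iff_real_differentiable assms frechet_derivative_real_1)

lemma smooth_on_real_deriv:
  assumes "smooth_on UNIV (f::real \<Rightarrow> real)"
  shows "smooth_on UNIV (deriv f)" "(f has_real_derivative deriv f x) (at x)"
proof -
  have "deriv f = (\<lambda>x. frechet_derivative f (at x) 1)"
    using frechet_derivative_real_eq_deriv smooth_on_imp_differentiable[OF assms] by auto
  then show "smooth_on UNIV (deriv f)" using smooth_on_frechet_derivative[OF assms] by simp
  show "(f has_real_derivative deriv f x) (at x)"
    using smooth_on_imp_differentiable[OF assms] DERIV_deriv_iff_real_differentiable by blast
qed

text \<open>An antiderivative of a smooth function is smooth. This is how the smooth step inherits its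
  smoothness from a bump.\<close>
lemma smooth_on_of_deriv:
  assumes "\<And>x. (f has_real_derivative g x) (at x)" "smooth_on UNIV g"
  shows "smooth_on UNIV f"
proof -
  have *: "(\<lambda>x. frechet_derivative f (at x) 1) = g" using frechet_derivative_real_1 assms(1) by blast
  have d: "f differentiable at x" for x using assms(1) real_differentiable_def by blast
  have "Ck_on k UNIV f" for k
  proof (cases k)
    case 0 then show ?thesis using d
      by (auto intro!: continuous_at_imp_continuous_on differentiable_imp_continuous_within)
  next
    case (Suc k) then show ?thesis using d * assms(2) by (simp add: smooth_on_def)
  qed
  then show ?thesis by (simp add: smooth_on_def)
qed

text \<open>Smooth functions of one coordinate: the factors of the product test functions below. In the
  proof the induction runs over all \<open>g\<close> and constant factors \<open>K\<close>, since differentiating turns \<open>g\<close>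
  into its derivative and multiplies \<open>K\<close>.\<close>
lemma smooth_on_comp_affine:
  fixes g :: "real \<Rightarrow> real" and b :: "'a::euclidean_space"
  assumes "smooth_on UNIV g"
  shows "smooth_on UNIV (\<lambda>x. g (c * (x \<bullet> b) + d))"
proof -
  have "Ck_on k UNIV (\<lambda>x. K * g (c * (x \<bullet> b) + d))" for k K
    using assms
  proof (induction k arbitrary: g K)
    case 0
    then have "continuous_on UNIV g" by (rule smooth_on_imp_continuous_on)
    then show ?case
      by (auto intro!: continuous_intros continuous_on_compose2[of UNIV g])
  next
    case (Suc k)
    have D: "((\<lambda>x. K * g (c * (x \<bullet> b) + d)) has_derivative
        (\<lambda>y. (K * (c * (y \<bullet> b))) * deriv g (c * (x \<bullet> b) + d))) (at x)" for x
    proof -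
      have "(g has_derivative (\<lambda>y. deriv g (c * (x \<bullet> b) + d) * y)) (at (c * (x \<bullet> b) + d))"
        using smooth_on_real_deriv(2)[OF Suc.prems] unfolding has_field_derivative_def .
      then have "(g has_derivative (\<lambda>y. deriv g (c * (x \<bullet> b) + d) * y)) (at (c * (x \<bullet> b) + d) within (range (\<lambda>x. c * (x \<bullet> b) + d)))"
        by (rule has_derivative_at_withinI)
      moreover have "((\<lambda>x. c * (x \<bullet> b) + d) has_derivative (\<lambda>y. c * (y \<bullet> b))) (at x)"
        by (auto intro!: derivative_eq_intros)
      ultimately have "((\<lambda>x. g (c * (x \<bullet> b) + d)) has_derivative (\<lambda>y. deriv g (c * (x \<bullet> b) + d) * (c * (y \<bullet> b)))) (at x)"
        by (rule has_derivative_in_compose[where f="\<lambda>x. c * (x \<bullet> b) + d", rotated])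
      from has_derivative_mult_right[OF this, of K] show ?thesis
        by (simp add: algebra_simps)
    qed
    have "frechet_derivative (\<lambda>x. K * g (c * (x \<bullet> b) + d)) (at x) y
         = (K * (c * (y \<bullet> b))) * deriv g (c * (x \<bullet> b) + d)" for x y
      using frechet_derivative_at[OF D] by metis
    moreover have "(\<lambda>x. K * g (c * (x \<bullet> b) + d)) differentiable at x" for x
      using D differentiable_def by blast
    ultimately show ?case
      using Suc.IH[OF smooth_on_real_deriv(1)[OF Suc.prems]] by simp
  qed
  from this[of _ 1] show ?thesis by (simp add: smooth_on_def)
qed

lemma smooth_on_inner: "smooth_on UNIV (\<lambda>x::'a::euclidean_space. x \<bullet> b)"
proof -
  have "smooth_on UNIV (\<lambda>x::real. x)"
    by (rule smooth_on_of_deriv[where g="\<lambda>_. 1"]) (auto simp: smooth_on_const)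
  from smooth_on_comp_affine[OF this, of 1 b 0] show ?thesis by simp
qed

text \<open>The derivatives of \<open>exp (- 1 / x)\<close>, extended by zero to the left half line, are all of this
  form; taking the polynomial as a parameter makes the family closed under differentiation.\<close>
definition flat_exp :: "real poly \<Rightarrow> real \<Rightarrow> real" where
  "flat_exp P x = (if x > 0 then poly P (1 / x) * exp (- 1 / x) else 0)"

lemma tendsto_poly_div_exp_at_top:
  "((\<lambda>y::real. poly P y * exp (- y)) \<longlongrightarrow> 0) at_top"
proof -
  have "((\<lambda>y. \<Sum>i\<le>degree P. coeff P i * (y ^ i / exp y)) \<longlongrightarrow> (\<Sum>i\<le>degree P. coeff P i * 0)) at_top"
    by (intro tendsto_intros tendsto_power_div_exp_0)
  then show ?thesis
    by (simp add: poly_altdef sum_distrib_left exp_minus divide_inverse mult_ac)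
qed

text \<open>With \<open>y = 1 / x\<close> the derivative of \<open>P y * exp (- y)\<close> is \<open>y\<^sup>2 * (P y - P' y) * exp (- y)\<close>. At
  the origin the difference quotient vanishes in the limit because the exponential beats every
  polynomial.\<close>
lemma flat_exp_has_derivative:
  "(flat_exp P has_real_derivative flat_exp ([:0,0,1:] * (P - pderiv P)) x) (at x)"
proof -
  consider "x > 0" | "x < 0" | "x = 0" by linarith
  then show ?thesis
  proof cases
    case 1
    have "((\<lambda>x. poly P (1 / x) * exp (- 1 / x)) has_real_derivative
        flat_exp ([:0,0,1:] * (P - pderiv P)) x) (at x)"
      using 1 unfolding flat_exp_def
      by (auto intro!: derivative_eq_intros poly_DERIV[THEN DERIV_chain2] simp: field_simps power2_eq_square)
    moreover have "eventually (\<lambda>y. flat_exp P y = poly P (1 / y) * exp (- 1 / y)) (nhds x)"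
      using eventually_nhds_in_open[of "{0<..}" x] 1 by (auto simp: flat_exp_def elim!: eventually_mono)
    ultimately show ?thesis by (rule DERIV_cong_ev[OF refl _ refl, THEN iffD2, rotated])
  next
    case 2
    have "((\<lambda>x. 0) has_real_derivative flat_exp ([:0,0,1:] * (P - pderiv P)) x) (at x)"
      using 2 unfolding flat_exp_def by simp
    moreover have "eventually (\<lambda>y. flat_exp P y = 0) (nhds x)"
      using eventually_nhds_in_open[of "{..<0}" x] 2 by (auto simp: flat_exp_def elim!: eventually_mono)
    ultimately show ?thesis by (rule DERIV_cong_ev[OF refl _ refl, THEN iffD2, rotated])
  next
    case 3
    have "((\<lambda>h. flat_exp P h / h) \<longlongrightarrow> 0) (at_right 0)"
    proof -
      have "((\<lambda>y::real. poly ([:0,1:] * P) y * exp (- y)) \<longlongrightarrow> 0) at_top"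
        by (rule tendsto_poly_div_exp_at_top)
      then have "((\<lambda>h::real. poly ([:0,1:] * P) (inverse h) * exp (- inverse h)) \<longlongrightarrow> 0) (at_right 0)"
        by (rule filterlim_compose[OF _ filterlim_inverse_at_top_right])
      then show ?thesis
        by (rule Lim_transform_eventually)
           (auto simp: eventually_at_filter flat_exp_def field_simps)
    qed
    moreover have "((\<lambda>h. flat_exp P h / h) \<longlongrightarrow> 0) (at_left 0)"
      by (rule Lim_transform_eventually[OF tendsto_const])
         (auto simp: eventually_at_filter flat_exp_def)
    ultimately have "((\<lambda>h. flat_exp P h / h) \<longlongrightarrow> 0) (at 0)"
      by (simp add: filterlim_split_at_real)
    then show ?thesis using 3 by (simp add: DERIV_def flat_exp_def)
  qed
qed

lemma smooth_flat_exp: "smooth_on UNIV (flat_exp P)"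
proof -
  have "Ck_on k UNIV (flat_exp P)" for k
  proof (induction k arbitrary: P)
    case 0
    show ?case using flat_exp_has_derivative[of P]
      by (auto intro!: continuous_at_imp_continuous_on DERIV_isCont)
  next
    case (Suc k)
    have "(\<lambda>x. frechet_derivative (flat_exp P) (at x) 1) = flat_exp ([:0,0,1:] * (P - pderiv P))"
      using frechet_derivative_real_1 flat_exp_has_derivative by blast
    moreover have "flat_exp P differentiable at x" for x
      using flat_exp_has_derivative[of P] real_differentiable_def by blast
    ultimately show ?case using Suc.IH by simp
  qed
  then show ?thesis by (simp add: smooth_on_def)
qed

text \<open>The normalized antiderivative of the bump \<open>exp (- 1 / y) * exp (- 1 / (1 - y))\<close> on the unit
  interval. It provides all cut-off functions, in space and in time.\<close>
lemma smooth_step_exists: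
  obtains H :: "real \<Rightarrow> real" where "smooth_on UNIV H" "mono H"
    "\<And>x. x \<le> 0 \<Longrightarrow> H x = 0" "\<And>x. x \<ge> 1 \<Longrightarrow> H x = 1"
proof -
  define \<beta> where "\<beta> y = flat_exp 1 y * flat_exp 1 (1 - y)" for y
  have s\<beta>: "smooth_on UNIV \<beta>"
    using smooth_on_mult[OF smooth_flat_exp[of 1] smooth_on_comp_affine[OF smooth_flat_exp[of 1], of "-1" "1::real" 1]]
    by (simp add: \<beta>_def[abs_def])
  have c\<beta>: "continuous_on S \<beta>" for S
    using smooth_on_imp_continuous_on[OF s\<beta>] continuous_on_subset by blast
  have nn: "\<beta> y \<ge> 0" for y by (simp add: \<beta>_def flat_exp_def)
  have z: "\<beta> y = 0" if "y \<le> 0 \<or> y \<ge> 1" for y using that by (auto simp: \<beta>_def flat_exp_def)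
  have i\<beta>: "\<beta> integrable_on {a..b}" for a b by (intro integrable_continuous_real c\<beta>)
  define F where "F x = integral {0..x} \<beta>" for x
  have F0: "F x = 0" if "x \<le> 0" for x
    unfolding F_def using that by (cases "x = 0") auto
  have F_eq: "F x = integral {-1..x} \<beta>" if "x > -1" for x
  proof (cases "x \<ge> 0")
    case True
    have "integral {-1..0} \<beta> + integral {0..x} \<beta> = integral {-1..x} \<beta>"
      using True by (intro Henstock_Kurzweil_Integration.integral_combine i\<beta>) auto
    moreover have "integral {-1..0} \<beta> = 0"
      by (subst integral_cong[of _ _ "\<lambda>_. 0"]) (auto simp: z)
    ultimately show ?thesis by (simp add: F_def)
  next
    case False
    have "integral {-1..x} \<beta> = 0"
      using False by (subst integral_cong[of _ _ "\<lambda>_. 0"]) (auto simp: z)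
    then show ?thesis using False by (simp add: F0)
  qed
  have DF: "(F has_real_derivative \<beta> x) (at x)" for x
  proof (cases "x > -1")
    case True
    have "((\<lambda>u. integral {-1..u} \<beta>) has_real_derivative \<beta> x) (at x within {-1..x+1})"
      using True by (intro integral_has_real_derivative c\<beta>) auto
    then have "((\<lambda>u. integral {-1..u} \<beta>) has_real_derivative \<beta> x) (at x)"
      using True by (subst (asm) at_within_interior) auto
    moreover have "eventually (\<lambda>y. F y = integral {-1..y} \<beta>) (nhds x)"
      using eventually_nhds_in_open[of "{-1<..}" x] True F_eq by (auto elim!: eventually_mono)
    ultimately show ?thesis by (rule DERIV_cong_ev[OF refl _ refl, THEN iffD2, rotated])
  next
    case False
    have "((\<lambda>x. 0) has_real_derivative \<beta> x) (at x)"
      using False by (simp add: z)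
    moreover have "eventually (\<lambda>y. F y = 0) (nhds x)"
      using eventually_nhds_in_open[of "{..<0}" x] False F0 by (auto elim!: eventually_mono)
    ultimately show ?thesis by (rule DERIV_cong_ev[OF refl _ refl, THEN iffD2, rotated])
  qed
  have F1: "F x = F 1" if "x \<ge> 1" for x
  proof -
    have "integral {0..1} \<beta> + integral {1..x} \<beta> = integral {0..x} \<beta>"
      using that by (intro Henstock_Kurzweil_Integration.integral_combine i\<beta>) auto
    moreover have "integral {1..x} \<beta> = 0"
      by (subst integral_cong[of _ _ "\<lambda>_. 0"]) (auto simp: z)
    ultimately show ?thesis by (simp add: F_def)
  qed
  have mF: "mono F" 
    using DERIV_nonneg_imp_nondecreasing[of _ _ F] DF nn by (metis monoI)
  have "F 1 \<noteq> 0"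
  proof
    assume "F 1 = 0"
    then have "\<beta> (1/2) = 0"
      unfolding F_def using integral_eq_0_iff[of 0 1 \<beta>] c\<beta> nn by auto
    then show False by (simp add: \<beta>_def flat_exp_def)
  qed
  moreover have "F 0 \<le> F 1" using mF by (simp add: monoD)
  ultimately have pos: "F 1 > 0" using F0[of 0] by simp
  show thesis
  proof
    have "smooth_on UNIV F" using smooth_on_of_deriv[OF DF s\<beta>] .
    from smooth_on_mult[OF this smooth_on_const[of "1 / F 1"]]
    show "smooth_on UNIV (\<lambda>x. F x / F 1)" by simp
    show "mono (\<lambda>x. F x / F 1)" using mF pos by (simp add: mono_def divide_right_mono)
    show "F x / F 1 = 0" if "x \<le> 0" for x using F0[OF that] by simp
    show "F x / F 1 = 1" if "x \<ge> 1" for x using F1[OF that] pos by simp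
  qed
qed

section \<open>Test functions and integration by parts\<close>

lemma test_fun_smooth: "test_fun S \<phi> \<Longrightarrow> smooth_on UNIV \<phi>"
  and test_fun_support: "test_fun S \<phi> \<Longrightarrow> x \<notin> S \<Longrightarrow> \<phi> x = 0"
  using closure_subset[of "{x. \<phi> x \<noteq> 0}"] by (auto simp: test_fun_def)

lemma test_fun_continuous: "test_fun S \<phi> \<Longrightarrow> continuous_on T \<phi>"
  using smooth_on_imp_continuous_on[OF test_fun_smooth] continuous_on_subset by blast

lemma test_funI:
  assumes "smooth_on UNIV \<phi>" "compact K" "K \<subseteq> S" "\<And>x. x \<notin> K \<Longrightarrow> \<phi> x = 0"
  shows "test_fun S \<phi>"
proof -
  have "closure {x. \<phi> x \<noteq> 0} \<subseteq> K"
    using assms by (intro closure_minimal) (auto simp: compact_imp_closed)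
  then show ?thesis using assms unfolding test_fun_def
    by (metis bounded_subset closed_closure compact_eq_bounded_closed subset_trans)
qed

lemma test_fun_compact_support:
  assumes "test_fun S \<phi>"
  shows "\<exists>K. compact K \<and> K \<subseteq> S \<and> (\<forall>x. x \<notin> K \<longrightarrow> \<phi> x = 0)"
  using assms closure_subset[of "{x. \<phi> x \<noteq> 0}"] unfolding test_fun_def by blast

lemma test_fun_mult_smooth:
  assumes "test_fun S \<phi>" "smooth_on UNIV g" shows "test_fun S (\<lambda>x. \<phi> x * g x)"
proof -
  obtain K where K: "compact K" "K \<subseteq> S" "\<And>x. x \<notin> K \<Longrightarrow> \<phi> x = 0"
    using test_fun_compact_support[OF assms(1)] by blast
  show ?thesis
    by (rule test_funI[OF smooth_on_mult[OF test_fun_smooth[OF assms(1)] assms(2)] K(1,2)]) (simp add: K(3))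
qed

lemma test_fun_diff:
  assumes "test_fun S \<phi>" "test_fun S \<psi>" shows "test_fun S (\<lambda>x. \<phi> x - \<psi> x)"
proof -
  obtain K where K: "compact K" "K \<subseteq> S" "\<And>x. x \<notin> K \<Longrightarrow> \<phi> x = 0"
    using test_fun_compact_support[OF assms(1)] by blast
  obtain L where L: "compact L" "L \<subseteq> S" "\<And>x. x \<notin> L \<Longrightarrow> \<psi> x = 0"
    using test_fun_compact_support[OF assms(2)] by blast
  show ?thesis
  proof (rule test_funI)
    show "smooth_on UNIV (\<lambda>x. \<phi> x - \<psi> x)" using assms by (intro smooth_on_diff test_fun_smooth)
    show "compact (K \<union> L)" using K(1) L(1) by (rule compact_Un)
    show "K \<union> L \<subseteq> S" using K(2) L(2) by blast
    show "\<phi> x - \<psi> x = 0" if "x \<notin> K \<union> L" for x using that K(3)[of x] L(3)[of x] by simp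
  qed
qed

lemma test_fun_zero: "test_fun S (\<lambda>x. 0)"
  by (rule test_funI[of _ "{}"]) (auto simp: smooth_on_const)

lemma frechet_derivative_zero_outside:
  assumes "compact K" "\<And>x. x \<notin> K \<Longrightarrow> \<phi> x = 0" "x \<notin> K"
  shows "frechet_derivative \<phi> (at x) = (\<lambda>_. 0)"
proof -
  have "((\<lambda>_. 0) has_derivative (\<lambda>_. 0)) (at x)" by simp
  then have "(\<phi> has_derivative (\<lambda>_. 0)) (at x)"
    by (rule has_derivative_transform_within_open[where s="- K"])
       (use assms in \<open>simp_all add: compact_imp_closed open_Compl\<close>)
  from frechet_derivative_at[OF this] show ?thesis by simp
qed

lemma test_fun_deriv:
  assumes "test_fun S \<phi>" "b \<in> Basis"
  shows "test_fun S (\<lambda>x. frechet_derivative \<phi> (at x) b)"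
proof -
  obtain K where K: "compact K" "K \<subseteq> S" "\<And>x. x \<notin> K \<Longrightarrow> \<phi> x = 0" using test_fun_compact_support[OF assms(1)] by blast
  show ?thesis
    using K assms by (intro test_funI[OF _ K(1,2)] smooth_on_frechet_derivative)
      (auto simp: test_fun_def frechet_derivative_zero_outside[OF K(1,3)])
qed

lemma test_fun_bounded:
  assumes "test_fun S \<phi>" obtains M where "M > 0" "\<And>x. \<bar>\<phi> x\<bar> \<le> M"
proof -
  obtain K where K: "compact K" "K \<subseteq> S" "\<And>x. x \<notin> K \<Longrightarrow> \<phi> x = 0" using test_fun_compact_support[OF assms(1)] by blast
  have "bounded (\<phi> ` K)"
    by (intro compact_imp_bounded compact_continuous_image K test_fun_continuous[OF assms])
  then obtain M where "M > 0" "\<And>x. x \<in> K \<Longrightarrow> \<bar>\<phi> x\<bar> \<le> M" unfolding bounded_pos by auto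
  then show ?thesis using that[of M] K(3) by (metis abs_zero less_eq_real_def)
qed

lemma test_fun_integrable:
  fixes \<phi> :: "'a::euclidean_space \<Rightarrow> real"
  assumes "test_fun S \<phi>" shows "integrable lborel \<phi>"
proof -
  obtain K where K: "compact K" "K \<subseteq> S" "\<And>x. x \<notin> K \<Longrightarrow> \<phi> x = 0" using test_fun_compact_support[OF assms(1)] by blast
  have "integrable lborel (\<lambda>x. indicator K x *\<^sub>R \<phi> x)"
    by (intro borel_integrable_compact K test_fun_continuous[OF assms])
  moreover have "(\<lambda>x. indicator K x *\<^sub>R \<phi> x) = \<phi>" using K(3) by (force simp: indicator_def)
  ultimately show ?thesis by simp
qed

lemma loc_integrable_mult_bounded:
  assumes u: "loc_integrable \<Omega> u" and K: "compact K" "K \<subseteq> \<Omega>" and "open \<Omega>"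
    and g: "g \<in> borel_measurable borel" "\<And>x. x \<notin> K \<Longrightarrow> g x = 0" "\<And>x. \<bar>g x\<bar> \<le> (M::real)"
  shows "integrable (lebesgue_on \<Omega>) (\<lambda>x. u x * g x)"
proof -
  have Kl: "K \<in> sets lebesgue" "\<Omega> \<in> sets lebesgue" using K assms(4) by (auto simp: compact_imp_closed)
  have "integrable (lebesgue_on K) u" using u K by (simp add: loc_integrable_def)
  then have i: "integrable lebesgue (\<lambda>x. if x \<in> K then u x else 0)"
    by (simp add: Lebesgue_Measure.integrable_restrict_UNIV Kl)
  have "integrable lebesgue (\<lambda>x. (if x \<in> K then u x else 0) * g x)"
  proof (rule Bochner_Integration.integrable_bound[OF integrable_mult_left[OF integrable_norm[OF i], of M]])
    show "(\<lambda>x. (if x \<in> K then u x else 0) * g x) \<in> borel_measurable lebesgue"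
      using borel_measurable_integrable[OF i] measurable_completion[of g lborel borel] g(1)
      by (intro borel_measurable_times) auto
    have "norm ((if x \<in> K then u x else 0) * g x) \<le> norm (norm (if x \<in> K then u x else 0) * M)" for x
      using g(3)[of x] by (auto simp: abs_mult intro!: mult_left_mono)
    then show "AE x in lebesgue. norm ((if x \<in> K then u x else 0) * g x) \<le> norm (norm (if x \<in> K then u x else 0) * M)"
      by (rule AE_I2)
  qed
  moreover have "(\<lambda>x. (if x \<in> K then u x else 0) * g x) = (\<lambda>x. if x \<in> \<Omega> then u x * g x else 0)"
    using g(2) K by (auto simp: fun_eq_iff)
  ultimately show ?thesis using Lebesgue_Measure.integrable_restrict_UNIV[OF Kl(2), of "\<lambda>x. u x * g x"] by simp
qed

lemma loc_integrable_mult_test_fun: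
  assumes "loc_integrable \<Omega> u" "open \<Omega>" "test_fun \<Omega> \<phi>"
  shows "integrable (lebesgue_on \<Omega>) (\<lambda>x. u x * \<phi> x)"
proof -
  obtain K where K: "compact K" "K \<subseteq> \<Omega>" "\<And>x. x \<notin> K \<Longrightarrow> \<phi> x = 0" using test_fun_compact_support[OF assms(3)] by blast
  obtain M where "\<And>x. \<bar>\<phi> x\<bar> \<le> M" using test_fun_bounded[OF assms(3)] by metis
  moreover have "\<phi> \<in> borel_measurable borel"
    using test_fun_continuous[OF assms(3)] by (rule borel_measurable_continuous_onI)
  ultimately show ?thesis using assms K by (intro loc_integrable_mult_bounded[OF assms(1) K(1,2)]) auto
qed

lemma integral_lebesgue_on_support:
  assumes "open \<Omega>" "test_fun \<Omega> \<phi>"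
  shows "(LINT x|lebesgue_on \<Omega>. \<phi> x) = (LINT x|lborel. \<phi> x)"
proof -
  have "(\<lambda>x. if x \<in> \<Omega> then \<phi> x else 0) = \<phi>"
    using test_fun_support[OF assms(2)] by auto
  moreover have "(LINT x|lebesgue. \<phi> x) = (LINT x|lborel. \<phi> x)"
    using test_fun_continuous[OF assms(2)] by (intro integral_completion) (auto intro!: borel_measurable_continuous_onI)
  ultimately show ?thesis
    using Lebesgue_Measure.integral_restrict_UNIV[of \<Omega> \<phi>] assms(1) by simp
qed

text \<open>By translation invariance the difference quotients of \<open>\<psi>\<close> have integral zero. They are bounded
  by the supremum of the derivative and vanish outside a fixed ball, so that dominated convergence
  applies.\<close>
lemma integral_test_fun_deriv_lborel:
  fixes \<psi> :: "'a::euclidean_space \<Rightarrow> real"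
  assumes \<psi>: "test_fun S \<psi>" and b: "b \<in> Basis"
  shows "(LINT x|lborel. frechet_derivative \<psi> (at x) b) = 0"
proof -
  define h where "h n = inverse (real (Suc n))" for n
  have h: "0 < h n" "h n \<le> 1" for n by (auto simp: h_def divide_simps)
  have h0: "h \<longlonglongrightarrow> 0" unfolding h_def by (rule LIMSEQ_inverse_real_of_nat)
  define d where "d n x = (\<psi> (h n *\<^sub>R b + x) - \<psi> x) / h n" for n x
  obtain K where K: "compact K" "\<And>x. x \<notin> K \<Longrightarrow> \<psi> x = 0" using test_fun_compact_support[OF \<psi>] by blast
  obtain R where R: "\<And>x. x \<in> K \<Longrightarrow> norm x \<le> R" using compact_imp_bounded[OF K(1)] unfolding bounded_iff by blast
  obtain M where M: "M > 0" "\<And>x. \<bar>frechet_derivative \<psi> (at x) b\<bar> \<le> M"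
    using test_fun_bounded[OF test_fun_deriv[OF \<psi> b]] by metis
  have D: "((\<lambda>t. \<psi> (t *\<^sub>R b + x)) has_real_derivative frechet_derivative \<psi> (at (t *\<^sub>R b + x)) b) (at t)" for t x
  proof -
    have f: "(\<psi> has_derivative frechet_derivative \<psi> (at (t *\<^sub>R b + x))) (at (t *\<^sub>R b + x) within range (\<lambda>t. t *\<^sub>R b + x))"
      using smooth_on_has_derivative[OF test_fun_smooth[OF \<psi>]] by (auto intro: has_derivative_at_withinI)
    have "((\<lambda>t. t *\<^sub>R b + x) has_derivative (\<lambda>s. s *\<^sub>R b)) (at t)"
      by (auto intro!: derivative_eq_intros)
    from has_derivative_in_compose[OF this f]
    have "((\<lambda>t. \<psi> (t *\<^sub>R b + x)) has_derivative (\<lambda>s. frechet_derivative \<psi> (at (t *\<^sub>R b + x)) (s *\<^sub>R b))) (at t)" .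
    moreover have "frechet_derivative \<psi> (at y) (s *\<^sub>R b) = s * frechet_derivative \<psi> (at y) b" for y s
      using linear_frechet_derivative[OF smooth_on_imp_differentiable[OF test_fun_smooth[OF \<psi>]]]
      by (simp add: linear_cmul)
    ultimately show ?thesis by (simp add: has_field_derivative_def mult_commute_abs)
  qed
  have lim: "(\<lambda>n. d n x) \<longlonglongrightarrow> frechet_derivative \<psi> (at x) b" for x
  proof -
    have "((\<lambda>t. (\<psi> (t *\<^sub>R b + x) - \<psi> x) / t) \<longlongrightarrow> frechet_derivative \<psi> (at x) b) (at 0)"
      using D[of x 0] by (simp add: DERIV_def)
    moreover have "filterlim h (at 0) sequentially"
      using h0 h(1) by (auto simp: filterlim_at intro!: always_eventually) (metis less_irrefl)
    ultimately show ?thesis unfolding d_def by (rule filterlim_compose)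
  qed
  \<comment> \<open>The step \<open>h n\<close> is at most 1, hence the enlargement of the radius by 1.\<close>
  have bound: "\<bar>d n x\<bar> \<le> M * indicator (cball 0 (R + 1)) x" for n x
  proof (cases "x \<in> cball 0 (R+1)")
    case True
    obtain z where "\<psi> (h n *\<^sub>R b + x) - \<psi> (0 *\<^sub>R b + x) = (h n - 0) * frechet_derivative \<psi> (at (z *\<^sub>R b + x)) b"
      using MVT2[of 0 "h n" "\<lambda>t. \<psi> (t *\<^sub>R b + x)" "\<lambda>z. frechet_derivative \<psi> (at (z *\<^sub>R b + x)) b"] h(1) D by blast
    then have "d n x = frechet_derivative \<psi> (at (z *\<^sub>R b + x)) b" using h(1)[of n] by (simp add: d_def)
    then show ?thesis using True M(2) by simp
  next
    case False
    then have "x \<notin> K" using R by fastforce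
    moreover have "h n *\<^sub>R b + x \<notin> K"
    proof
      assume "h n *\<^sub>R b + x \<in> K"
      then have "norm (h n *\<^sub>R b + x) \<le> R" by (rule R)
      then have "norm x \<le> R + 1" using norm_triangle_ineq2[of x "- (h n *\<^sub>R b)"] h[of n] b by (simp add: add.commute)
      then show False using False by simp
    qed
    ultimately have "d n x = 0" by (simp add: d_def K)
    then show ?thesis using False by simp
  qed
  have i: "integrable lborel \<psi>" by (rule test_fun_integrable[OF \<psi>])
  have c: "\<psi> \<in> borel_measurable borel" using test_fun_continuous[OF \<psi>] by (rule borel_measurable_continuous_onI)
  have sh: "integrable lborel (\<lambda>x. \<psi> (v + x))" "(LINT x|lborel. \<psi> (v + x)) = (LINT x|lborel. \<psi> x)" for v
  proof -
    have "integrable (distr lborel borel ((+) v)) \<psi>" using i by (simp add: lborel_distr_plus)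
    then show "integrable lborel (\<lambda>x. \<psi> (v + x))" by (subst (asm) integrable_distr_eq) (auto simp: c)
    have "(LINT x|distr lborel borel ((+) v). \<psi> x) = (LINT x|lborel. \<psi> (v + x))"
      by (subst integral_distr) (auto simp: c)
    then show "(LINT x|lborel. \<psi> (v + x)) = (LINT x|lborel. \<psi> x)" by (simp add: lborel_distr_plus)
  qed
  have z: "(LINT x|lborel. d n x) = 0" for n
    unfolding d_def using sh i by simp
  have "(\<lambda>n. LINT x|lborel. d n x) \<longlonglongrightarrow> (LINT x|lborel. frechet_derivative \<psi> (at x) b)"
  proof (rule integral_dominated_convergence[where w="\<lambda>x. M * indicator (cball 0 (R + 1)) x"])
    show "(\<lambda>x. frechet_derivative \<psi> (at x) b) \<in> borel_measurable lborel"
      using test_fun_continuous[OF test_fun_deriv[OF \<psi> b]] by (simp add: borel_measurable_continuous_onI)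
    show "d n \<in> borel_measurable lborel" for n
      unfolding d_def using borel_measurable_integrable[OF sh(1)] borel_measurable_integrable[OF i]
      by (intro borel_measurable_divide borel_measurable_diff) auto
    show "integrable lborel (\<lambda>x::'a. M * indicator (cball 0 (R + 1)) x)"
      by (intro integrable_mult_right integrable_real_indicator) (auto simp flip: infinity_ennreal_def intro!: emeasure_bounded_finite)
  qed (use lim bound in auto)
  then show ?thesis using z by (simp add: LIMSEQ_const_iff)
qed

lemma integral_test_fun_deriv:
  assumes "open \<Omega>" "test_fun \<Omega> \<psi>" "b \<in> Basis"
  shows "(LINT x|lebesgue_on \<Omega>. frechet_derivative \<psi> (at x) b) = 0"
  using integral_lebesgue_on_support[OF assms(1) test_fun_deriv[OF assms(2,3)]]
    integral_test_fun_deriv_lborel[OF assms(2,3)] by simp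

lemma frechet_derivative_mult_smooth:
  fixes f g :: "'a::euclidean_space \<Rightarrow> real"
  assumes "smooth_on UNIV f" "smooth_on UNIV g"
  shows "frechet_derivative (\<lambda>x. f x * g x) (at x) b
      = f x * frechet_derivative g (at x) b + frechet_derivative f (at x) b * g x"
  using has_derivative_mult[OF smooth_on_has_derivative[OF assms(1)] smooth_on_has_derivative[OF assms(2)]]
  by (subst frechet_derivative_at[symmetric]) auto

lemma loc_integrable_smooth:
  fixes g :: "'a::euclidean_space \<Rightarrow> real"
  assumes "smooth_on UNIV g" shows "loc_integrable \<Omega> g"
  unfolding loc_integrable_def
proof safe
  fix K :: "'a set" assume K: "compact K" "K \<subseteq> \<Omega>"
  have "integrable lborel (\<lambda>x. indicator K x *\<^sub>R g x)"
    using smooth_on_imp_continuous_on[OF assms] by (intro borel_integrable_compact K) (rule continuous_on_subset, auto)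
  then have "integrable lebesgue (\<lambda>x. indicator K x *\<^sub>R g x)"
    using integrable_completion[OF borel_measurable_integrable] by blast
  then show "integrable (lebesgue_on K) g" using K by (subst integrable_restrict_space) (auto simp: compact_imp_closed)
qed

lemma integral_by_parts_test_fun:
  assumes "open \<Omega>" "smooth_on UNIV f" "test_fun \<Omega> \<psi>" "b \<in> Basis"
  shows "(LINT x|lebesgue_on \<Omega>. f x * frechet_derivative \<psi> (at x) b) =
        - (LINT x|lebesgue_on \<Omega>. frechet_derivative f (at x) b * \<psi> x)"
proof -
  have ps: "smooth_on UNIV \<psi>" using assms by (simp add: test_fun_smooth)
  have "test_fun \<Omega> (\<lambda>x. \<psi> x * f x)" using assms by (intro test_fun_mult_smooth)
  from integral_test_fun_deriv[OF assms(1) this assms(4)]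
  have "(LINT x|lebesgue_on \<Omega>. frechet_derivative f (at x) b * \<psi> x + f x * frechet_derivative \<psi> (at x) b) = 0"
    unfolding frechet_derivative_mult_smooth[OF ps assms(2)] by (simp add: algebra_simps)
  moreover have "integrable (lebesgue_on \<Omega>) (\<lambda>x. frechet_derivative f (at x) b * \<psi> x)"
    by (intro loc_integrable_mult_test_fun loc_integrable_smooth smooth_on_frechet_derivative assms)
  moreover have "integrable (lebesgue_on \<Omega>) (\<lambda>x. f x * frechet_derivative \<psi> (at x) b)"
    by (intro loc_integrable_mult_test_fun loc_integrable_smooth test_fun_deriv assms)
  ultimately show ?thesis by simp
qed

text \<open>Rescaled steps in each coordinate, one rising at the lower face and one falling at the upper
  face.\<close>
lemma box_approx_test_fun:
  fixes a b :: "'a::euclidean_space"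
  assumes "cbox a b \<subseteq> \<Omega>"
  obtains \<psi> :: "nat \<Rightarrow> 'a \<Rightarrow> real" where "\<And>n. test_fun \<Omega> (\<psi> n)"
    "\<And>n x. 0 \<le> \<psi> n x \<and> \<psi> n x \<le> indicator (cbox a b) x" "\<And>x. (\<lambda>n. \<psi> n x) \<longlonglongrightarrow> indicator (box a b) x"
proof -
  obtain H :: "real \<Rightarrow> real" where H: "smooth_on UNIV H" "mono H"
    "\<And>x. x \<le> 0 \<Longrightarrow> H x = 0" "\<And>x. x \<ge> 1 \<Longrightarrow> H x = 1" using smooth_step_exists by metis
  have H01: "0 \<le> H x" "H x \<le> 1" for x
    using monoD[OF H(2), of "min x 0" x] monoD[OF H(2), of x "max x 1"] H(3)[of "min x 0"] H(4)[of "max x 1"] by auto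
  define \<psi> where "\<psi> n x = (\<Prod>i\<in>Basis. H (real n * (x \<bullet> i) + - real n * (a \<bullet> i)) * H (- real n * (x \<bullet> i) + real n * (b \<bullet> i)))" for n and x :: 'a
  have out: "\<psi> n x = 0" if "x \<notin> box a b" for n x
  proof -
    from that obtain i where i: "i \<in> Basis" "x \<bullet> i \<le> a \<bullet> i \<or> x \<bullet> i \<ge> b \<bullet> i" by (auto simp: mem_box not_less)
    then have "real n * (x \<bullet> i) \<le> real n * (a \<bullet> i) \<or> real n * (x \<bullet> i) \<ge> real n * (b \<bullet> i)"
      by (auto intro: mult_left_mono)
    then have "H (real n * (x \<bullet> i) + - real n * (a \<bullet> i)) * H (- real n * (x \<bullet> i) + real n * (b \<bullet> i)) = 0"
      using H(3) by auto
    then show ?thesis unfolding \<psi>_def using i(1) by (intro prod_zero) auto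
  qed
  show thesis
  proof
    show "test_fun \<Omega> (\<psi> n)" for n
    proof (rule test_funI[of _ "cbox a b"])
      show "smooth_on UNIV (\<psi> n)" unfolding \<psi>_def
        by (intro smooth_on_prod smooth_on_mult smooth_on_comp_affine H)
      show "\<psi> n x = 0" if "x \<notin> cbox a b" for x using out that box_subset_cbox by blast
    qed (use assms in auto)
    have "0 \<le> \<psi> n x" "\<psi> n x \<le> 1" for n x
      unfolding \<psi>_def by (auto intro!: prod_nonneg prod_le_1 mult_nonneg_nonneg mult_le_one H01)
    moreover have "\<psi> n x = 0" if "x \<notin> cbox a b" for n x
      using that box_subset_cbox[of a b] by (intro out) auto
    ultimately show "0 \<le> \<psi> n x \<and> \<psi> n x \<le> indicator (cbox a b) x" for n x
      by (cases "x \<in> cbox a b") auto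
    show "(\<lambda>n. \<psi> n x) \<longlonglongrightarrow> indicator (box a b) x" for x
    proof (cases "x \<in> box a b")
      case True
      have "(\<lambda>n. \<psi> n x) \<longlonglongrightarrow> (\<Prod>i\<in>(Basis::'a set). 1 * 1)"
        unfolding \<psi>_def
      proof (intro tendsto_prod tendsto_mult)
        fix i :: 'a assume i: "i \<in> Basis"
        have *: "(\<lambda>n. H (real n * c)) \<longlonglongrightarrow> 1" if "c > 0" for c
        proof -
          obtain N :: nat where N: "1 / c \<le> N" using real_arch_simple by blast
          have "H (real n * c) = 1" if "n \<ge> N" for n
          proof -
            have "1 / c \<le> real n" using N that by linarith
            then show ?thesis using \<open>c > 0\<close> by (intro H(4)) (simp add: field_simps)
          qed
          then show ?thesis by (intro tendsto_eventually) (auto simp: eventually_sequentially)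
        qed
        from True i have "a \<bullet> i < x \<bullet> i" "x \<bullet> i < b \<bullet> i" by (auto simp: mem_box)
        then show "(\<lambda>n. H (real n * (x \<bullet> i) + - real n * (a \<bullet> i))) \<longlonglongrightarrow> 1"
             "(\<lambda>n. H (- real n * (x \<bullet> i) + real n * (b \<bullet> i))) \<longlonglongrightarrow> 1"
          using *[of "x \<bullet> i - a \<bullet> i"] *[of "b \<bullet> i - x \<bullet> i"] by (simp_all add: algebra_simps)
      qed
      then show ?thesis using True by simp
    qed (simp add: out)
  qed
qed

text \<open>Approximating indicators of boxes by test functions shows that \<open>g\<close> has integral zero over each
  small box. The sets over which a fixed localization of \<open>g\<close> has integral zero form a Dynkin system,
  so they comprise all Borel sets, and \<open>g\<close> vanishes almost everywhere in the box. Countably many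
  boxes cover \<open>\<Omega>\<close>.\<close>
lemma fundamental_lemma_calculus_of_variations:
  fixes g :: "'a::euclidean_space \<Rightarrow> real"
  assumes g: "loc_integrable \<Omega> g" and "open \<Omega>"
    and test: "\<And>\<psi>. test_fun \<Omega> \<psi> \<Longrightarrow> (LINT x|lebesgue_on \<Omega>. g x * \<psi> x) = 0"
  shows "AE x in lebesgue_on \<Omega>. g x = 0"
proof -
  have \<Omega>[measurable]: "\<Omega> \<in> sets lebesgue" using assms(2) by simp
  have box0: "(LINT x|lebesgue. g x * indicator (box a b) x) = 0"
    if ab: "cbox a b \<subseteq> \<Omega>" for a b
  proof -
    obtain \<psi> :: "nat \<Rightarrow> 'a \<Rightarrow> real" where \<psi>: "\<And>n. test_fun \<Omega> (\<psi> n)"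
      "\<And>n x. 0 \<le> \<psi> n x \<and> \<psi> n x \<le> indicator (cbox a b) x" "\<And>x. (\<lambda>n. \<psi> n x) \<longlonglongrightarrow> indicator (box a b) x"
      using box_approx_test_fun[OF ab] by metis
    have i: "integrable (lebesgue_on \<Omega>) (\<lambda>x. g x * indicator (cbox a b) x)"
      by (rule loc_integrable_mult_bounded[OF g _ ab assms(2), where M=1]) (auto simp: indicator_def)
    have i': "integrable (lebesgue_on \<Omega>) (\<lambda>x. g x * indicator (box a b) x)"
      using box_subset_cbox[of a b]
      by (intro loc_integrable_mult_bounded[OF g _ ab assms(2), where M=1]) (auto simp: indicator_def)
    have "(\<lambda>n. LINT x|lebesgue_on \<Omega>. g x * \<psi> n x) \<longlonglongrightarrow> (LINT x|lebesgue_on \<Omega>. g x * indicator (box a b) x)"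
    proof (rule integral_dominated_convergence[OF _ _ integrable_norm[OF i]])
      show "AE x in lebesgue_on \<Omega>. (\<lambda>n. g x * \<psi> n x) \<longlonglongrightarrow> g x * indicator (box a b) x"
        by (intro AE_I2 tendsto_intros \<psi>)
      show "AE x in lebesgue_on \<Omega>. norm (g x * \<psi> n x) \<le> norm (g x * indicator (cbox a b) x)" for n
        using \<psi>(2)[of n] by (intro AE_I2) (auto simp: abs_mult intro!: mult_left_mono)
    qed (use i' borel_measurable_integrable loc_integrable_mult_test_fun[OF g assms(2) \<psi>(1)] in auto)
    then have "(LINT x|lebesgue_on \<Omega>. g x * indicator (box a b) x) = 0"
      by (simp add: test \<psi>(1) LIMSEQ_const_iff)
    moreover have "(\<lambda>x. if x \<in> \<Omega> then g x * indicator (box a b) x else 0) = (\<lambda>x. g x * indicator (box a b) x)"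
      using ab box_subset_cbox[of a b] by (auto simp: fun_eq_iff indicator_def)
    ultimately show ?thesis using Lebesgue_Measure.integral_restrict_UNIV[OF \<Omega>, of "\<lambda>x. g x * indicator (box a b) x"] by simp
  qed
  have ae_box: "AE x in lebesgue. x \<in> box a b \<longrightarrow> g x = 0" if ab: "cbox a b \<subseteq> \<Omega>" for a b
  proof -
    define G where "G x = g x * indicator (box a b) x" for x
    have "integrable (lebesgue_on \<Omega>) G" unfolding G_def
      using box_subset_cbox[of a b]
      by (intro loc_integrable_mult_bounded[OF g _ ab assms(2), where M=1]) (auto simp: indicator_def)
    moreover have "(\<lambda>x. if x \<in> \<Omega> then G x else 0) = G"
      using ab box_subset_cbox[of a b] by (auto simp: fun_eq_iff G_def indicator_def)
    ultimately have iG: "integrable lebesgue G" using Lebesgue_Measure.integrable_restrict_UNIV[OF \<Omega>, of G] by simp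
    \<comment> \<open>A Borel representative, since the Dynkin argument reaches Borel sets only.\<close>
    obtain G' where G': "G' \<in> borel_measurable lborel" "AE x in lborel. G x = G' x"
      using completion_ex_borel_measurable_real[of G lborel] borel_measurable_integrable[OF iG] by auto
    have ae': "AE x in lebesgue. G x = G' x" using G'(2) by (rule AE_completion)
    have G'm: "G' \<in> borel_measurable lebesgue" using G'(1) by (rule measurable_completion)
    have "integrable lebesgue G'" using integrable_cong_AE[of G lebesgue G'] iG ae' G'm by auto
    then have iG': "integrable lborel G'" using integrable_completion[OF G'(1)] by simp
    have iI: "integrable lborel (\<lambda>x. G' x * indicator A x)" if "A \<in> sets borel" for A
      using integrable_mult_indicator[OF _ iG', of A] that by (simp add: mult.commute)
    have conv: "(LINT x|lborel. G' x * indicator A x) = (LINT x|lebesgue. G x * indicator A x)"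
      if [measurable]: "A \<in> sets borel" for A
    proof -
      have "(LINT x|lborel. G' x * indicator A x) = (LINT x|lebesgue. G' x * indicator A x)"
        using G'(1) by (intro integral_completion[symmetric]) auto
      also have "\<dots> = (LINT x|lebesgue. G x * indicator A x)"
      proof (rule integral_cong_AE)
        have [measurable]: "A \<in> sets lebesgue" using that by (simp add: sets_completionI_sets)
        note [measurable] = G'm borel_measurable_integrable[OF iG]
        show "(\<lambda>x. G' x * indicator A x) \<in> borel_measurable lebesgue" by measurable
        show "(\<lambda>x. G x * indicator A x) \<in> borel_measurable lebesgue" by measurable
      qed (use ae' in auto)
      finally show ?thesis .
    qed
    have all0: "(LINT x|lborel. G' x * indicator A x) = 0" if "A \<in> sets borel" for A
    proof -
      let ?P = "\<lambda>A. (LINT x|lborel. G' x * indicator A x) = 0"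
      let ?E = "range (\<lambda>(a, b). box a b :: 'a set)"
      have sb: "sets borel = sigma_sets UNIV ?E"
        by (subst borel_eq_box) (rule sets_measure_of, simp)
      have st: "Int_stable ?E"
      proof (rule Int_stableI)
        fix A B assume "A \<in> ?E" "B \<in> ?E"
        then obtain c d c' d' where "A = box c d" "B = box c' d'" by auto
        then show "A \<inter> B \<in> ?E" by (metis (no_types, lifting) box_Int_box case_prod_conv rangeI)
      qed
      have tot: "(LINT x|lborel. G' x) = 0"
      proof -
        have "(LINT x|lborel. G' x) = (LINT x|lebesgue. G x * indicator UNIV x)"
          using conv[of UNIV] by simp
        then show ?thesis using box0[OF ab] by (simp add: G_def)
      qed
      have sub: "?E \<subseteq> Pow UNIV" by simp
      show ?thesis
        using st sub that[unfolded sb]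
      proof (induction A rule: sigma_sets_induct_disjoint)
        case (basic A)
        then obtain c d where A: "A = box c d" by auto
        define e f where "e = (\<Sum>i\<in>Basis. max (a \<bullet> i) (c \<bullet> i) *\<^sub>R i)" and "f = (\<Sum>i\<in>Basis. min (b \<bullet> i) (d \<bullet> i) *\<^sub>R i)"
        have 1: "box a b \<inter> box c d = box e f" unfolding e_def f_def by (rule box_Int_box)
        have "cbox e f \<subseteq> cbox a b" unfolding e_def f_def by (auto simp: mem_box)
        then have "cbox e f \<subseteq> \<Omega>" using ab by blast
        from box0[OF this] have "(LINT x|lebesgue. G x * indicator A x) = 0"
          by (simp add: G_def A 1[symmetric] indicator_inter_arith mult_ac)
        then show ?case using conv[of A] A by simp
      next
        case empty then show ?case by simp
      next
        case (compl A)
        then have "A \<in> sets borel" by (simp add: sb)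
        have "(LINT x|lborel. G' x * indicator (UNIV - A) x) = (LINT x|lborel. G' x - G' x * indicator A x)"
          by (intro Bochner_Integration.integral_cong) (auto simp: indicator_def)
        also have "\<dots> = 0" using iG' iI[OF \<open>A \<in> sets borel\<close>] tot compl by simp
        finally show ?case .
      next
        case (union A)
        then have Ai: "A i \<in> sets borel" for i by (auto simp: sb)
        then have Au: "(\<Union>i. A i) \<in> sets borel" by auto
        have "(LINT x:(\<Union>i. A i)|lborel. G' x) = (\<Sum>i. (LINT x:(A i)|lborel. G' x))"
          using union(1) Ai iI[OF Au]
          by (intro lebesgue_integral_countable_add) (auto simp: disjoint_family_on_def set_integrable_def mult.commute)
        then show ?case using union(3) by (simp add: set_lebesgue_integral_def mult.commute)
      qed
    qed
    have "AE x in lborel. G' x = 0"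
      using all0 by (intro density_unique_real iG') (simp_all add: set_lebesgue_integral_def mult.commute)
    then have "AE x in lebesgue. G' x = 0" by (rule AE_completion)
    with ae' show ?thesis by eventually_elim (auto simp: G_def indicator_def)
  qed
  obtain \<D> where \<D>: "countable \<D>" "\<And>X. X \<in> \<D> \<Longrightarrow> X \<subseteq> \<Omega>" "\<And>X. X \<in> \<D> \<Longrightarrow> \<exists>a b. X = cbox a b" "\<Union>\<D> = \<Omega>"
    using open_countable_Union_open_cbox[OF assms(2)] by (metis PowD subsetD)
  have "AE x in lebesgue. x \<in> X \<longrightarrow> g x = 0" if X: "X \<in> \<D>" for X
  proof -
    obtain a b where ab: "X = cbox a b" using \<D>(3)[OF X] by blast
    have "AE x in lborel. x \<notin> cbox a b - box a b" by (rule AE_not_in[OF null_sets_cbox_Diff_box])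
    then have "AE x in lebesgue. x \<notin> cbox a b - box a b" by (rule AE_completion)
    moreover have "AE x in lebesgue. x \<in> box a b \<longrightarrow> g x = 0"
      using ae_box[of a b] \<D>(2)[OF X] ab by blast
    ultimately show ?thesis by eventually_elim (auto simp: ab)
  qed
  then have "AE x in lebesgue. \<forall>X\<in>\<D>. x \<in> X \<longrightarrow> g x = 0"
    using AE_ball_countable[OF \<D>(1), of "\<lambda>x X. x \<in> X \<longrightarrow> g x = 0" lebesgue] by blast
  then have "AE x in lebesgue. x \<in> \<Omega> \<longrightarrow> g x = 0"
    by eventually_elim (use \<D>(4) in auto)
  then show ?thesis by (simp add: AE_restrict_space_iff)
qed

section \<open>Weak derivatives\<close>

lemma borel_measurable_lebesgue_on_AE:
  fixes f g :: "'a::euclidean_space \<Rightarrow> real"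
  assumes f: "f \<in> borel_measurable (lebesgue_on \<Omega>)" and \<Omega>: "\<Omega> \<in> sets lebesgue"
    and ae: "AE x in lebesgue_on \<Omega>. f x = g x"
  shows "g \<in> borel_measurable (lebesgue_on \<Omega>)"
proof -
  let ?f = "\<lambda>x. if x \<in> \<Omega> then f x else 0" and ?g = "\<lambda>x. if x \<in> \<Omega> then g x else 0"
  have "?f \<in> borel_measurable lebesgue"
    using f \<Omega> borel_measurable_if[of \<Omega> f] by simp
  moreover have "AE x in lebesgue. ?f x = ?g x"
    using ae \<Omega> by (simp add: AE_restrict_space_iff)
  ultimately have "?g \<in> borel_measurable lebesgue" by (rule borel_measurable_AE)
  then show ?thesis using \<Omega> borel_measurable_if[of \<Omega> g] by simp
qed

lemma loc_integrable_diff: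
  "loc_integrable \<Omega> u \<Longrightarrow> loc_integrable \<Omega> v \<Longrightarrow> loc_integrable \<Omega> (\<lambda>x. u x - v x)"
  by (auto simp: loc_integrable_def)

lemma weak_partial_diff:
  assumes "open \<Omega>" "b \<in> Basis" "weak_partial \<Omega> b u g" "weak_partial \<Omega> b v k"
  shows "weak_partial \<Omega> b (\<lambda>x. u x - v x) (\<lambda>x. g x - k x)"
  unfolding weak_partial_def
proof (intro conjI allI impI)
  show "loc_integrable \<Omega> (\<lambda>x. u x - v x)" "loc_integrable \<Omega> (\<lambda>x. g x - k x)"
    using assms by (auto simp: weak_partial_def intro: loc_integrable_diff)
  fix \<phi> assume t: "test_fun \<Omega> \<phi>"
  note i = loc_integrable_mult_test_fun[OF _ assms(1) t] loc_integrable_mult_test_fun[OF _ assms(1) test_fun_deriv[OF t assms(2)]]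
  have "(LINT x|lebesgue_on \<Omega>. (u x - v x) * frechet_derivative \<phi> (at x) b)
      = (LINT x|lebesgue_on \<Omega>. u x * frechet_derivative \<phi> (at x) b) - (LINT x|lebesgue_on \<Omega>. v x * frechet_derivative \<phi> (at x) b)"
    using assms i by (simp add: weak_partial_def left_diff_distrib)
  also have "\<dots> = - ((LINT x|lebesgue_on \<Omega>. g x * \<phi> x) - (LINT x|lebesgue_on \<Omega>. k x * \<phi> x))"
    using assms t by (simp add: weak_partial_def)
  also have "\<dots> = - (LINT x|lebesgue_on \<Omega>. (g x - k x) * \<phi> x)"
    using assms i by (simp add: weak_partial_def left_diff_distrib)
  finally show "(LINT x|lebesgue_on \<Omega>. (u x - v x) * frechet_derivative \<phi> (at x) b) = - (LINT x|lebesgue_on \<Omega>. (g x - k x) * \<phi> x)" .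
qed

lemma weak_partial_unique:
  assumes "open \<Omega>" "b \<in> Basis" "weak_partial \<Omega> b u g" "weak_partial \<Omega> b u k"
  shows "AE x in lebesgue_on \<Omega>. g x = k x"
proof -
  have w: "weak_partial \<Omega> b (\<lambda>x. 0) (\<lambda>x. g x - k x)"
    using weak_partial_diff[OF assms] by simp
  have "AE x in lebesgue_on \<Omega>. g x - k x = 0"
    using w by (intro fundamental_lemma_calculus_of_variations assms) (auto simp: weak_partial_def)
  then show ?thesis by simp
qed

lemma weak_partial_smooth:
  assumes "open \<Omega>" "b \<in> Basis" "smooth_on UNIV f"
  shows "weak_partial \<Omega> b f (\<lambda>x. frechet_derivative f (at x) b)"
  unfolding weak_partial_def
  using assms by (auto intro!: loc_integrable_smooth smooth_on_frechet_derivative integral_by_parts_test_fun)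

text \<open>The chosen weak derivative may be computed from any weak derivative at hand.\<close>
lemma wderiv_eq_AE:
  assumes "open \<Omega>" "b \<in> Basis" "weak_partial \<Omega> b u g"
  shows "AE x in lebesgue_on \<Omega>. wderiv \<Omega> b u x = g x"
  using assms weak_partial_unique[OF assms(1,2) _ assms(3)] someI[of "weak_partial \<Omega> b u", OF assms(3)]
  unfolding wderiv_def by blast

section \<open>Lebesgue spaces\<close>

lemma Lp_norm_nonneg: "Lp_norm p \<Omega> v \<ge> 0"
  by (simp add: Lp_norm_def)

lemma Lp_norm_powr: "p > 0 \<Longrightarrow> Lp_norm p \<Omega> v powr p = (LINT x|lebesgue_on \<Omega>. \<bar>v x\<bar> powr p)"
  by (simp add: Lp_norm_def powr_powr integral_nonneg)

lemma Lp_cong_AE: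
  assumes "\<Omega> \<in> sets lebesgue" "u \<in> Lp_space p \<Omega>" "AE x in lebesgue_on \<Omega>. u x = v x"
  shows "v \<in> Lp_space p \<Omega>"
proof -
  have v: "v \<in> borel_measurable (lebesgue_on \<Omega>)"
    using assms borel_measurable_lebesgue_on_AE[OF _ assms(1,3)] by (auto simp: Lp_space_def)
  moreover have "integrable (lebesgue_on \<Omega>) (\<lambda>x. \<bar>v x\<bar> powr p)"
  proof (rule integrable_cong_AE_imp)
    show "integrable (lebesgue_on \<Omega>) (\<lambda>x. \<bar>u x\<bar> powr p)" using assms by (simp add: Lp_space_def)
    show "(\<lambda>x. \<bar>v x\<bar> powr p) \<in> borel_measurable (lebesgue_on \<Omega>)" using v by measurable
    show "AE x in lebesgue_on \<Omega>. \<bar>u x\<bar> powr p = \<bar>v x\<bar> powr p" using assms(3) by eventually_elim simp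
  qed
  ultimately show ?thesis by (simp add: Lp_space_def)
qed

lemma Lp_norm_cong_AE:
  assumes "\<Omega> \<in> sets lebesgue" "u \<in> Lp_space p \<Omega>" "AE x in lebesgue_on \<Omega>. u x = v x"
  shows "Lp_norm p \<Omega> u = Lp_norm p \<Omega> v"
proof -
  have "v \<in> Lp_space p \<Omega>" using Lp_cong_AE[OF assms] .
  then have "(LINT x|lebesgue_on \<Omega>. \<bar>u x\<bar> powr p) = (LINT x|lebesgue_on \<Omega>. \<bar>v x\<bar> powr p)"
    using assms by (intro integral_cong_AE) (auto simp: Lp_space_def elim: AE_mp)
  then show ?thesis by (simp add: Lp_norm_def)
qed

lemma powr_convex_comb:
  fixes a b \<theta> p :: real
  assumes "p \<ge> 1" "a \<ge> 0" "b \<ge> 0" "0 \<le> \<theta>" "\<theta> \<le> 1"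
  shows "(\<theta> * a + (1 - \<theta>) * b) powr p \<le> \<theta> * a powr p + (1 - \<theta>) * b powr p"
proof -
  have one: "(c * x) powr p \<le> c * x powr p" if "0 \<le> c" "c \<le> 1" "x \<ge> 0" for c x :: real
  proof -
    have "c powr p \<le> c powr 1" if "c > 0"
      using that \<open>c \<le> 1\<close> assms(1) by (intro powr_mono') auto
    then have "c powr p \<le> c" using \<open>0 \<le> c\<close> by (cases "c = 0") auto
    then show ?thesis using that by (simp add: powr_mult mult_right_mono)
  qed
  consider "a = 0" | "b = 0" | "a > 0" "b > 0" using assms by linarith
  then show ?thesis
  proof cases
    case 1 then show ?thesis using one[of "1 - \<theta>" b] assms by simp
  next
    case 2 then show ?thesis using one[of \<theta> a] assms by simp
  next
    case 3
    have "(\<lambda>x. x powr p) ((1 - \<theta>) *\<^sub>R b + \<theta> *\<^sub>R a) \<le> (1 - \<theta>) * b powr p + \<theta> * a powr p"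
      using 3 assms by (intro convex_onD[OF powr_convex[OF assms(1)]]) auto
    then show ?thesis by (simp add: algebra_simps)
  qed
qed

lemma powr_add_le:
  fixes a b p :: real
  assumes "p \<ge> 1" "a \<ge> 0" "b \<ge> 0"
  shows "(a + b) powr p \<le> 2 powr p * (a powr p + b powr p)"
proof -
  have "(a + b) powr p \<le> (2 * max a b) powr p" using assms by (intro powr_mono2) auto
  also have "\<dots> = 2 powr p * (max a b) powr p" using assms by (simp add: powr_mult)
  also have "\<dots> \<le> 2 powr p * (a powr p + b powr p)" by (intro mult_left_mono) (auto simp: max_def)
  finally show ?thesis .
qed

lemma Lp_space_diff:
  assumes "p \<ge> 1" "u \<in> Lp_space p \<Omega>" "v \<in> Lp_space p \<Omega>"
  shows "(\<lambda>x. u x - v x) \<in> Lp_space p \<Omega>"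
proof -
  have [measurable]: "u \<in> borel_measurable (lebesgue_on \<Omega>)" "v \<in> borel_measurable (lebesgue_on \<Omega>)"
    using assms by (auto simp: Lp_space_def)
  have "integrable (lebesgue_on \<Omega>) (\<lambda>x. 2 powr p * (\<bar>u x\<bar> powr p + \<bar>v x\<bar> powr p))"
    using assms by (auto simp: Lp_space_def)
  then have "integrable (lebesgue_on \<Omega>) (\<lambda>x. \<bar>u x - v x\<bar> powr p)"
  proof (rule Bochner_Integration.integrable_bound)
    have "\<bar>u x - v x\<bar> powr p \<le> 2 powr p * (\<bar>u x\<bar> powr p + \<bar>v x\<bar> powr p)" for x
      using powr_add_le[of p "\<bar>u x\<bar>" "\<bar>v x\<bar>"] powr_mono2[of p "\<bar>u x - v x\<bar>" "\<bar>u x\<bar> + \<bar>v x\<bar>"] assms(1) by force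
    then show "AE x in lebesgue_on \<Omega>. norm (\<bar>u x - v x\<bar> powr p) \<le> norm (2 powr p * (\<bar>u x\<bar> powr p + \<bar>v x\<bar> powr p))"
      by (intro AE_I2) (simp add: order_trans[OF _ abs_ge_self])
  qed measurable
  then show ?thesis by (simp add: Lp_space_def)
qed

lemma Lp_space_zero: "(\<lambda>x. 0) \<in> Lp_space p \<Omega>"
  by (simp add: Lp_space_def)

text \<open>Minkowski's inequality, by convexity of the power function: \<open>|u| + |v|\<close> is \<open>A + B\<close> times a
  convex combination of \<open>|u| / A\<close> and \<open>|v| / B\<close>.\<close>
lemma Lp_norm_triangle:
  assumes p: "p \<ge> 1" and u: "u \<in> Lp_space p \<Omega>" and v: "v \<in> Lp_space p \<Omega>"
  shows "Lp_norm p \<Omega> (\<lambda>x. u x - v x) \<le> Lp_norm p \<Omega> u + Lp_norm p \<Omega> v"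
proof (rule field_le_epsilon)
  fix e :: real assume "e > 0"
  \<comment> \<open>Enlarging both norms by \<open>e / 2\<close> makes them positive, so that they can be divided by.\<close>
  define A B where "A = Lp_norm p \<Omega> u + e / 2" and "B = Lp_norm p \<Omega> v + e / 2"
  have pos: "A > 0" "B > 0"
    using \<open>e > 0\<close> Lp_norm_nonneg[of p \<Omega> u] Lp_norm_nonneg[of p \<Omega> v] by (auto simp: A_def B_def)
  define \<theta> where "\<theta> = A / (A + B)"
  have \<theta>: "0 \<le> \<theta>" "\<theta> \<le> 1" "1 - \<theta> = B / (A + B)" using pos by (auto simp: \<theta>_def field_simps)
  have i: "integrable (lebesgue_on \<Omega>) (\<lambda>x. \<bar>u x\<bar> powr p)" "integrable (lebesgue_on \<Omega>) (\<lambda>x. \<bar>v x\<bar> powr p)"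
    using u v by (auto simp: Lp_space_def)
  have le1: "(LINT x|lebesgue_on \<Omega>. \<bar>u x\<bar> powr p) \<le> A powr p" "(LINT x|lebesgue_on \<Omega>. \<bar>v x\<bar> powr p) \<le> B powr p"
    using p \<open>e > 0\<close> Lp_norm_powr[of p \<Omega> u] Lp_norm_powr[of p \<Omega> v]
      powr_mono2[of p "Lp_norm p \<Omega> u" A] powr_mono2[of p "Lp_norm p \<Omega> v" B]
      Lp_norm_nonneg[of p \<Omega> u] Lp_norm_nonneg[of p \<Omega> v] by (auto simp: A_def B_def)
  have pw: "\<bar>u x - v x\<bar> powr p \<le> (A + B) powr p * (\<theta> / A powr p * \<bar>u x\<bar> powr p + (1 - \<theta>) / B powr p * \<bar>v x\<bar> powr p)" for x
  proof -
    have "\<bar>u x - v x\<bar> powr p \<le> (\<bar>u x\<bar> + \<bar>v x\<bar>) powr p" using p by (intro powr_mono2) auto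
    also have "\<bar>u x\<bar> + \<bar>v x\<bar> = (A + B) * (\<theta> * (\<bar>u x\<bar> / A) + (1 - \<theta>) * (\<bar>v x\<bar> / B))"
    proof -
      have "(A + B) * (\<theta> * (\<bar>u x\<bar> / A)) = \<bar>u x\<bar>" using pos by (simp add: \<theta>_def)
      moreover have "(A + B) * ((1 - \<theta>) * (\<bar>v x\<bar> / B)) = \<bar>v x\<bar>" using pos by (simp add: \<theta>(3))
      ultimately show ?thesis by (simp only: distrib_left)
    qed
    also have "\<dots> powr p = (A + B) powr p * (\<theta> * (\<bar>u x\<bar> / A) + (1 - \<theta>) * (\<bar>v x\<bar> / B)) powr p"
      by (rule powr_mult)
    also have "\<dots> \<le> (A + B) powr p * (\<theta> * (\<bar>u x\<bar> / A) powr p + (1 - \<theta>) * (\<bar>v x\<bar> / B) powr p)"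
      using pos \<theta> p by (intro mult_left_mono powr_convex_comb) auto
    finally show ?thesis using pos by (simp add: powr_divide)
  qed
  have "(LINT x|lebesgue_on \<Omega>. \<bar>u x - v x\<bar> powr p)
      \<le> (LINT x|lebesgue_on \<Omega>. (A + B) powr p * (\<theta> / A powr p * \<bar>u x\<bar> powr p + (1 - \<theta>) / B powr p * \<bar>v x\<bar> powr p))"
    using Lp_space_diff[OF assms] i pw by (intro integral_mono) (auto simp: Lp_space_def)
  also have "\<dots> = (A + B) powr p * (\<theta> / A powr p * (LINT x|lebesgue_on \<Omega>. \<bar>u x\<bar> powr p) + (1 - \<theta>) / B powr p * (LINT x|lebesgue_on \<Omega>. \<bar>v x\<bar> powr p))"
    using i by simp
  also have "\<dots> \<le> (A + B) powr p * (\<theta> / A powr p * A powr p + (1 - \<theta>) / B powr p * B powr p)"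
    using \<theta>(1,2) le1 by (intro mult_left_mono add_mono) auto
  also have "\<dots> = (A + B) powr p" using pos by simp
  finally have "(LINT x|lebesgue_on \<Omega>. \<bar>u x - v x\<bar> powr p) powr (1 / p) \<le> ((A + B) powr p) powr (1 / p)"
    using p by (intro powr_mono2) (auto intro!: integral_nonneg)
  also have "\<dots> = A + B" using pos p by (simp add: powr_powr)
  finally show "Lp_norm p \<Omega> (\<lambda>x. u x - v x) \<le> Lp_norm p \<Omega> u + Lp_norm p \<Omega> v + e"
    by (simp add: Lp_norm_def[of p \<Omega> "\<lambda>x. u x - v x"]) (simp add: A_def B_def)
qed

lemma abs_powr_2: "\<bar>x::real\<bar> powr 2 = x\<^sup>2"
  by (simp add: powr_numeral)

lemma L2_iff: "v \<in> Lp_space 2 \<Omega> \<longleftrightarrow> v \<in> borel_measurable (lebesgue_on \<Omega>) \<and> integrable (lebesgue_on \<Omega>) (\<lambda>x. (v x)\<^sup>2)"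
  by (simp add: Lp_space_def abs_powr_2)

lemma L2_norm_sq: "(Lp_norm 2 \<Omega> v)\<^sup>2 = pairing \<Omega> v v"
proof -
  have "(Lp_norm 2 \<Omega> v)\<^sup>2 = Lp_norm 2 \<Omega> v powr 2" using Lp_norm_nonneg[of 2 \<Omega> v] by (simp add: powr_numeral)
  then show ?thesis by (simp add: Lp_norm_powr abs_powr_2 pairing_def power2_eq_square)
qed

lemma L2_mult_integrable:
  assumes "u \<in> Lp_space 2 \<Omega>" "v \<in> Lp_space 2 \<Omega>"
  shows "integrable (lebesgue_on \<Omega>) (\<lambda>x. u x * v x)"
proof (rule Bochner_Integration.integrable_bound[where f="\<lambda>x. (u x)\<^sup>2 + (v x)\<^sup>2"])
  have "\<bar>u x * v x\<bar> \<le> (u x)\<^sup>2 + (v x)\<^sup>2" for x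
  proof -
    have "2 * (\<bar>u x\<bar> * \<bar>v x\<bar>) \<le> (u x)\<^sup>2 + (v x)\<^sup>2"
      using sum_squares_bound[of "\<bar>u x\<bar>" "\<bar>v x\<bar>"] by (simp add: mult.assoc)
    moreover have "0 \<le> \<bar>u x\<bar> * \<bar>v x\<bar>" by simp
    ultimately show ?thesis by (simp only: abs_mult)
  qed
  then show "AE x in lebesgue_on \<Omega>. norm (u x * v x) \<le> norm ((u x)\<^sup>2 + (v x)\<^sup>2)"
    by (intro AE_I2) simp
qed (use assms in \<open>auto simp: L2_iff\<close>)

lemma pairing_commute: "pairing \<Omega> u v = pairing \<Omega> v u"
  by (simp add: pairing_def mult.commute)

lemma pairing_diff_left:
  assumes "u \<in> Lp_space 2 \<Omega>" "v \<in> Lp_space 2 \<Omega>" "w \<in> Lp_space 2 \<Omega>"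
  shows "pairing \<Omega> (\<lambda>x. u x - v x) w = pairing \<Omega> u w - pairing \<Omega> v w"
  using L2_mult_integrable[OF assms(1,3)] L2_mult_integrable[OF assms(2,3)]
  by (simp add: pairing_def left_diff_distrib)

lemma pairing_diff_right:
  assumes "u \<in> Lp_space 2 \<Omega>" "v \<in> Lp_space 2 \<Omega>" "w \<in> Lp_space 2 \<Omega>"
  shows "pairing \<Omega> w (\<lambda>x. u x - v x) = pairing \<Omega> w u - pairing \<Omega> w v"
  using pairing_diff_left[OF assms] by (simp add: pairing_commute)

lemma pairing_cong_AE:
  assumes "\<Omega> \<in> sets lebesgue" "u \<in> Lp_space 2 \<Omega>" "v \<in> Lp_space 2 \<Omega>"
    "AE x in lebesgue_on \<Omega>. u x = u' x" "AE x in lebesgue_on \<Omega>. v x = v' x"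
  shows "pairing \<Omega> u v = pairing \<Omega> u' v'"
proof -
  have "u' \<in> Lp_space 2 \<Omega>" "v' \<in> Lp_space 2 \<Omega>" using assms Lp_cong_AE by blast+
  moreover have "AE x in lebesgue_on \<Omega>. u x * v x = u' x * v' x" using assms(4,5) by eventually_elim simp
  ultimately show ?thesis using assms unfolding pairing_def
    by (intro integral_cong_AE) (auto simp: L2_iff)
qed

lemma pairing_Cauchy_Schwarz:
  assumes u: "u \<in> Lp_space 2 \<Omega>" and v: "v \<in> Lp_space 2 \<Omega>"
  shows "\<bar>pairing \<Omega> u v\<bar> \<le> Lp_norm 2 \<Omega> u * Lp_norm 2 \<Omega> v"
proof (rule field_le_epsilon)
  fix e :: real assume "e > 0"
  define A B where "A = Lp_norm 2 \<Omega> u" and "B = Lp_norm 2 \<Omega> v"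
  have AB: "A \<ge> 0" "B \<ge> 0" by (auto simp: A_def B_def Lp_norm_nonneg)
  note i = L2_mult_integrable[OF u u] L2_mult_integrable[OF v v] L2_mult_integrable[OF u v]
  have young: "2 * \<bar>pairing \<Omega> u v\<bar> \<le> s * A\<^sup>2 + B\<^sup>2 / s" if "s > 0" for s
  proof -
    have pw: "2 * \<bar>u x * v x\<bar> \<le> s * (u x * u x) + (v x * v x) / s" for x
    proof -
      have "0 \<le> (s * \<bar>u x\<bar> - \<bar>v x\<bar>)\<^sup>2 / s" using that by simp
      also have "\<dots> = s * (u x * u x) + (v x * v x) / s - 2 * \<bar>u x * v x\<bar>"
        using that by (simp add: power2_eq_square field_simps abs_mult)
      finally show ?thesis by simp
    qed
    have "2 * \<bar>pairing \<Omega> u v\<bar> \<le> 2 * (LINT x|lebesgue_on \<Omega>. \<bar>u x * v x\<bar>)"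
      unfolding pairing_def by (intro mult_left_mono integral_abs_bound) auto
    also have "\<dots> = (LINT x|lebesgue_on \<Omega>. 2 * \<bar>u x * v x\<bar>)" by simp
    also have "\<dots> \<le> (LINT x|lebesgue_on \<Omega>. s * (u x * u x) + (v x * v x) / s)"
      using i pw by (intro integral_mono) auto
    also have "\<dots> = s * A\<^sup>2 + B\<^sup>2 / s" using i by (simp add: A_def B_def L2_norm_sq pairing_def)
    finally show ?thesis .
  qed
  define d where "d = min 1 (e / (A + B + 1))"
  have d: "d > 0" "d \<le> 1" "d \<le> e / (A + B + 1)" using AB \<open>e > 0\<close>
    by (auto simp: d_def)
  then have de: "d * (A + B + 1) \<le> e" using AB by (subst (asm) pos_le_divide_eq) auto
  \<comment> \<open>The optimal weight would be \<open>B / A\<close>; the shift by \<open>d\<close> covers vanishing norms.\<close>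
  have "2 * \<bar>pairing \<Omega> u v\<bar> \<le> ((B + d) / (A + d)) * A\<^sup>2 + B\<^sup>2 / ((B + d) / (A + d))"
    using AB d by (intro young) auto
  also have "\<dots> \<le> (B + d) / (A + d) * (A + d)\<^sup>2 + (B + d)\<^sup>2 / ((B + d) / (A + d))"
    using AB d by (intro add_mono mult_left_mono divide_right_mono power_mono) auto
  also have "\<dots> = 2 * (A + d) * (B + d)" using AB d by (simp add: power2_eq_square)
  also have "\<dots> = 2 * (A * B + d * (A + B + d))" by (simp add: algebra_simps)
  also have "\<dots> \<le> 2 * (A * B + d * (A + B + 1))" using AB d by (intro mult_left_mono add_left_mono) auto
  finally have "\<bar>pairing \<Omega> u v\<bar> \<le> A * B + d * (A + B + 1)" by simp
  also have "\<dots> \<le> A * B + e" using de by simp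
  finally show "\<bar>pairing \<Omega> u v\<bar> \<le> Lp_norm 2 \<Omega> u * Lp_norm 2 \<Omega> v + e" by (simp add: A_def B_def)
qed

section \<open>Seminorms and the Sobolev space\<close>

text \<open>The spaces of representatives are closed under differences, and differences are all that
  occurs; the axioms are stated accordingly.\<close>
locale seminorm_on =
  fixes X :: "('a \<Rightarrow> real) set" and N :: "('a \<Rightarrow> real) \<Rightarrow> real"
  assumes zero_mem: "(\<lambda>x. 0) \<in> X"
    and diff_mem: "u \<in> X \<Longrightarrow> v \<in> X \<Longrightarrow> (\<lambda>x. u x - v x) \<in> X"
    and zero: "N (\<lambda>x. 0) = 0"
    and nonneg: "N u \<ge> 0"
    and diff_le: "u \<in> X \<Longrightarrow> v \<in> X \<Longrightarrow> N (\<lambda>x. u x - v x) \<le> N u + N v"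
begin

lemma commute:
  assumes "u \<in> X" "v \<in> X" shows "N (\<lambda>x. u x - v x) = N (\<lambda>x. v x - u x)"
proof -
  have "N (\<lambda>x. u x - v x) \<le> N (\<lambda>x. v x - u x)" if "u \<in> X" "v \<in> X" for u v
    using diff_le[OF zero_mem diff_mem[OF that(2,1)]] by (simp add: zero)
  then show ?thesis using assms by (intro order_antisym)
qed

lemma triangle:
  assumes "u \<in> X" "v \<in> X" "w \<in> X"
  shows "N (\<lambda>x. u x - w x) \<le> N (\<lambda>x. u x - v x) + N (\<lambda>x. v x - w x)"
  using diff_le[OF diff_mem[OF assms(1,2)] diff_mem[OF assms(3,2)]] commute[OF assms(2,3)] by simp

lemma le_add_diff:
  assumes "u \<in> X" "v \<in> X" shows "N u \<le> N (\<lambda>x. u x - v x) + N v"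
  using triangle[OF assms zero_mem] by simp

lemma abs_diff_le:
  assumes "u \<in> X" "v \<in> X" shows "\<bar>N u - N v\<bar> \<le> N (\<lambda>x. u x - v x)"
  using le_add_diff[OF assms] le_add_diff[OF assms(2,1)] commute[OF assms] by simp

end

lemma seminorm_on_subset:
  assumes "seminorm_on X N" "Y \<subseteq> X" "(\<lambda>x. 0) \<in> Y" "\<And>u v. u \<in> Y \<Longrightarrow> v \<in> Y \<Longrightarrow> (\<lambda>x. u x - v x) \<in> Y"
  shows "seminorm_on Y N"
  using assms unfolding seminorm_on_def by blast

lemma seminorm_Lp: "p \<ge> 1 \<Longrightarrow> seminorm_on (Lp_space p \<Omega>) (Lp_norm p \<Omega>)"
  by unfold_locales (auto simp: Lp_space_zero Lp_space_diff Lp_norm_nonneg Lp_norm_triangle, simp add: Lp_norm_def)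

text \<open>The functions with square integrable weak gradient. Both the test functions and \<open>H\<^sub>0\<^sup>1\<close> lie in
  it, so that differences of the two can be measured in one seminormed space.\<close>
definition W1 :: "'a::euclidean_space set \<Rightarrow> ('a \<Rightarrow> real) set" where
  "W1 \<Omega> = {u. sobolev 1 \<Omega> u}"

lemma W1_I:
  assumes "u \<in> Lp_space 2 \<Omega>" "\<And>b. b \<in> Basis \<Longrightarrow> weak_partial \<Omega> b u (g b)" "\<And>b. b \<in> Basis \<Longrightarrow> g b \<in> Lp_space 2 \<Omega>"
  shows "u \<in> W1 \<Omega>"
  using assms by (auto simp: W1_def)

lemma W1_D:
  assumes "open \<Omega>" "u \<in> W1 \<Omega>"
  shows "u \<in> Lp_space 2 \<Omega>"
    and "b \<in> Basis \<Longrightarrow> weak_partial \<Omega> b u (wderiv \<Omega> b u)"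
    and "b \<in> Basis \<Longrightarrow> wderiv \<Omega> b u \<in> Lp_space 2 \<Omega>"
proof -
  show "u \<in> Lp_space 2 \<Omega>" using assms by (simp add: W1_def)
  assume b: "b \<in> Basis"
  then obtain g where g: "weak_partial \<Omega> b u g" "g \<in> Lp_space 2 \<Omega>" using assms by (auto simp: W1_def)
  show w: "weak_partial \<Omega> b u (wderiv \<Omega> b u)" unfolding wderiv_def using someI[of "weak_partial \<Omega> b u", OF g(1)] by simp
  show "wderiv \<Omega> b u \<in> Lp_space 2 \<Omega>"
    by (rule Lp_cong_AE[OF _ g(2) weak_partial_unique[OF assms(1) b g(1) w]]) (simp add: assms(1))
qed

text \<open>Uniqueness of weak derivatives makes the choice in \<open>wderiv\<close> linear up to null sets.\<close>
lemma W1_diff: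
  assumes "open \<Omega>" "u \<in> W1 \<Omega>" "v \<in> W1 \<Omega>"
  shows "(\<lambda>x. u x - v x) \<in> W1 \<Omega>"
    and "b \<in> Basis \<Longrightarrow> AE x in lebesgue_on \<Omega>. wderiv \<Omega> b (\<lambda>x. u x - v x) x = wderiv \<Omega> b u x - wderiv \<Omega> b v x"
proof -
  note D = W1_D[OF assms(1,2)] W1_D[OF assms(1,3)]
  have w: "b \<in> Basis \<Longrightarrow> weak_partial \<Omega> b (\<lambda>x. u x - v x) (\<lambda>x. wderiv \<Omega> b u x - wderiv \<Omega> b v x)" for b
    using D assms by (intro weak_partial_diff) auto
  show "(\<lambda>x. u x - v x) \<in> W1 \<Omega>"
    using D by (intro W1_I[OF _ w] Lp_space_diff) auto
  show "b \<in> Basis \<Longrightarrow> AE x in lebesgue_on \<Omega>. wderiv \<Omega> b (\<lambda>x. u x - v x) x = wderiv \<Omega> b u x - wderiv \<Omega> b v x"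
    using wderiv_eq_AE[OF assms(1) _ w] .
qed

lemma test_fun_L2:
  assumes "open \<Omega>" "test_fun \<Omega> \<phi>"
  shows "\<phi> \<in> Lp_space 2 \<Omega>"
proof -
  have "integrable (lebesgue_on \<Omega>) (\<lambda>x. \<phi> x * \<phi> x)"
    using assms by (intro loc_integrable_mult_test_fun loc_integrable_smooth test_fun_smooth)
  moreover have "\<phi> \<in> borel_measurable (lebesgue_on \<Omega>)"
    using test_fun_continuous[OF assms(2)] assms(1) by (intro continuous_imp_measurable_on_sets_lebesgue) auto
  ultimately show ?thesis by (simp add: L2_iff power2_eq_square)
qed

lemma test_fun_W1:
  assumes "open \<Omega>" "test_fun \<Omega> \<phi>"
  shows "\<phi> \<in> W1 \<Omega>"
    and "b \<in> Basis \<Longrightarrow> AE x in lebesgue_on \<Omega>. wderiv \<Omega> b \<phi> x = frechet_derivative \<phi> (at x) b"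
proof -
  have w: "b \<in> Basis \<Longrightarrow> weak_partial \<Omega> b \<phi> (\<lambda>x. frechet_derivative \<phi> (at x) b)" for b
    using assms by (intro weak_partial_smooth test_fun_smooth)
  show "\<phi> \<in> W1 \<Omega>"
    using assms by (intro W1_I[OF _ w] test_fun_L2 test_fun_deriv)
  show "b \<in> Basis \<Longrightarrow> AE x in lebesgue_on \<Omega>. wderiv \<Omega> b \<phi> x = frechet_derivative \<phi> (at x) b"
    using wderiv_eq_AE[OF assms(1) _ w] .
qed

lemma H10_norm_nonneg: "H10_norm \<Omega> u \<ge> 0"
  by (simp add: H10_norm_def sum_nonneg)

lemma H10_norm_L2_set: "H10_norm \<Omega> u = L2_set (\<lambda>b. Lp_norm 2 \<Omega> (wderiv \<Omega> b u)) Basis"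
  by (simp add: H10_norm_def L2_set_def)

lemma H1_norm_eq: "H1_norm \<Omega> u = sqrt ((Lp_norm 2 \<Omega> u)\<^sup>2 + (H10_norm \<Omega> u)\<^sup>2)"
  by (simp add: H1_norm_def H10_norm_def sum_nonneg)

lemma Lp_norm_wderiv_le_H10_norm:
  "b \<in> Basis \<Longrightarrow> Lp_norm 2 \<Omega> (wderiv \<Omega> b u) \<le> H10_norm \<Omega> u"
  unfolding H10_norm_L2_set by (rule member_le_L2_set) auto

lemma Lp_norm_le_H1_norm: "Lp_norm 2 \<Omega> u \<le> H1_norm \<Omega> u" "H10_norm \<Omega> u \<le> H1_norm \<Omega> u"
  unfolding H1_norm_eq using Lp_norm_nonneg[of 2 \<Omega> u] H10_norm_nonneg[of \<Omega> u]
  by (auto intro: real_le_rsqrt)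

lemma seminorm_W1:
  fixes \<Omega> :: "'a::euclidean_space set"
  assumes "open \<Omega>"
  shows "seminorm_on (W1 \<Omega>) (H10_norm \<Omega>)"
proof
  have z: "(\<lambda>x::'a. 0) \<in> W1 \<Omega>" by (rule test_fun_W1[OF assms test_fun_zero])
  then show "(\<lambda>x::'a. 0) \<in> W1 \<Omega>" .
  show "(\<lambda>x. u x - v x) \<in> W1 \<Omega>" if "u \<in> W1 \<Omega>" "v \<in> W1 \<Omega>" for u v
    using W1_diff(1)[OF assms that] .
  have wz: "Lp_norm 2 \<Omega> (wderiv \<Omega> b (\<lambda>x. 0)) = 0" if b: "b \<in> Basis" for b :: 'a
  proof -
    have "AE x in lebesgue_on \<Omega>. wderiv \<Omega> b (\<lambda>x. 0) x = 0"
      using W1_diff(2)[OF assms z z b] by simp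
    then have "Lp_norm 2 \<Omega> (wderiv \<Omega> b (\<lambda>x. 0)) = Lp_norm 2 \<Omega> (\<lambda>x. 0)"
      using assms W1_D[OF assms z] b by (intro Lp_norm_cong_AE) auto
    then show ?thesis by (simp add: Lp_norm_def)
  qed
  then show "H10_norm \<Omega> (\<lambda>x::'a. 0) = 0" by (simp add: H10_norm_def)
  show "H10_norm \<Omega> u \<ge> 0" for u :: "'a \<Rightarrow> real" by (rule H10_norm_nonneg)
  show "H10_norm \<Omega> (\<lambda>x. u x - v x) \<le> H10_norm \<Omega> u + H10_norm \<Omega> v"
    if u: "u \<in> W1 \<Omega>" and v: "v \<in> W1 \<Omega>" for u v :: "'a \<Rightarrow> real"
  proof -
    have "Lp_norm 2 \<Omega> (wderiv \<Omega> b (\<lambda>x. u x - v x)) \<le> Lp_norm 2 \<Omega> (wderiv \<Omega> b u) + Lp_norm 2 \<Omega> (wderiv \<Omega> b v)"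
      if b: "b \<in> Basis" for b
    proof -
      have "Lp_norm 2 \<Omega> (wderiv \<Omega> b (\<lambda>x. u x - v x)) = Lp_norm 2 \<Omega> (\<lambda>x. wderiv \<Omega> b u x - wderiv \<Omega> b v x)"
        using W1_diff[OF assms u v] W1_D[OF assms] b assms by (intro Lp_norm_cong_AE) auto
      also have "\<dots> \<le> Lp_norm 2 \<Omega> (wderiv \<Omega> b u) + Lp_norm 2 \<Omega> (wderiv \<Omega> b v)"
        using W1_D[OF assms u] W1_D[OF assms v] b by (intro Lp_norm_triangle) auto
      finally show ?thesis .
    qed
    then have "H10_norm \<Omega> (\<lambda>x. u x - v x) \<le> L2_set (\<lambda>b. Lp_norm 2 \<Omega> (wderiv \<Omega> b u) + Lp_norm 2 \<Omega> (wderiv \<Omega> b v)) Basis"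
      unfolding H10_norm_L2_set by (intro L2_set_mono) (auto simp: Lp_norm_nonneg)
    also have "\<dots> \<le> H10_norm \<Omega> u + H10_norm \<Omega> v"
      unfolding H10_norm_L2_set by (rule L2_set_triangle_ineq)
    finally show ?thesis .
  qed
qed

lemma H1_norm_diff_le:
  assumes "open \<Omega>" "u \<in> W1 \<Omega>" "v \<in> W1 \<Omega>"
  shows "H1_norm \<Omega> (\<lambda>x. u x - v x) \<le> H1_norm \<Omega> u + H1_norm \<Omega> v"
proof -
  interpret seminorm_on "W1 \<Omega>" "H10_norm \<Omega>" by (rule seminorm_W1[OF assms(1)])
  have "H1_norm \<Omega> (\<lambda>x. u x - v x) \<le> sqrt ((Lp_norm 2 \<Omega> u + Lp_norm 2 \<Omega> v)\<^sup>2 + (H10_norm \<Omega> u + H10_norm \<Omega> v)\<^sup>2)"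
    unfolding H1_norm_eq using W1_D(1)[OF assms(1)] assms
    by (intro real_sqrt_le_mono add_mono power_mono Lp_norm_triangle diff_le Lp_norm_nonneg nonneg) auto
  also have "\<dots> \<le> H1_norm \<Omega> u + H1_norm \<Omega> v"
    unfolding H1_norm_eq by (rule real_sqrt_sum_squares_triangle_ineq)
  finally show ?thesis .
qed

lemma H10_subset_W1: "H10 \<Omega> \<subseteq> W1 \<Omega>"
  by (auto simp: H10_def W1_def)

text \<open>Differences of approximating test functions approximate the difference.\<close>
lemma H10_diff:
  assumes "open \<Omega>" "u \<in> H10 \<Omega>" "v \<in> H10 \<Omega>"
  shows "(\<lambda>x. u x - v x) \<in> H10 \<Omega>"
proof -
  obtain \<phi> where \<phi>: "\<And>k. test_fun \<Omega> (\<phi> k)" "(\<lambda>k::nat. H1_norm \<Omega> (\<lambda>x. \<phi> k x - u x)) \<longlonglongrightarrow> 0"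
    using assms(2) unfolding H10_def by blast
  obtain \<psi> where \<psi>: "\<And>k. test_fun \<Omega> (\<psi> k)" "(\<lambda>k::nat. H1_norm \<Omega> (\<lambda>x. \<psi> k x - v x)) \<longlonglongrightarrow> 0"
    using assms(3) unfolding H10_def by blast
  have uv: "u \<in> W1 \<Omega>" "v \<in> W1 \<Omega>" using assms H10_subset_W1 by auto
  have le: "H1_norm \<Omega> (\<lambda>x. (\<phi> k x - \<psi> k x) - (u x - v x)) \<le> H1_norm \<Omega> (\<lambda>x. \<phi> k x - u x) + H1_norm \<Omega> (\<lambda>x. \<psi> k x - v x)" for k
    using H1_norm_diff_le[OF assms(1) W1_diff(1)[OF assms(1) test_fun_W1(1)[OF assms(1) \<phi>(1)] uv(1)] W1_diff(1)[OF assms(1) test_fun_W1(1)[OF assms(1) \<psi>(1)] uv(2)], of k k]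
    by (simp add: algebra_simps)
  have "(\<lambda>k. H1_norm \<Omega> (\<lambda>x. (\<phi> k x - \<psi> k x) - (u x - v x))) \<longlonglongrightarrow> 0"
  proof (rule tendsto_sandwich[OF _ _ tendsto_const])
    show "(\<lambda>k. H1_norm \<Omega> (\<lambda>x. \<phi> k x - u x) + H1_norm \<Omega> (\<lambda>x. \<psi> k x - v x)) \<longlonglongrightarrow> 0"
      using tendsto_add[OF \<phi>(2) \<psi>(2)] by simp
  qed (use le in \<open>auto simp: H1_norm_eq\<close>)
  moreover have "sobolev 1 \<Omega> (\<lambda>x. u x - v x)" using W1_diff(1)[OF assms(1) uv] by (simp add: W1_def)
  ultimately show ?thesis using test_fun_diff[OF \<phi>(1) \<psi>(1)]
    unfolding H10_def by (auto intro!: exI[of _ "\<lambda>k x. \<phi> k x - \<psi> k x"])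
qed

lemma seminorm_H10:
  assumes "open \<Omega>" shows "seminorm_on (H10 \<Omega>) (H10_norm \<Omega>)"
proof (rule seminorm_on_subset[OF seminorm_W1[OF assms] H10_subset_W1])
  interpret seminorm_on "W1 \<Omega>" "H10_norm \<Omega>" by (rule seminorm_W1[OF assms])
  have "H1_norm \<Omega> (\<lambda>x. 0) = 0" using zero by (simp add: H1_norm_eq) (simp add: Lp_norm_def)
  then show "(\<lambda>x. 0) \<in> H10 \<Omega>"
    using zero_mem unfolding H10_def W1_def by (auto intro!: exI[of _ "\<lambda>k x. 0"] test_fun_zero)
qed (rule H10_diff[OF assms])

lemma grad_pairing_self: "grad_pairing \<Omega> u u = (H10_norm \<Omega> u)\<^sup>2"
  by (simp add: grad_pairing_def H10_norm_def L2_norm_sq[symmetric] sum_nonneg)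

lemma grad_pairing_commute: "grad_pairing \<Omega> u v = grad_pairing \<Omega> v u"
  by (simp add: grad_pairing_def pairing_commute)

lemma grad_pairing_diff_right:
  assumes "open \<Omega>" "u \<in> W1 \<Omega>" "v \<in> W1 \<Omega>" "w \<in> W1 \<Omega>"
  shows "grad_pairing \<Omega> w (\<lambda>x. u x - v x) = grad_pairing \<Omega> w u - grad_pairing \<Omega> w v"
proof -
  have "pairing \<Omega> (wderiv \<Omega> b w) (wderiv \<Omega> b (\<lambda>x. u x - v x))
      = pairing \<Omega> (wderiv \<Omega> b w) (wderiv \<Omega> b u) - pairing \<Omega> (wderiv \<Omega> b w) (wderiv \<Omega> b v)" if b: "b \<in> Basis" for b
  proof -
    note D = W1_D(3)[OF assms(1) _ b]
    have "pairing \<Omega> (wderiv \<Omega> b w) (wderiv \<Omega> b (\<lambda>x. u x - v x)) = pairing \<Omega> (wderiv \<Omega> b w) (\<lambda>x. wderiv \<Omega> b u x - wderiv \<Omega> b v x)"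
      using W1_diff[OF assms(1-3)] b assms D by (intro pairing_cong_AE) auto
    then show ?thesis using D assms by (simp add: pairing_diff_right)
  qed
  then show ?thesis by (simp add: grad_pairing_def sum_subtractf)
qed

lemma grad_pairing_Cauchy_Schwarz:
  assumes "open \<Omega>" "u \<in> W1 \<Omega>" "v \<in> W1 \<Omega>"
  shows "\<bar>grad_pairing \<Omega> u v\<bar> \<le> H10_norm \<Omega> u * H10_norm \<Omega> v"
proof -
  have "\<bar>grad_pairing \<Omega> u v\<bar> \<le> (\<Sum>b\<in>Basis. \<bar>pairing \<Omega> (wderiv \<Omega> b u) (wderiv \<Omega> b v)\<bar>)"
    unfolding grad_pairing_def by (rule sum_abs)
  also have "\<dots> \<le> (\<Sum>b\<in>Basis. \<bar>Lp_norm 2 \<Omega> (wderiv \<Omega> b u)\<bar> * \<bar>Lp_norm 2 \<Omega> (wderiv \<Omega> b v)\<bar>)"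
    using pairing_Cauchy_Schwarz[OF W1_D(3)[OF assms(1,2)] W1_D(3)[OF assms(1,3)]]
    by (intro sum_mono) (simp add: Lp_norm_nonneg)
  also have "\<dots> \<le> H10_norm \<Omega> u * H10_norm \<Omega> v"
    unfolding H10_norm_L2_set by (rule L2_set_mult_ineq)
  finally show ?thesis .
qed

text \<open>With \<open>x\<^sub>b = x \<bullet> b\<close>, the integral of the \<open>b\<close>-derivative of \<open>\<phi>\<^sup>2 x\<^sub>b\<close> vanishes, that is, \<open>\<phi>\<^sup>2\<close>
  has the same integral as \<open>- 2 \<phi> \<partial>\<^sub>b\<phi> x\<^sub>b\<close>; and \<open>|x\<^sub>b| \<le> R\<close> on \<open>\<Omega>\<close>.\<close>
lemma Poincare_test_fun:
  fixes \<Omega> :: "'a::euclidean_space set"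
  assumes "open \<Omega>" "test_fun \<Omega> \<phi>" and R: "\<And>x. x \<in> \<Omega> \<Longrightarrow> norm x \<le> R" "R \<ge> 0"
  shows "Lp_norm 2 \<Omega> \<phi> \<le> 2 * R * H10_norm \<Omega> \<phi>"
proof -
  obtain b :: 'a where b: "b \<in> Basis" using nonempty_Basis by blast
  note s = test_fun_smooth[OF assms(2)]
  define d where "d x = frechet_derivative \<phi> (at x) b" for x
  have d: "test_fun \<Omega> d" unfolding d_def by (rule test_fun_deriv[OF assms(2) b])
  define \<psi> where "\<psi> x = d x * (x \<bullet> b)" for x
  have \<psi>: "test_fun \<Omega> \<psi>" unfolding \<psi>_def by (rule test_fun_mult_smooth[OF d smooth_on_inner])
  note L2 = test_fun_L2[OF assms(1)]
  have t: "test_fun \<Omega> (\<lambda>x. \<phi> x * (\<phi> x * (x \<bullet> b)))"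
    by (intro test_fun_mult_smooth[OF assms(2)] smooth_on_mult s smooth_on_inner)
  have fi: "frechet_derivative (\<lambda>x. x \<bullet> b) (at x) b = 1" for x
  proof -
    have "((\<lambda>x. x \<bullet> b) has_derivative (\<lambda>y. y \<bullet> b)) (at x)" by (auto intro!: derivative_eq_intros)
    from frechet_derivative_at[OF this] show ?thesis using b by (metis inner_same_Basis)
  qed
  have "frechet_derivative (\<lambda>x. \<phi> x * (\<phi> x * (x \<bullet> b))) (at x) b = \<phi> x * \<phi> x + 2 * (\<phi> x * \<psi> x)" for x
    unfolding frechet_derivative_mult_smooth[OF s smooth_on_mult[OF s smooth_on_inner]]
      frechet_derivative_mult_smooth[OF s smooth_on_inner] fi \<psi>_def d_def
    by (simp add: algebra_simps)
  with integral_test_fun_deriv[OF assms(1) t b]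
  have "(LINT x|lebesgue_on \<Omega>. \<phi> x * \<phi> x + 2 * (\<phi> x * \<psi> x)) = 0" by simp
  then have "pairing \<Omega> \<phi> \<phi> = - 2 * pairing \<Omega> \<phi> \<psi>"
    using L2_mult_integrable[OF L2[OF assms(2)] L2[OF assms(2)]] L2_mult_integrable[OF L2[OF assms(2)] L2[OF \<psi>]]
    by (simp add: pairing_def)
  then have sq: "(Lp_norm 2 \<Omega> \<phi>)\<^sup>2 \<le> 2 * (Lp_norm 2 \<Omega> \<phi> * Lp_norm 2 \<Omega> \<psi>)"
    using pairing_Cauchy_Schwarz[OF L2[OF assms(2)] L2[OF \<psi>]] by (simp add: L2_norm_sq)
  have "Lp_norm 2 \<Omega> \<psi> \<le> R * Lp_norm 2 \<Omega> d"
  proof (rule power2_le_imp_le)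
    have "pairing \<Omega> \<psi> \<psi> \<le> (LINT x|lebesgue_on \<Omega>. R\<^sup>2 * (d x * d x))"
      unfolding pairing_def
    proof (rule integral_mono)
      fix x assume "x \<in> space (lebesgue_on \<Omega>)"
      then have "\<bar>x \<bullet> b\<bar> \<le> R" using R Basis_le_norm[OF b, of x] by fastforce
      then have "(x \<bullet> b)\<^sup>2 \<le> R\<^sup>2" using abs_le_square_iff[of "x \<bullet> b" R] R(2) by simp
      from mult_right_mono[OF this, of "(d x)\<^sup>2"] show "\<psi> x * \<psi> x \<le> R\<^sup>2 * (d x * d x)"
        by (simp add: \<psi>_def power2_eq_square mult_ac)
    qed (use L2_mult_integrable L2 \<psi> d in auto)
    then show "(Lp_norm 2 \<Omega> \<psi>)\<^sup>2 \<le> (R * Lp_norm 2 \<Omega> d)\<^sup>2"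
      by (simp add: L2_norm_sq power_mult_distrib pairing_def)
    show "0 \<le> R * Lp_norm 2 \<Omega> d" using R(2) Lp_norm_nonneg by (rule mult_nonneg_nonneg)
  qed
  also have "\<dots> \<le> R * H10_norm \<Omega> \<phi>"
  proof (rule mult_left_mono[OF _ R(2)])
    have "Lp_norm 2 \<Omega> d = Lp_norm 2 \<Omega> (wderiv \<Omega> b \<phi>)"
      using test_fun_W1(2)[OF assms(1,2) b] assms(1)
      by (intro Lp_norm_cong_AE L2[OF d]) (auto simp: d_def elim: AE_mp)
    then show "Lp_norm 2 \<Omega> d \<le> H10_norm \<Omega> \<phi>" using Lp_norm_wderiv_le_H10_norm[OF b] by simp
  qed
  finally have "2 * (Lp_norm 2 \<Omega> \<phi> * Lp_norm 2 \<Omega> \<psi>) \<le> 2 * (Lp_norm 2 \<Omega> \<phi> * (R * H10_norm \<Omega> \<phi>))"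
    by (intro mult_left_mono) (auto simp: Lp_norm_nonneg)
  with sq have "Lp_norm 2 \<Omega> \<phi> * Lp_norm 2 \<Omega> \<phi> \<le> Lp_norm 2 \<Omega> \<phi> * (2 * R * H10_norm \<Omega> \<phi>)"
    by (simp add: power2_eq_square mult_ac)
  then show ?thesis using Lp_norm_nonneg[of 2 \<Omega> \<phi>] H10_norm_nonneg[of \<Omega> \<phi>] R(2)
    by (cases "Lp_norm 2 \<Omega> \<phi> = 0") auto
qed

lemma Poincare:
  fixes \<Omega> :: "'a::euclidean_space set"
  assumes "open \<Omega>" "u \<in> H10 \<Omega>" and R: "\<And>x. x \<in> \<Omega> \<Longrightarrow> norm x \<le> R" "R \<ge> 0"
  shows "Lp_norm 2 \<Omega> u \<le> 2 * R * H10_norm \<Omega> u"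
proof -
  obtain \<phi> where \<phi>: "\<And>k. test_fun \<Omega> (\<phi> k)" "(\<lambda>k::nat. H1_norm \<Omega> (\<lambda>x. \<phi> k x - u x)) \<longlonglongrightarrow> 0"
    using assms(2) unfolding H10_def by blast
  interpret W: seminorm_on "W1 \<Omega>" "H10_norm \<Omega>" by (rule seminorm_W1[OF assms(1)])
  interpret L: seminorm_on "Lp_space 2 \<Omega>" "Lp_norm 2 \<Omega>" by (rule seminorm_Lp) simp
  have u: "u \<in> W1 \<Omega>" using assms(2) H10_subset_W1 by auto
  note u = u W1_D(1)[OF assms(1) u]
  have \<phi>': "\<phi> k \<in> W1 \<Omega>" "\<phi> k \<in> Lp_space 2 \<Omega>" for k using test_fun_W1(1)[OF assms(1) \<phi>(1)] test_fun_L2[OF assms(1) \<phi>(1)] by auto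
  have "Lp_norm 2 \<Omega> u \<le> (1 + 2 * R) * H1_norm \<Omega> (\<lambda>x. \<phi> k x - u x) + 2 * R * H10_norm \<Omega> u" for k
  proof -
    have "Lp_norm 2 \<Omega> u \<le> Lp_norm 2 \<Omega> (\<lambda>x. \<phi> k x - u x) + Lp_norm 2 \<Omega> (\<phi> k)"
      using L.le_add_diff[OF u(2) \<phi>'(2)] L.commute[OF u(2) \<phi>'(2)] by simp
    also have "\<dots> \<le> H1_norm \<Omega> (\<lambda>x. \<phi> k x - u x) + 2 * R * H10_norm \<Omega> (\<phi> k)"
      using Poincare_test_fun[OF assms(1) \<phi>(1) R] by (intro add_mono Lp_norm_le_H1_norm) auto
    also have "2 * R * H10_norm \<Omega> (\<phi> k) \<le> 2 * R * (H1_norm \<Omega> (\<lambda>x. \<phi> k x - u x) + H10_norm \<Omega> u)"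
      using R(2) W.le_add_diff[OF \<phi>'(1)[of k] u(1)] Lp_norm_le_H1_norm(2)[of \<Omega> "\<lambda>x. \<phi> k x - u x"] by (intro mult_left_mono) auto
    finally show ?thesis by (simp add: algebra_simps)
  qed
  moreover have "(\<lambda>k. (1 + 2 * R) * H1_norm \<Omega> (\<lambda>x. \<phi> k x - u x) + 2 * R * H10_norm \<Omega> u) \<longlonglongrightarrow> (1 + 2 * R) * 0 + 2 * R * H10_norm \<Omega> u"
    by (intro tendsto_intros \<phi>(2))
  ultimately show ?thesis by (intro LIMSEQ_le_const[of "\<lambda>k. (1 + 2 * R) * H1_norm \<Omega> (\<lambda>x. \<phi> k x - u x) + 2 * R * H10_norm \<Omega> u"]) auto
qed

section \<open>Quasi-continuity of Bochner integrable functions\<close>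

text \<open>Each of the finitely many level sets contains a compact set of nearly full measure; these
  compact sets are disjoint, hence at positive distance from each other.\<close>
lemma step_fun_gap:
  fixes s :: "real \<Rightarrow> 'a \<Rightarrow> real"
  assumes s: "step_fun I X s" and I: "bounded I" and "e > 0"
  obtains Q d where "Q \<subseteq> I" "Q \<in> sets lebesgue" "measure lebesgue (I - Q) \<le> e" "d > 0"
    "\<And>t r. t \<in> Q \<Longrightarrow> r \<in> Q \<Longrightarrow> \<bar>t - r\<bar> < d \<Longrightarrow> s t = s r"
proof -
  define W where "W = s ` I"
  have W: "finite W" using s by (simp add: W_def step_fun_def)
  define A where "A w = {t \<in> I. s t = w}" for w
  have A: "A w \<in> sets lebesgue" "bounded (A w)" for w
    using s bounded_subset[OF I] by (auto simp: A_def step_fun_def)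
  define e' where "e' = e / (real (card W) + 1)"
  have e': "e' > 0" "card W * e' \<le> e" using \<open>e > 0\<close> by (auto simp: e'_def field_simps)
  have "\<exists>K. closed K \<and> K \<subseteq> A w \<and> A w - K \<in> lmeasurable \<and> measure lebesgue (A w - K) \<le> e'" for w
  proof -
    obtain K where K: "closed K" "K \<subseteq> A w" "A w - K \<in> lmeasurable" "emeasure lebesgue (A w - K) < ennreal e'"
      using sets_lebesgue_inner_closed[OF A(1) e'(1)] by metis
    then have "measure lebesgue (A w - K) \<le> e'"
      using e'(1) by (simp add: emeasure_eq_measure2 ennreal_less_iff)
    then show ?thesis using K by blast
  qed
  then obtain K where K: "\<And>w. closed (K w)" "\<And>w. K w \<subseteq> A w" "\<And>w. A w - K w \<in> lmeasurable"
    "\<And>w. measure lebesgue (A w - K w) \<le> e'" by metis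
  have cK: "compact (K w)" for w
    unfolding compact_eq_bounded_closed using K(1) bounded_subset[OF A(2) K(2)] by blast
  have "\<exists>d>0. w \<noteq> w' \<longrightarrow> (\<forall>x\<in>K w. \<forall>y\<in>K w'. d \<le> dist x y)" for w w'
  proof (cases "w = w'")
    case False
    then have "K w \<inter> K w' = {}" using K(2)[of w] K(2)[of w'] by (auto simp: A_def)
    then show ?thesis using separate_closed_compact[OF K(1) cK] by blast
  qed (auto intro: zero_less_one)
  then obtain D where D: "\<And>w w'. D w w' > (0::real)" "\<And>w w' x y. w \<noteq> w' \<Longrightarrow> x \<in> K w \<Longrightarrow> y \<in> K w' \<Longrightarrow> D w w' \<le> dist x y"
    by metis
  define d where "d = Min (insert 1 ((\<lambda>(w, w'). D w w') ` (W \<times> W)))"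
  have d: "d > 0" "\<And>w w'. w \<in> W \<Longrightarrow> w' \<in> W \<Longrightarrow> d \<le> D w w'"
    unfolding d_def using W D(1) by (auto intro!: Min_le)
  define Q where "Q = (\<Union>w\<in>W. K w)"
  have QI: "Q \<subseteq> I" using K(2) by (auto simp: Q_def A_def)
  show thesis
  proof
    show "Q \<subseteq> I" by (rule QI)
    show "Q \<in> sets lebesgue" unfolding Q_def using W K(1) by (intro sets.finite_UN) auto
    show "d > 0" by (rule d(1))
    have "I - Q \<subseteq> (\<Union>w\<in>W. A w - K w)"
      by (auto simp: Q_def A_def W_def)
    moreover have "I - Q = (\<Union>w\<in>W. A w) - Q" by (auto simp: A_def W_def)
    then have "I - Q \<in> sets lebesgue"
      using W A(1) \<open>Q \<in> sets lebesgue\<close> by (auto intro!: sets.finite_UN)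
    ultimately have "measure lebesgue (I - Q) \<le> measure lebesgue (\<Union>w\<in>W. A w - K w)"
      using W K(3) by (intro measure_mono_fmeasurable fmeasurable.finite_UN) auto
    also have "\<dots> \<le> (\<Sum>w\<in>W. measure lebesgue (A w - K w))"
      using W K(3) by (intro measure_UNION_le) auto
    also have "\<dots> \<le> (\<Sum>w\<in>W. e')" using K(4) by (intro sum_mono)
    also have "\<dots> \<le> e" using e'(2) by simp
    finally show "measure lebesgue (I - Q) \<le> e" .
    fix t r assume t: "t \<in> Q" and r: "r \<in> Q" and tr: "\<bar>t - r\<bar> < d"
    obtain w w' where w: "w \<in> W" "t \<in> K w" "w' \<in> W" "r \<in> K w'" using t r by (auto simp: Q_def)
    have "w = w'"
    proof (rule ccontr)
      assume "w \<noteq> w'"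
      then have "D w w' \<le> dist t r" using D(2) w by blast
      then show False using d(2)[OF w(1,3)] tr by (simp add: dist_real_def)
    qed
    then show "s t = s r" using w K(2)[of w] K(2)[of w'] by (auto simp: A_def)
  qed
qed

lemma step_fun_comp_measurable:
  fixes G :: "('a \<Rightarrow> real) \<Rightarrow> ('a \<Rightarrow> real) \<Rightarrow> real"
  assumes s: "step_fun I X s" and s': "step_fun I X' s'"
  shows "(\<lambda>t. G (s t) (s' t)) \<in> borel_measurable (lebesgue_on I)"
proof -
  have fin: "finite (s ` I)" "finite (s' ` I)" using s s' by (auto simp: step_fun_def)
  have m: "{t\<in>I. s t = w} \<in> sets (lebesgue_on I)" "{t\<in>I. s' t = w} \<in> sets (lebesgue_on I)" for w
    unfolding sets_restrict_space using s s'
    by (auto simp: step_fun_def intro!: image_eqI[of "{t\<in>I. s t = w}" _ "{t\<in>I. s t = w}"]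
        image_eqI[of "{t\<in>I. s' t = w}" _ "{t\<in>I. s' t = w}"])
  have "(\<lambda>t. \<Sum>w\<in>s ` I. \<Sum>w'\<in>s' ` I. indicator {t\<in>I. s t = w} t * indicator {t\<in>I. s' t = w'} t * G w w')
       \<in> borel_measurable (lebesgue_on I)"
    using m by (intro borel_measurable_sum borel_measurable_times borel_measurable_indicator) auto
  moreover have "(\<Sum>w\<in>s ` I. \<Sum>w'\<in>s' ` I. indicator {t\<in>I. s t = w} t * indicator {t\<in>I. s' t = w'} t * G w w') = G (s t) (s' t)"
    if t: "t \<in> I" for t
  proof -
    have "(\<Sum>w\<in>s ` I. \<Sum>w'\<in>s' ` I. indicator {t\<in>I. s t = w} t * indicator {t\<in>I. s' t = w'} t * G w w')
        = (\<Sum>w\<in>s ` I. \<Sum>w'\<in>s' ` I. if w' = s' t then (if w = s t then G w w' else 0) else 0)"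
      using t by (intro sum.cong) (auto simp: indicator_def)
    also have "\<dots> = G (s t) (s' t)" using fin t by (simp add: sum.delta')
    finally show ?thesis .
  qed
  ultimately show ?thesis by (subst measurable_cong) auto
qed

text \<open>A limit of distances of step functions.\<close>
lemma strongly_measurable_dist_measurable:
  assumes "seminorm_on X N" and I: "I \<in> sets lebesgue"
    and s: "\<And>k. step_fun I X (s k)"
    and conv: "AE t in lebesgue_on I. F t \<in> X \<and> (\<lambda>k. N (\<lambda>x. s k t x - F t x)) \<longlonglongrightarrow> 0"
  shows "(\<lambda>t. N (\<lambda>x. s k t x - F t x)) \<in> borel_measurable (lebesgue_on I)"
proof (rule borel_measurable_lebesgue_on_AE[OF _ I])
  interpret seminorm_on X N by fact
  show "(\<lambda>t. lim (\<lambda>j. N (\<lambda>x. s k t x - s j t x))) \<in> borel_measurable (lebesgue_on I)"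
    by (intro borel_measurable_lim_metric step_fun_comp_measurable[where G="\<lambda>v w. N (\<lambda>x. v x - w x)", OF s s])
  have "AE t in lebesgue_on I. t \<in> I" by (auto intro: AE_I2)
  with conv show "AE t in lebesgue_on I. lim (\<lambda>j. N (\<lambda>x. s k t x - s j t x)) = N (\<lambda>x. s k t x - F t x)"
  proof eventually_elim
    case (elim t)
    have sX: "s j t \<in> X" for j using s[of j] elim by (auto simp: step_fun_def)
    have "\<bar>N (\<lambda>x. s k t x - s j t x) - N (\<lambda>x. s k t x - F t x)\<bar> \<le> N (\<lambda>x. s j t x - F t x)" for j
      using triangle[of "s k t" "F t" "s j t"] triangle[of "s k t" "s j t" "F t"] sX elim commute[of "F t" "s j t"]
      by auto
    then have ev: "eventually (\<lambda>j. norm (N (\<lambda>x. s k t x - s j t x) - N (\<lambda>x. s k t x - F t x)) \<le> N (\<lambda>x. s j t x - F t x)) sequentially"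
      by simp
    have "(\<lambda>j. N (\<lambda>x. s k t x - s j t x) - N (\<lambda>x. s k t x - F t x)) \<longlonglongrightarrow> 0"
      by (rule Lim_null_comparison[OF ev]) (use elim in blast)
    then show ?case by (intro limI) (simp add: LIM_zero_iff)
  qed
qed

text \<open>A substitute for a modulus of continuity of a function of time with distances \<open>G t r\<close>: the
  error is small except for a contribution \<open>b\<close> of small integral, which depends on \<open>t\<close> and \<open>r\<close>
  separately. The second set consists of the times at which the function takes its values in the
  right space.\<close>
definition almost_modulus ::
  "real set \<Rightarrow> real set \<Rightarrow> (real \<Rightarrow> real \<Rightarrow> real) \<Rightarrow> real \<Rightarrow> (real \<Rightarrow> real) \<Rightarrow> real \<Rightarrow> bool" where
  "almost_modulus I J G e b d \<longleftrightarrow> (\<forall>t. b t \<ge> 0) \<and> integrable (lebesgue_on I) b \<and>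
     (LINT t|lebesgue_on I. b t) \<le> e \<and> d > 0 \<and>
     (\<forall>t\<in>J. \<forall>r\<in>J. \<bar>t - r\<bar> < d \<longrightarrow> G t r \<le> b t + b r + e)"

text \<open>If \<open>t\<close> and \<open>r\<close> avoid a small set, then \<open>F\<close> is close to a step function at both times, and the
  step function takes the same value if \<open>t\<close> and \<open>r\<close> are close. Otherwise the distance is bounded by
  the sum of the norms; the truncation of \<open>|F|\<^sup>q\<close> at height \<open>M\<close> is paid for by the small set, and
  the excess over \<open>M\<close> has small integral.\<close>
lemma bochner_Lp_quasi_continuous:
  assumes sN: "seminorm_on X N" and I: "I \<in> sets lebesgue" "bounded I" and q: "q \<ge> 1"
    and F: "F \<in> bochner_Lp q I X N" and e: "e > 0"
  shows "\<exists>b d. almost_modulus I {t\<in>I. F t \<in> X} (\<lambda>t r. N (\<lambda>x. F t x - F r x) powr q) e b d"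
proof -
  interpret seminorm_on X N by fact
  have Il: "I \<in> lmeasurable" using I bounded_set_imp_lmeasurable by blast
  interpret fm: finite_measure "lebesgue_on I" by (rule finite_measure_lebesgue_on[OF Il])
  define g where "g t = N (F t) powr q" for t
  have g: "integrable (lebesgue_on I) g" "\<And>t. g t \<ge> 0" using F by (auto simp: bochner_Lp_def g_def[abs_def])
  obtain s where s: "\<And>k::nat. step_fun I X (s k)"
    "AE t in lebesgue_on I. F t \<in> X \<and> (\<lambda>k. N (\<lambda>x. s k t x - F t x)) \<longlonglongrightarrow> 0"
    using F unfolding bochner_Lp_def strongly_measurable_def by blast
  note dm = strongly_measurable_dist_measurable[OF sN I(1) s]
  have sX: "t \<in> I \<Longrightarrow> s k t \<in> X" for k t using s(1)[of k] by (auto simp: step_fun_def)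
  define C where "C = (2::real) powr q"
  have C: "C > 0" by (simp add: C_def)
  have "(\<lambda>n. LINT t|lebesgue_on I. max (g t - real n) 0) \<longlonglongrightarrow> (LINT t|lebesgue_on I. 0)"
  proof (rule integral_dominated_convergence[where w=g])
    show "AE t in lebesgue_on I. (\<lambda>n. max (g t - real n) 0) \<longlonglongrightarrow> 0"
    proof (rule AE_I2)
      fix t
      obtain n0 :: nat where "g t \<le> n0" using real_arch_simple by blast
      then have "\<forall>n\<ge>n0. max (g t - real n) 0 = 0" by auto
      then show "(\<lambda>n. max (g t - real n) 0) \<longlonglongrightarrow> 0"
        by (intro tendsto_eventually) (auto simp: eventually_sequentially)
    qed
    show "AE t in lebesgue_on I. norm (max (g t - real n) 0) \<le> g t" for n
      using g(2) by (intro AE_I2) (auto simp: max_def)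
  qed (use g(1) borel_measurable_integrable[OF g(1)] in auto)
  then have "eventually (\<lambda>n. (LINT t|lebesgue_on I. max (g t - real n) 0) < e / (3 * C)) sequentially"
    using C e by (intro order_tendstoD(2)[where y=0]) auto
  then obtain M :: nat where M: "(LINT t|lebesgue_on I. max (g t - real M) 0) < e / (3 * C)"
    by (auto simp: eventually_sequentially)
  \<comment> \<open>Two errors of size \<open>e0\<close> add up to a distance whose \<open>q\<close>-th power is \<open>e\<close>.\<close>
  define e0 where "e0 = e powr (1 / q) / 2"
  have e0: "e0 > 0" "(2 * e0) powr q = e" using e q by (auto simp: e0_def powr_powr)
  define B where "B k = {t\<in>I. N (\<lambda>x. s k t x - F t x) > e0}" for k
  have Bm: "B k \<in> sets (lebesgue_on I)" for k
    using dm[of k] unfolding B_def borel_measurable_iff_greater by auto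
  have "(\<lambda>k. LINT t|lebesgue_on I. indicator (B k) t) \<longlonglongrightarrow> (LINT t|lebesgue_on I. (0::real))"
  proof (rule integral_dominated_convergence[where w="\<lambda>_. 1"])
    show "AE t in lebesgue_on I. (\<lambda>k. indicator (B k) t) \<longlonglongrightarrow> (0::real)"
      using s(2)
    proof eventually_elim
      case (elim t)
      then have "eventually (\<lambda>k. N (\<lambda>x. s k t x - F t x) < e0) sequentially"
        using e0 by (intro order_tendstoD(2)) auto
      then have "eventually (\<lambda>k. indicator (B k) t = (0::real)) sequentially"
        by eventually_elim (auto simp: B_def indicator_def)
      then show ?case by (rule tendsto_eventually)
    qed
  qed (use Bm in auto)
  define c where "c = e / (3 * (2 * C * (real M + 1)))"
  have c: "c > 0" using e C by (auto simp: c_def)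
  have "eventually (\<lambda>k. (LINT t|lebesgue_on I. indicator (B k) t) < c) sequentially"
    using \<open>(\<lambda>k. LINT t|lebesgue_on I. indicator (B k) t) \<longlonglongrightarrow> (LINT t|lebesgue_on I. (0::real))\<close> c
    by (intro order_tendstoD(2)[where y=0]) auto
  then obtain k where k: "(LINT t|lebesgue_on I. indicator (B k) t) < c"
    by (auto simp: eventually_sequentially)
  obtain Q d where Q: "Q \<subseteq> I" "Q \<in> sets lebesgue" "measure lebesgue (I - Q) \<le> c" "d > 0"
    "\<And>t r. t \<in> Q \<Longrightarrow> r \<in> Q \<Longrightarrow> \<bar>t - r\<bar> < d \<Longrightarrow> s k t = s k r"
    using step_fun_gap[OF s(1)[of k] I(2) c] by metis
  have IQ: "I - Q \<in> sets (lebesgue_on I)" using Q I by (auto simp: sets_restrict_space_iff)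
  have mIQ: "(LINT t|lebesgue_on I. indicator (I - Q) t) \<le> c"
    using Q(3) I(1) IQ by (simp add: measure_restrict_space Int_absorb2)
  \<comment> \<open>The factor 2 is needed because possibly only one of \<open>t\<close>, \<open>r\<close> lies in the exceptional set,
    while the truncated norms at both times have to be covered.\<close>
  define b where "b t = C * max (g t - real M) 0 + 2 * C * (real M + 1) * (indicator (I - Q) t + indicator (B k) t)" for t
  have ib: "integrable (lebesgue_on I) (\<lambda>t. max (g t - real M) 0)"
    "integrable (lebesgue_on I) (indicator (I - Q) :: real \<Rightarrow> real)"
    "integrable (lebesgue_on I) (indicator (B k) :: real \<Rightarrow> real)"
    using g(1) IQ Bm by (auto simp: fm.emeasure_finite less_top[symmetric] intro!: integrable_real_indicator)
  have b0: "b t \<ge> 0" for t using C by (auto simp: b_def)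
  have "almost_modulus I {t\<in>I. F t \<in> X} (\<lambda>t r. N (\<lambda>x. F t x - F r x) powr q) e b d"
    unfolding almost_modulus_def
  proof (intro conjI allI ballI impI b0)
    show "integrable (lebesgue_on I) b" unfolding b_def using ib by auto
    have "(LINT t|lebesgue_on I. b t) = C * (LINT t|lebesgue_on I. max (g t - real M) 0)
        + 2 * C * (real M + 1) * ((LINT t|lebesgue_on I. indicator (I - Q) t) + (LINT t|lebesgue_on I. indicator (B k) t))"
      unfolding b_def using ib by simp
    also have "\<dots> \<le> C * (e / (3 * C)) + 2 * C * (real M + 1) * (c + c)"
      using C M mIQ k by (intro add_mono mult_left_mono) auto
    also have "\<dots> = e"
    proof -
      have "x * (e / (3 * x)) = e / 3" if "x > 0" for x using that by simp
      then have "2 * C * (real M + 1) * c = e / 3" unfolding c_def using C by (metis mult_pos_pos of_nat_0_le_iff add_nonneg_pos zero_less_numeral zero_less_one)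
      then have "2 * C * (real M + 1) * (c + c) = e / 3 + e / 3"
        by (simp only: distrib_left[of "2 * C * (real M + 1)"])
      moreover have "C * (e / (3 * C)) = e / 3" using C by simp
      ultimately show ?thesis by linarith
    qed
    finally show "(LINT t|lebesgue_on I. b t) \<le> e" .
    show "d > 0" by fact
    fix t r assume "t \<in> {t\<in>I. F t \<in> X}" "r \<in> {t\<in>I. F t \<in> X}" "\<bar>t - r\<bar> < d"
    then have tr: "t \<in> I" "r \<in> I" "F t \<in> X" "F r \<in> X" "\<bar>t - r\<bar> < d" by auto
    show "N (\<lambda>x. F t x - F r x) powr q \<le> b t + b r + e"
    proof (cases "t \<in> Q \<and> r \<in> Q \<and> t \<notin> B k \<and> r \<notin> B k")
      case True
      then have "s k t = s k r" using Q(5) tr by blast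
      moreover have "N (\<lambda>x. F t x - F r x) \<le> N (\<lambda>x. F t x - s k t x) + N (\<lambda>x. s k t x - F r x)"
        using tr sX by (intro triangle) auto
      moreover have "N (\<lambda>x. F t x - s k t x) = N (\<lambda>x. s k t x - F t x)" using tr sX by (intro commute) auto
      ultimately have "N (\<lambda>x. F t x - F r x) \<le> 2 * e0" using True tr by (auto simp: B_def)
      then have "N (\<lambda>x. F t x - F r x) powr q \<le> e"
        using q nonneg powr_mono2[of q _ "2 * e0"] by (simp add: e0(2))
      then show ?thesis using b0[of t] b0[of r] by simp
    next
      case False
      have "N (\<lambda>x. F t x - F r x) powr q \<le> (N (F t) + N (F r)) powr q"
        using tr diff_le nonneg q by (intro powr_mono2) auto
      also have "\<dots> \<le> C * (g t + g r)"
        unfolding C_def g_def using q nonneg by (intro powr_add_le) auto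
      also have "\<dots> \<le> C * (max (g t - real M) 0 + max (g r - real M) 0 + 2 * (real M + 1))"
        using C by (intro mult_left_mono) auto
      also have "\<dots> \<le> b t + b r"
      proof -
        have "(1::real) \<le> indicator (I - Q) t + indicator (B k) t + (indicator (I - Q) r + indicator (B k) r)"
          using False tr by (auto simp: indicator_def)
        from mult_left_mono[OF this, of "2 * C * (real M + 1)"] C
        show ?thesis by (simp add: b_def distrib_left)
      qed
      finally show ?thesis using e by simp
    qed
  qed
  then show ?thesis by blast
qed

section \<open>Distributional derivatives in time\<close>

lemma lebesgue_on_support:
  fixes f :: "'a::euclidean_space \<Rightarrow> real"
  assumes "S \<subseteq> T" "S \<in> sets lebesgue" "T \<in> sets lebesgue" "\<And>x. x \<in> T \<Longrightarrow> x \<notin> S \<Longrightarrow> f x = 0"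
  shows "integrable (lebesgue_on T) f \<longleftrightarrow> integrable (lebesgue_on S) f"
    and "(LINT x|lebesgue_on T. f x) = (LINT x|lebesgue_on S. f x)"
proof -
  have "(\<lambda>x. if x \<in> T then f x else 0) = (\<lambda>x. if x \<in> S then f x else 0)"
    using assms(1,4) by (auto simp: fun_eq_iff)
  then show "integrable (lebesgue_on T) f \<longleftrightarrow> integrable (lebesgue_on S) f"
    "(LINT x|lebesgue_on T. f x) = (LINT x|lebesgue_on S. f x)"
    using assms(2,3) Lebesgue_Measure.integral_restrict_UNIV[of T f] Lebesgue_Measure.integral_restrict_UNIV[of S f]
      Lebesgue_Measure.integrable_restrict_UNIV[of T f] Lebesgue_Measure.integrable_restrict_UNIV[of S f] by auto
qed

text \<open>The derivatives of the rescaled steps are nonnegative, have integral one, and concentrate at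
  \<open>s\<close> from the right.\<close>
lemma smooth_step_deriv_approximate_identity:
  fixes H G :: "real \<Rightarrow> real"
  assumes H: "smooth_on UNIV H" "mono H" and H0: "\<forall>x\<le>0. H x = 0" and H1: "\<forall>x\<ge>1. H x = 1"
    and G: "continuous_on {0<..} G" and s: "s > 0"
  shows "(\<lambda>n. LINT r|lebesgue_on {0<..}. G r * (real (Suc n) * deriv H (real (Suc n) * (r - s)))) \<longlonglongrightarrow> G s"
    and "integrable (lebesgue_on {0<..}) (\<lambda>r. G r * (real (Suc n) * deriv H (real (Suc n) * (r - s))))"
proof -
  note H = H H0[rule_format] H1[rule_format]
  define c where "c n = real (Suc n)" for n
  define \<rho> where "\<rho> n r = c n * deriv H (c n * (r - s))" for n r
  have c: "c n > 0" for n by (simp add: c_def)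
  have D: "((\<lambda>r. H (c n * (r - s))) has_real_derivative \<rho> n r) (at r)" for n r
  proof -
    have "((\<lambda>r. c n * (r - s)) has_real_derivative c n) (at r)" by (auto intro!: derivative_eq_intros)
    from DERIV_chain2[OF smooth_on_real_deriv(2)[OF H(1)] this] show ?thesis
      by (simp add: \<rho>_def mult.commute)
  qed
  have dH0: "deriv H x \<ge> 0" for x
    by (rule mono_on_imp_deriv_nonneg[OF _ smooth_on_real_deriv(2)[OF H(1)], of UNIV]) (use H(2) in simp_all)
  have \<rho>0: "\<rho> n r \<ge> 0" for n r using dH0 c[of n] by (simp add: \<rho>_def)
  have dHz: "deriv H x = 0" if "x < 0 \<or> x > 1" for x
  proof -
    have "((\<lambda>x. H x) has_real_derivative 0) (at x)"
    proof (cases "x < 0")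
      case True
      have "eventually (\<lambda>y. H y = 0) (nhds x)"
        using eventually_nhds_in_open[of "{..<0}" x] True H(3) by (auto elim!: eventually_mono)
      from DERIV_cong_ev[OF refl this refl, of 0] show ?thesis by simp
    next
      case False
      have "eventually (\<lambda>y. H y = 1) (nhds x)"
        using eventually_nhds_in_open[of "{1<..}" x] that False H(4) by (auto elim!: eventually_mono)
      from DERIV_cong_ev[OF refl this refl, of 0] show ?thesis by simp
    qed
    then show ?thesis by (rule DERIV_imp_deriv)
  qed
  have c\<rho>: "continuous_on S (\<rho> n)" for S n
  proof -
    have "continuous_on UNIV (deriv H)"
      by (rule smooth_on_imp_continuous_on[OF smooth_on_real_deriv(1)[OF H(1)]])
    from continuous_on_compose2[OF this, of S "\<lambda>r. c n * (r - s)"]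
    have "continuous_on S (\<lambda>r. deriv H (c n * (r - s)))" by (simp add: continuous_intros)
    then show ?thesis unfolding \<rho>_def by (rule continuous_on_mult_left)
  qed
  let ?I = "\<lambda>n. {s..s + 1 / c n}"
  have z: "\<rho> n r = 0" if "r \<notin> ?I n" for n r
  proof -
    have "c n * (r - s) < 0 \<or> c n * (r - s) > 1"
      using that c[of n] by (auto simp: mult_less_0_iff field_simps)
    then show ?thesis using dHz by (simp add: \<rho>_def)
  qed
  have sub: "?I n \<subseteq> {0<..}" for n using s by auto
  have cG: "continuous_on (?I n) G" for n using G sub continuous_on_subset by blast
  have i1: "integrable (lebesgue_on (?I n)) (\<rho> n)" for n by (intro continuous_imp_integrable_real c\<rho>)
  have i2: "integrable (lebesgue_on (?I n)) (\<lambda>r. G r * \<rho> n r)" for n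
    by (intro continuous_imp_integrable_real continuous_intros c\<rho> cG)
  note supp = lebesgue_on_support[where T="{0<..}" and S="?I n" and f="\<lambda>r. G r * \<rho> n r" for n, OF sub]
  show "integrable (lebesgue_on {0<..}) (\<lambda>r. G r * (real (Suc n) * deriv H (real (Suc n) * (r - s))))"
    using supp(1)[of n] i2[of n] z[of _ n] by (simp add: \<rho>_def c_def)
  have eq: "(LINT r|lebesgue_on {0<..}. G r * \<rho> n r) = (LINT r|lebesgue_on (?I n). G r * \<rho> n r)" for n
    using supp(2)[of n] z[of _ n] by simp
  have one: "(LINT r|lebesgue_on (?I n). \<rho> n r) = 1" for n
  proof -
    have "((\<rho> n) has_integral (H (c n * (s + 1 / c n - s)) - H (c n * (s - s)))) (?I n)"
      using D c[of n]
      by (intro fundamental_theorem_of_calculus[where f="\<lambda>r. H (c n * (r - s))"])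
         (auto simp: has_real_derivative_iff_has_vector_derivative[symmetric] intro: DERIV_subset)
    then have "integral (?I n) (\<rho> n) = 1" using H(3)[of 0] H(4)[of 1] c[of n] by (simp add: integral_unique)
    then show ?thesis using lebesgue_integral_eq_integral[OF i1] by simp
  qed
  have "(\<lambda>n. LINT r|lebesgue_on {0<..}. G r * \<rho> n r) \<longlonglongrightarrow> G s"
  proof (rule LIMSEQ_I)
    fix e :: real assume e: "e > 0"
    have "isCont G s" using G s by (simp add: continuous_on_eq_continuous_at)
    then obtain d where d: "d > 0" "\<And>r. \<bar>r - s\<bar> < d \<Longrightarrow> \<bar>G r - G s\<bar> < e / 2"
      unfolding continuous_at_eps_delta dist_real_def using e by (metis half_gt_zero)
    obtain n0 where n0: "1 / d < real n0" using reals_Archimedean2 by blast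
    have "norm ((LINT r|lebesgue_on {0<..}. G r * \<rho> n r) - G s) < e" if n: "n \<ge> n0" for n
    proof -
      have "1 / d < c n" using n0 n by (simp add: c_def)
      then have cn: "1 / c n < d" using d(1) c[of n] by (simp add: field_simps)
      have "(LINT r|lebesgue_on (?I n). G r * \<rho> n r) - G s = (LINT r|lebesgue_on (?I n). G r * \<rho> n r) - G s * (LINT r|lebesgue_on (?I n). \<rho> n r)"
        by (simp add: one)
      also have "\<dots> = (LINT r|lebesgue_on (?I n). (G r - G s) * \<rho> n r)"
        using i1[of n] i2[of n] by (simp add: left_diff_distrib)
      finally have "norm ((LINT r|lebesgue_on (?I n). G r * \<rho> n r) - G s) = norm (LINT r|lebesgue_on (?I n). (G r - G s) * \<rho> n r)" by simp
      also have "\<dots> \<le> (LINT r|lebesgue_on (?I n). norm ((G r - G s) * \<rho> n r))"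
        by (rule integral_norm_bound)
      also have "\<dots> \<le> (LINT r|lebesgue_on (?I n). e / 2 * \<rho> n r)"
      proof (rule integral_mono)
        show "integrable (lebesgue_on (?I n)) (\<lambda>r. norm ((G r - G s) * \<rho> n r))"
          by (intro continuous_imp_integrable_real continuous_intros c\<rho> cG)
        show "integrable (lebesgue_on (?I n)) (\<lambda>r. e / 2 * \<rho> n r)" using i1 by simp
        fix r assume "r \<in> space (lebesgue_on (?I n))"
        then have "\<bar>r - s\<bar> < d" using cn by auto
        then show "norm ((G r - G s) * \<rho> n r) \<le> e / 2 * \<rho> n r"
          using mult_right_mono[OF less_imp_le[OF d(2)[of r]] \<rho>0[of n r]] \<rho>0[of n r] by (simp add: abs_mult)
      qed
      also have "\<dots> = e / 2" using one[of n] by simp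
      finally show ?thesis using e eq[of n] by simp
    qed
    then show "\<exists>n0. \<forall>n\<ge>n0. norm ((LINT r|lebesgue_on {0<..}. G r * \<rho> n r) - G s) < e" by blast
  qed
  then show "(\<lambda>n. LINT r|lebesgue_on {0<..}. G r * (real (Suc n) * deriv H (real (Suc n) * (r - s)))) \<longlonglongrightarrow> G s"
    by (simp only: \<rho>_def c_def)
qed

text \<open>Test with smooth approximations of the indicator of the interval from \<open>s\<close> to \<open>t\<close>, differences
  of two rescaled steps: their derivatives converge to the point mass at \<open>s\<close> minus the point mass at
  \<open>t\<close>. The step starting at \<open>t\<close> descends to the right of \<open>t\<close>, so the approximations live on the
  interval up to \<open>t + 1\<close>.\<close>
lemma scalar_distr_deriv_increment:
  assumes gk: "scalar_distr_deriv g k" and ae: "AE t in lebesgue_on {0<..}. g t = G t"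
    and G: "continuous_on {0<..} G" and st: "0 < s" "s < t"
  shows "G t - G s = (LINT r|lebesgue_on {s..t}. k r)"
    and "integrable (lebesgue_on {s..t}) k"
proof -
  have "compact {s..t}" "{s..t} \<subseteq> {0<..}" using st by auto
  then show ik: "integrable (lebesgue_on {s..t}) k"
    using gk unfolding scalar_distr_deriv_def loc_integrable_def by blast
  have lk: "loc_integrable {0<..} k" using gk by (simp add: scalar_distr_deriv_def)
  obtain H :: "real \<Rightarrow> real" where H: "smooth_on UNIV H" "mono H"
    "\<And>x. x \<le> 0 \<Longrightarrow> H x = 0" "\<And>x. x \<ge> 1 \<Longrightarrow> H x = 1" using smooth_step_exists by metis
  have H01: "0 \<le> H x" "H x \<le> 1" for x
    using monoD[OF H(2), of "min x 0" x] monoD[OF H(2), of x "max x 1"] H(3)[of "min x 0"] H(4)[of "max x 1"] by auto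
  define c where "c n = real (Suc n)" for n
  have c: "c n \<ge> 1" for n by (simp add: c_def)
  define \<phi> where "\<phi> n r = H (c n * (r - s)) - H (c n * (r - t))" for n r
  have D: "(\<phi> n has_real_derivative (c n * deriv H (c n * (r - s)) - c n * deriv H (c n * (r - t)))) (at r)" for n r
    unfolding \<phi>_def
    by (auto intro!: derivative_eq_intros smooth_on_real_deriv(2)[OF H(1), THEN DERIV_chain2])
  have d\<phi>: "deriv (\<phi> n) r = c n * deriv H (c n * (r - s)) - c n * deriv H (c n * (r - t))" for n r
    using DERIV_imp_deriv[OF D] .
  have out: "\<phi> n r = 0" if "r \<notin> {s..t+1}" for n r
  proof (cases "r < s")
    case True
    then have "c n * (r - s) \<le> 0" "c n * (r - t) \<le> 0"
      using st c[of n] by (auto intro!: mult_nonneg_nonpos)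
    then show ?thesis by (simp add: \<phi>_def H(3))
  next
    case False
    then have "1 * 1 \<le> c n * (r - s)" "1 * 1 \<le> c n * (r - t)"
      using st c[of n] that mult_mono[of 1 "c n" 1 "r - s"] mult_mono[of 1 "c n" 1 "r - t"] by auto
    then show ?thesis by (simp add: \<phi>_def H(4))
  qed
  have test: "test_fun {0<..} (\<phi> n)" for n
  proof (rule test_funI[of _ "{s..t+1}"])
    have "smooth_on UNIV (\<lambda>r::real. H (c n * (r \<bullet> 1) + (- c n * s)) - H (c n * (r \<bullet> 1) + (- c n * t)))"
      by (intro smooth_on_diff smooth_on_comp_affine H)
    then show "smooth_on UNIV (\<phi> n)" by (simp add: \<phi>_def[abs_def] algebra_simps inner_real_def)
  qed (use out st in auto)
  have "\<forall>x\<le>0. H x = 0" "\<forall>x\<ge>1. H x = 1" using H(3,4) by auto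
  note lim = smooth_step_deriv_approximate_identity[OF H(1,2) this G, folded c_def]
  have t0: "t > 0" using st by simp
  have gG: "(LINT r|lebesgue_on {0<..}. g r * deriv (\<phi> n) r) =
      (LINT r|lebesgue_on {0<..}. G r * (c n * deriv H (c n * (r - s)))) - (LINT r|lebesgue_on {0<..}. G r * (c n * deriv H (c n * (r - t))))" for n
  proof -
    have iG: "integrable (lebesgue_on {0<..}) (\<lambda>r. G r * deriv (\<phi> n) r)"
      using Bochner_Integration.integrable_diff[OF lim(2)[OF st(1), of n] lim(2)[OF t0, of n]]
      by (simp add: d\<phi> right_diff_distrib)
    have dm: "test_fun {0<..} (deriv (\<phi> n))"
    proof -
      have "deriv (\<phi> n) = (\<lambda>r. frechet_derivative (\<phi> n) (at r) 1)"
        using D frechet_derivative_real_1 d\<phi> by metis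
      then show ?thesis using test_fun_deriv[OF test, of 1 n] by simp
    qed
    have "loc_integrable {0<..} g" using gk by (simp add: scalar_distr_deriv_def)
    then have ig: "integrable (lebesgue_on {0<..}) (\<lambda>r. g r * deriv (\<phi> n) r)"
      using loc_integrable_mult_test_fun[OF _ _ dm] by simp
    have "(LINT r|lebesgue_on {0<..}. g r * deriv (\<phi> n) r) = (LINT r|lebesgue_on {0<..}. G r * deriv (\<phi> n) r)"
      using ae by (intro integral_cong_AE borel_measurable_integrable[OF ig] borel_measurable_integrable[OF iG])
        (auto elim: AE_mp)
    also have "\<dots> = (LINT r|lebesgue_on {0<..}. G r * (c n * deriv H (c n * (r - s))) - G r * (c n * deriv H (c n * (r - t))))"
      by (simp add: d\<phi> right_diff_distrib)
    also have "\<dots> = (LINT r|lebesgue_on {0<..}. G r * (c n * deriv H (c n * (r - s)))) - (LINT r|lebesgue_on {0<..}. G r * (c n * deriv H (c n * (r - t))))"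
      by (intro Bochner_Integration.integral_diff lim(2) st(1) t0)
    finally show ?thesis .
  qed
  have 1: "(\<lambda>n. LINT r|lebesgue_on {0<..}. g r * deriv (\<phi> n) r) \<longlonglongrightarrow> G s - G t"
    unfolding gG by (intro tendsto_diff lim(1) st(1) t0)
  have idom: "integrable (lebesgue_on {0<..}) (\<lambda>r. k r * indicator {s..t+1} r)"
    using st by (intro loc_integrable_mult_bounded[OF lk, of "{s..t+1}", where M=1]) (auto simp: indicator_def)
  have ilim: "integrable (lebesgue_on {0<..}) (\<lambda>r. k r * indicator {s<..t} r)"
    using st by (intro loc_integrable_mult_bounded[OF lk, of "{s..t}", where M=1]) (auto simp: indicator_def)
  have ilim': "integrable (lebesgue_on {0<..}) (\<lambda>r. k r * indicator {s..t} r)"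
    using st by (intro loc_integrable_mult_bounded[OF lk, of "{s..t}", where M=1]) (auto simp: indicator_def)
  have Hlim: "(\<lambda>n. H (c n * x)) \<longlonglongrightarrow> 1" if "x > 0" for x
  proof -
    obtain N :: nat where N: "1 / x \<le> N" using real_arch_simple by blast
    have "H (c n * x) = 1" if "n \<ge> N" for n
    proof -
      have "1 / x \<le> c n" using N that by (simp add: c_def)
      then show ?thesis using \<open>x > 0\<close> by (intro H(4)) (simp add: field_simps)
    qed
    then show ?thesis by (intro tendsto_eventually) (auto simp: eventually_sequentially)
  qed
  have plim: "(\<lambda>n. \<phi> n r) \<longlonglongrightarrow> indicator {s<..t} r" for r
  proof -
    have neg: "(\<lambda>n. H (c n * x)) \<longlonglongrightarrow> 0" if "x \<le> 0" for x
      using that c by (simp add: H(3) mult_nonneg_nonpos order_trans[OF zero_le_one])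
    have "(\<lambda>n. H (c n * x)) \<longlonglongrightarrow> (if x > 0 then 1 else 0)" for x using neg[of x] Hlim[of x] by auto
    from tendsto_diff[OF this[of "r - s"] this[of "r - t"]]
    show ?thesis using st by (auto simp: \<phi>_def indicator_def split: if_splits)
  qed
  have 2: "(\<lambda>n. LINT r|lebesgue_on {0<..}. k r * \<phi> n r) \<longlonglongrightarrow> (LINT r|lebesgue_on {0<..}. k r * indicator {s<..t} r)"
  proof (rule integral_dominated_convergence[OF _ _ integrable_norm[OF idom]])
    show "AE r in lebesgue_on {0<..}. (\<lambda>n. k r * \<phi> n r) \<longlonglongrightarrow> k r * indicator {s<..t} r"
      by (intro AE_I2 tendsto_intros plim)
    have "\<bar>\<phi> n r\<bar> \<le> indicator {s..t+1} r" for n r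
      using out[of r n] H01[of "c n * (r - s)"] H01[of "c n * (r - t)"] by (cases "r \<in> {s..t+1}") (auto simp: \<phi>_def)
    then show "AE r in lebesgue_on {0<..}. norm (k r * \<phi> n r) \<le> norm (k r * indicator {s..t+1} r)" for n
      by (intro AE_I2) (auto simp: abs_mult intro!: mult_left_mono)
    show "(\<lambda>r. k r * \<phi> n r) \<in> borel_measurable (lebesgue_on {0<..})" for n
      by (intro borel_measurable_integrable loc_integrable_mult_test_fun[OF lk _ test]) simp
  qed (use borel_measurable_integrable[OF ilim] in simp)
  have "(LINT r|lebesgue_on {0<..}. g r * deriv (\<phi> n) r) = - (LINT r|lebesgue_on {0<..}. k r * \<phi> n r)" for n
    using gk test by (simp add: scalar_distr_deriv_def)
  with 1 have "(\<lambda>n. - (LINT r|lebesgue_on {0<..}. k r * \<phi> n r)) \<longlonglongrightarrow> G s - G t" by simp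
  with tendsto_minus[OF 2] have "G s - G t = - (LINT r|lebesgue_on {0<..}. k r * indicator {s<..t} r)"
    by (rule LIMSEQ_unique[rotated])
  also have "(LINT r|lebesgue_on {0<..}. k r * indicator {s<..t} r) = (LINT r|lebesgue_on {0<..}. k r * indicator {s..t} r)"
  proof (rule integral_cong_AE[OF borel_measurable_integrable[OF ilim] borel_measurable_integrable[OF ilim']])
    have "AE r in lebesgue. r \<noteq> s" by (intro AE_completion AE_lborel_singleton)
    then have "AE r in lebesgue_on {0<..}. r \<noteq> s" by (simp add: AE_restrict_space_iff) (auto elim: AE_mp)
    then show "AE r in lebesgue_on {0<..}. k r * indicator {s<..t} r = k r * indicator {s..t} r"
      by eventually_elim (auto simp: indicator_def)
  qed
  also have "\<dots> = (LINT r|lebesgue_on {s..t}. k r * indicator {s..t} r)"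
    using st by (intro lebesgue_on_support(2)) auto
  also have "\<dots> = (LINT r|lebesgue_on {s..t}. k r)"
    by (intro Bochner_Integration.integral_cong) auto
  finally show "G t - G s = (LINT r|lebesgue_on {s..t}. k r)" by simp
qed

section \<open>Averaged increments and Gronwall's inequality\<close>

text \<open>A bound on the difference quotients at almost every single time would not control the
  increments of \<open>z\<close>, as the Cantor function shows; here the bound is uniform in small \<open>\<delta>\<close>, and can
  be integrated over \<open>t\<close> before \<open>\<delta>\<close> tends to zero. The integral of \<open>z(t) - z(t - \<delta>)\<close> telescopes to
  averages of \<open>z\<close> near the end points.\<close>
lemma increment_le_integral_of_AE_quotient:
  fixes z b :: "real \<Rightarrow> real"
  assumes z: "continuous_on {\<alpha>..\<tau>} z" and b: "integrable (lebesgue_on {s..\<tau>}) b"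
    and ord: "\<alpha> < s" "s < \<tau>" and d: "d > 0"
    and le: "\<And>\<delta>. 0 < \<delta> \<Longrightarrow> \<delta> < d \<Longrightarrow> \<delta> \<le> s - \<alpha> \<Longrightarrow> AE t in lebesgue_on {s..\<tau>}. z t - z (t - \<delta>) \<le> \<delta> * b t"
  shows "z \<tau> - z s \<le> (LINT t|lebesgue_on {s..\<tau>}. b t)"
proof (rule field_le_epsilon)
  fix e :: real assume e: "e > 0"
  have "continuous (at \<tau> within {\<alpha>..\<tau>}) z" "continuous (at s within {\<alpha>..\<tau>}) z"
    using z ord by (auto simp: continuous_on_eq_continuous_within)
  then obtain d1 d2 where d1: "d1 > 0" "\<And>x. x \<in> {\<alpha>..\<tau>} \<Longrightarrow> \<bar>x - \<tau>\<bar> < d1 \<Longrightarrow> \<bar>z x - z \<tau>\<bar> < e / 2"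
    and d2: "d2 > 0" "\<And>x. x \<in> {\<alpha>..\<tau>} \<Longrightarrow> \<bar>x - s\<bar> < d2 \<Longrightarrow> \<bar>z x - z s\<bar> < e / 2"
    unfolding continuous_within_eps_delta dist_real_def using e by (metis half_gt_zero)
  define \<delta> where "\<delta> = Min {d1, d2, d, s - \<alpha>, \<tau> - s} / 2"
  have \<delta>: "0 < \<delta>" "\<delta> < d1" "\<delta> < d2" "\<delta> < d" "\<delta> < s - \<alpha>" "\<delta> < \<tau> - s"
    using d1(1) d2(1) d ord by (auto simp: \<delta>_def min_def)
  have iz: "z integrable_on {x..y}" if "\<alpha> \<le> x" "y \<le> \<tau>" for x y
    using z that by (intro integrable_continuous_real) (auto elim!: continuous_on_subset)
  have c1: "continuous_on {s..\<tau>} z" using z ord by (auto elim!: continuous_on_subset)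
  have c2: "continuous_on {s..\<tau>} (\<lambda>t. z (t - \<delta>))"
    using \<delta> ord by (intro continuous_on_compose2[OF z] continuous_intros) auto
  have i: "integrable (lebesgue_on {s..\<tau>}) (\<lambda>t. z t - z (t - \<delta>))"
    by (intro continuous_imp_integrable_real continuous_intros c1 c2)
  have "(LINT t|lebesgue_on {s..\<tau>}. z t - z (t - \<delta>)) \<le> (LINT t|lebesgue_on {s..\<tau>}. \<delta> * b t)"
    using le[of \<delta>] \<delta> i b by (intro integral_mono_AE) auto
  also have "\<dots> = \<delta> * (LINT t|lebesgue_on {s..\<tau>}. b t)" by simp
  also have "(LINT t|lebesgue_on {s..\<tau>}. z t - z (t - \<delta>)) = integral {s..\<tau>} (\<lambda>t. z t - z (t - \<delta>))"
    using lebesgue_integral_eq_integral[OF i] by simp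
  also have "\<dots> = integral {s..\<tau>} z - integral {s..\<tau>} (\<lambda>t. z (t - \<delta>))"
    by (intro Henstock_Kurzweil_Integration.integral_diff integrable_continuous_real c1 c2)
  also have "integral {s..\<tau>} (\<lambda>t. z (t - \<delta>)) = integral {s - \<delta>..\<tau> - \<delta>} z"
    using integral_shift_real_ivl[of "s - \<delta>" "-\<delta>" "\<tau> - \<delta>" z] by simp
  also have "integral {s..\<tau>} z = integral {s..\<tau> - \<delta>} z + integral {\<tau> - \<delta>..\<tau>} z"
    using \<delta> ord by (intro Henstock_Kurzweil_Integration.integral_combine[symmetric] iz) auto
  also have "integral {s - \<delta>..\<tau> - \<delta>} z = integral {s - \<delta>..s} z + integral {s..\<tau> - \<delta>} z"
    using \<delta> ord by (intro Henstock_Kurzweil_Integration.integral_combine[symmetric] iz) auto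
  finally have main: "integral {\<tau> - \<delta>..\<tau>} z - integral {s - \<delta>..s} z \<le> \<delta> * (LINT t|lebesgue_on {s..\<tau>}. b t)" by simp
  have "integral {\<tau> - \<delta>..\<tau>} (\<lambda>_. z \<tau> - e / 2) \<le> integral {\<tau> - \<delta>..\<tau>} z"
  proof (rule integral_le)
    fix x assume "x \<in> {\<tau> - \<delta>..\<tau>}"
    then have "\<bar>z x - z \<tau>\<bar> < e / 2" using \<delta> ord by (intro d1(2)) auto
    then show "z \<tau> - e / 2 \<le> z x" by linarith
  qed (use \<delta> ord iz in auto)
  then have l1: "\<delta> * (z \<tau> - e / 2) \<le> integral {\<tau> - \<delta>..\<tau>} z" using \<delta> by simp
  have "integral {s - \<delta>..s} z \<le> integral {s - \<delta>..s} (\<lambda>_. z s + e / 2)"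
  proof (rule integral_le)
    fix x assume "x \<in> {s - \<delta>..s}"
    then have "\<bar>z x - z s\<bar> < e / 2" using \<delta> ord by (intro d2(2)) auto
    then show "z x \<le> z s + e / 2" by linarith
  qed (use \<delta> ord iz in auto)
  then have l2: "integral {s - \<delta>..s} z \<le> \<delta> * (z s + e / 2)" using \<delta> by simp
  have "\<delta> * (z \<tau> - z s - e) \<le> \<delta> * (LINT t|lebesgue_on {s..\<tau>}. b t)"
    using main l1 l2 by (simp add: algebra_simps)
  then show "z \<tau> - z s \<le> (LINT t|lebesgue_on {s..\<tau>}. b t) + e" using \<delta>(1) by simp
qed

text \<open>As \<open>s\<close> tends to zero the hypothesis becomes \<open>y \<le> c Y\<close> for the primitive \<open>Y\<close> of \<open>y\<close>, so
  \<open>exp (- c t) Y(t)\<close> is nonincreasing and starts at zero.\<close>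
lemma Gronwall_zero:
  fixes y :: "real \<Rightarrow> real"
  assumes y: "continuous_on {0..} y" and y0: "y 0 = 0" "\<And>t. t \<ge> 0 \<Longrightarrow> y t \<ge> 0" and c: "c \<ge> 0"
    and le: "\<And>s \<tau>. 0 < s \<Longrightarrow> s < \<tau> \<Longrightarrow> y \<tau> - y s \<le> c * (LINT t|lebesgue_on {s..\<tau>}. y t)"
    and "\<tau> \<ge> 0"
  shows "y \<tau> = 0"
proof -
  have cy: "continuous_on {a..b} y" if "a \<ge> 0" for a b using y that by (auto elim!: continuous_on_subset)
  define Y where "Y t = integral {0..t} y" for t
  have yY: "y t \<le> c * Y t" if t: "t > 0" for t
  proof -
    have "(y \<longlongrightarrow> y 0) (at 0 within {0..})" using y by (simp add: continuous_on_def)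
    then have "(y \<longlongrightarrow> 0) (at_right 0)" using y0 by (metis atLeast_iff greaterThan_iff less_imp_le subsetI tendsto_within_subset)
    then have lim: "((\<lambda>s. y s + c * Y t) \<longlongrightarrow> 0 + c * Y t) (at_right 0)" by (intro tendsto_intros)
    have "eventually (\<lambda>s. s \<in> {0<..<t}) (at_right 0)" using t eventually_at_right_field by fastforce
    then have ev: "eventually (\<lambda>s. y t \<le> y s + c * Y t) (at_right 0)"
    proof eventually_elim
      case (elim s)
      then have s: "0 < s" "s < t" by auto
      have "(LINT t|lebesgue_on {s..t}. y t) = integral {s..t} y"
        using s cy by (intro lebesgue_integral_eq_integral continuous_imp_integrable_real) auto
      also have "\<dots> \<le> Y t"
        unfolding Y_def using s y0(2) cy by (intro integral_subset_le integrable_continuous_real) auto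
      finally have "c * (LINT t|lebesgue_on {s..t}. y t) \<le> c * Y t" using c by (rule mult_left_mono)
      then show ?case using le[OF s] by simp
    qed
    show ?thesis using tendsto_lowerbound[OF lim ev] by simp
  qed
  have Yz: "Y t \<le> 0" if t: "t > 0" for t
  proof -
    define E where "E r = exp (- c * r) * Y r" for r
    have cY: "continuous_on {0..t} Y" unfolding Y_def
      by (intro indefinite_integral_continuous_1 integrable_continuous_real cy) simp
    have DY: "(Y has_real_derivative y r) (at r)" if r: "0 < r" "r < t" for r
    proof -
      have "(Y has_real_derivative y r) (at r within {0..t})" unfolding Y_def
        using r cy by (intro integral_has_real_derivative) auto
      then show ?thesis using r by (simp add: at_within_Icc_at)
    qed
    have "E t \<le> E 0"
    proof (rule DERIV_nonpos_imp_decreasing_open[of 0 t E])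
      show "0 \<le> t" using t by simp
      show "continuous_on {0..t} E" unfolding E_def by (intro continuous_intros cY)
      fix r assume r: "0 < r" "r < t"
      have "(E has_real_derivative (exp (- c * r) * (y r - c * Y r))) (at r)"
        unfolding E_def using DY[OF r] by (auto intro!: derivative_eq_intros simp: algebra_simps)
      moreover have "exp (- c * r) * (y r - c * Y r) \<le> 0" using yY[OF r(1)] by (simp add: mult_nonneg_nonpos)
      ultimately show "\<exists>y. (E has_real_derivative y) (at r) \<and> y \<le> 0" by blast
    qed
    then show ?thesis by (simp add: E_def Y_def mult_le_0_iff)
  qed
  show ?thesis
  proof (cases "\<tau> = 0")
    case False
    then have "y \<tau> \<le> 0" using yY[of \<tau>] Yz[of \<tau>] c \<open>\<tau> \<ge> 0\<close> by (smt (verit) mult_nonneg_nonpos)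
    then show ?thesis using y0(2)[OF \<open>\<tau> \<ge> 0\<close>] by simp
  qed (simp add: y0)
qed

lemma lebesgue_on_integrable_subset:
  fixes f :: "'a::euclidean_space \<Rightarrow> real"
  assumes "integrable (lebesgue_on T) f" "S \<subseteq> T" "S \<in> sets lebesgue" "T \<in> sets lebesgue"
  shows "integrable (lebesgue_on S) f"
proof -
  have "set_integrable lebesgue T f" using assms by (simp add: integrable_restrict_space set_integrable_def)
  then have "set_integrable lebesgue S f" by (rule set_integrable_subset[OF _ assms(3,2)])
  then show ?thesis using assms by (simp add: integrable_restrict_space set_integrable_def)
qed

lemma AE_lebesgue_on_subset:
  fixes S :: "'a::euclidean_space set"
  assumes "AE x in lebesgue_on T. P x" "S \<subseteq> T" "S \<in> sets lebesgue" "T \<in> sets lebesgue"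
  shows "AE x in lebesgue_on S. P x"
  using assms by (simp add: AE_restrict_space_iff) (auto elim!: AE_mp)

lemma LINT_interval_diff:
  fixes k :: "real \<Rightarrow> real"
  assumes k: "integrable (lebesgue_on {\<alpha>..\<tau>}) k" and "\<alpha> \<le> r" "r \<le> t" "t \<le> \<tau>"
  shows "(LINT x|lebesgue_on {\<alpha>..t}. k x) - (LINT x|lebesgue_on {\<alpha>..r}. k x) = (LINT x|lebesgue_on {r..t}. k x)"
proof -
  have i: "integrable (lebesgue_on {x..y}) k" if "\<alpha> \<le> x" "y \<le> \<tau>" for x y
    using that by (intro lebesgue_on_integrable_subset[OF k]) auto
  have "(LINT x|lebesgue_on {x..y}. k x) = integral {x..y} k" if "\<alpha> \<le> x" "y \<le> \<tau>" for x y
    using lebesgue_integral_eq_integral[OF i[OF that]] by simp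
  moreover have "integral {\<alpha>..r} k + integral {r..t} k = integral {\<alpha>..t} k"
    using assms by (intro Henstock_Kurzweil_Integration.integral_combine integrable_on_lebesgue_on i) auto
  ultimately show ?thesis using assms by simp
qed

text \<open>The part of the bound that is itself an integral over the short interval is absorbed by
  subtracting the primitive of \<open>k\<close> from \<open>y\<close>.\<close>
lemma increment_le_integral:
  fixes y k b :: "real \<Rightarrow> real"
  assumes y: "continuous_on {\<alpha>..\<tau>} y" and k: "integrable (lebesgue_on {\<alpha>..\<tau>}) k"
    and b: "integrable (lebesgue_on {s..\<tau>}) b"
    and ord: "\<alpha> < s" "s < \<tau>" and d: "d > 0"
    and le: "\<And>\<delta>. 0 < \<delta> \<Longrightarrow> \<delta> < d \<Longrightarrow> \<delta> \<le> s - \<alpha> \<Longrightarrow>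
       AE t in lebesgue_on {s..\<tau>}. y t - y (t - \<delta>) \<le> (LINT r|lebesgue_on {t - \<delta>..t}. k r) + \<delta> * b t"
  shows "y \<tau> - y s \<le> (LINT t|lebesgue_on {s..\<tau>}. k t) + (LINT t|lebesgue_on {s..\<tau>}. b t)"
proof -
  define z where "z t = y t - (LINT x|lebesgue_on {\<alpha>..t}. k x)" for t
  have "z \<tau> - z s \<le> (LINT t|lebesgue_on {s..\<tau>}. b t)"
  proof (rule increment_le_integral_of_AE_quotient[OF _ b ord d])
    show "continuous_on {\<alpha>..\<tau>} z"
      unfolding z_def by (intro continuous_intros y indefinite_integral_continuous_real k)
    fix \<delta> assume \<delta>: "0 < \<delta>" "\<delta> < d" "\<delta> \<le> s - \<alpha>"
    have "AE t in lebesgue_on {s..\<tau>}. t \<in> {s..\<tau>}" by (rule AE_I2) simp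
    with le[OF \<delta>] show "AE t in lebesgue_on {s..\<tau>}. z t - z (t - \<delta>) \<le> \<delta> * b t"
    proof eventually_elim
      case (elim t)
      then show ?case using LINT_interval_diff[OF k, of "t - \<delta>" t] \<delta> by (simp add: z_def)
    qed
  qed
  then show ?thesis using LINT_interval_diff[OF k, of s \<tau>] ord by (simp add: z_def)
qed

lemma scalar_distr_deriv_diff:
  assumes "scalar_distr_deriv g k" "scalar_distr_deriv g' k'"
  shows "scalar_distr_deriv (\<lambda>t. g t - g' t) (\<lambda>t. k t - k' t)"
  unfolding scalar_distr_deriv_def
proof (intro conjI allI impI)
  note A = assms[unfolded scalar_distr_deriv_def]
  show "loc_integrable {0<..} (\<lambda>t. g t - g' t)" "loc_integrable {0<..} (\<lambda>t. k t - k' t)"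
    using A loc_integrable_diff by auto
  fix \<phi> :: "real \<Rightarrow> real" assume t: "test_fun {0<..} \<phi>"
  have "deriv \<phi> = (\<lambda>r. frechet_derivative \<phi> (at r) 1)"
    using frechet_derivative_real_eq_deriv smooth_on_imp_differentiable[OF test_fun_smooth[OF t]] by auto
  then have t': "test_fun {0<..} (deriv \<phi>)" using test_fun_deriv[OF t, of 1] by simp
  note i = loc_integrable_mult_test_fun[OF _ _ t] loc_integrable_mult_test_fun[OF _ _ t']
  show "(LINT t|lebesgue_on {0<..}. (g t - g' t) * deriv \<phi> t) = - (LINT t|lebesgue_on {0<..}. (k t - k' t) * \<phi> t)"
    using A t i by (simp add: left_diff_distrib)
qed

text \<open>Young's inequality with a small factor for \<open>z\<close> and a large one for \<open>y\<close>. The first term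
  dominates if \<open>y \<le> l z\<close>, and the second otherwise.\<close>
lemma powr_Young:
  fixes z y l p :: real
  assumes "p \<ge> 1" "z \<ge> 0" "y \<ge> 0" "l > 0"
  shows "z powr (p - 1) * y \<le> l * z powr p + l powr (1 - p) * y powr p"
proof (cases "y \<le> l * z")
  case True
  have "z powr (p - 1) * y \<le> z powr (p - 1) * (l * z)" using True by (intro mult_left_mono) auto
  also have "\<dots> = l * z powr p"
    using assms by (cases "z = 0") (auto simp: powr_diff)
  also have "\<dots> \<le> l * z powr p + l powr (1 - p) * y powr p" by simp
  finally show ?thesis .
next
  case False
  then have y: "y > 0" using assms by (smt (verit) mult_nonneg_nonneg)
  have "z powr (p - 1) * y \<le> (y / l) powr (p - 1) * y"
    using False assms y by (intro mult_right_mono powr_mono2) (auto simp: field_simps)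
  also have "\<dots> = l powr (1 - p) * y powr p"
    using assms y by (simp add: powr_divide powr_diff field_simps)
  also have "\<dots> \<le> l * z powr p + l powr (1 - p) * y powr p" using assms by simp
  finally show ?thesis .
qed

section \<open>The monotone structure of the equation\<close>

text \<open>The structural conditions in the form in which they are used: one-sided Lipschitz continuity
  and growth of order \<open>p - 1\<close> instead of bounds on \<open>f'\<close> and \<open>f(s) s\<close>.\<close>
locale nonlocal_problem =
  fixes \<Omega> :: "'a::euclidean_space set" and f a :: "real \<Rightarrow> real" and p \<eta> C :: real
  assumes open_\<Omega>: "open \<Omega>" and bounded_\<Omega>: "bounded \<Omega>" and p: "p \<ge> 2"
    and f_cont: "continuous_on UNIV f"
    and f_incr: "\<And>x y. (f x - f y) * (x - y) \<le> \<eta> * (x - y)\<^sup>2"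
    and f_growth: "\<And>s. \<bar>f s\<bar> \<le> C * (1 + \<bar>s\<bar> powr (p - 1))"
    and C: "C > 0"
    and a_nonneg: "\<And>s. s \<ge> 0 \<Longrightarrow> a s \<ge> 0"
    and a_mono: "mono_on {0..} (\<lambda>s. a (s\<^sup>2) * s)"
begin

text \<open>The admissible test functions.\<close>
definition X where "X = H10 \<Omega> \<inter> Lp_space p \<Omega>"
definition Q where "Q w = (Lp_norm p \<Omega> w) powr p"
abbreviation "H \<equiv> H10_norm \<Omega>"
definition vol where "vol = measure lebesgue \<Omega>"

text \<open>The right-hand side of the variational equation for \<open>u\<close> tested with \<open>\<phi>\<close>, without the forcing
  term, which cancels in the difference of two solutions.\<close>
definition R where
  "R u \<phi> = - a ((H u)\<^sup>2) * grad_pairing \<Omega> u \<phi> + pairing \<Omega> (\<lambda>x. f (u x)) \<phi>"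

lemma Q_eq: "Q w = (LINT x|lebesgue_on \<Omega>. \<bar>w x\<bar> powr p)"
  using p by (simp add: Q_def Lp_norm_powr)

lemma Q_nonneg: "Q w \<ge> 0" by (simp add: Q_def)

lemma vol_nonneg: "vol \<ge> 0" by (simp add: vol_def)

lemma \<Omega>_lm: "\<Omega> \<in> lmeasurable" using open_\<Omega> bounded_\<Omega> by (simp add: bounded_set_imp_lmeasurable)

lemma X_D: "u \<in> X \<Longrightarrow> u \<in> W1 \<Omega>" "u \<in> X \<Longrightarrow> u \<in> Lp_space 2 \<Omega>" "u \<in> X \<Longrightarrow> u \<in> H10 \<Omega>" "u \<in> X \<Longrightarrow> u \<in> Lp_space p \<Omega>"
  using H10_subset_W1[of \<Omega>] W1_D(1)[OF open_\<Omega>] by (auto simp: X_def)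

lemma X_diff: "u \<in> X \<Longrightarrow> v \<in> X \<Longrightarrow> (\<lambda>x. u x - v x) \<in> X"
  using H10_diff[OF open_\<Omega>] Lp_space_diff[of p] p by (auto simp: X_def)

lemma f_mult_bound:
  assumes "l > 0"
  shows "\<bar>f z * y\<bar> \<le> C * (l * (1 + \<bar>z\<bar> powr p) + 2 * l powr (1 - p) * \<bar>y\<bar> powr p)"
proof -
  have "\<bar>f z * y\<bar> \<le> C * (1 + \<bar>z\<bar> powr (p - 1)) * \<bar>y\<bar>"
    unfolding abs_mult using f_growth by (intro mult_right_mono) auto
  also have "\<dots> = C * (1 powr (p - 1) * \<bar>y\<bar> + \<bar>z\<bar> powr (p - 1) * \<bar>y\<bar>)" by (simp add: algebra_simps)
  also have "\<dots> \<le> C * ((l * 1 powr p + l powr (1 - p) * \<bar>y\<bar> powr p) + (l * \<bar>z\<bar> powr p + l powr (1 - p) * \<bar>y\<bar> powr p))"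
    using C assms p by (intro mult_left_mono add_mono powr_Young) auto
  finally show ?thesis by (simp add: algebra_simps)
qed

lemma f_mult_integrable:
  assumes "u \<in> Lp_space p \<Omega>" "w \<in> Lp_space p \<Omega>"
  shows "integrable (lebesgue_on \<Omega>) (\<lambda>x. f (u x) * w x)"
    and "l > 0 \<Longrightarrow> \<bar>pairing \<Omega> (\<lambda>x. f (u x)) w\<bar> \<le> C * (l * (vol + Q u) + 2 * l powr (1 - p) * Q w)"
proof -
  interpret finite_measure "lebesgue_on \<Omega>" by (rule finite_measure_lebesgue_on[OF \<Omega>_lm])
  have i: "integrable (lebesgue_on \<Omega>) (\<lambda>x. \<bar>u x\<bar> powr p)" "integrable (lebesgue_on \<Omega>) (\<lambda>x. \<bar>w x\<bar> powr p)"
    using assms by (auto simp: Lp_space_def)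
  have i1: "integrable (lebesgue_on \<Omega>) (\<lambda>x. C * (l * (1 + \<bar>u x\<bar> powr p) + 2 * l powr (1 - p) * \<bar>w x\<bar> powr p))" for l
    using i by simp
  have [measurable]: "u \<in> borel_measurable (lebesgue_on \<Omega>)" "w \<in> borel_measurable (lebesgue_on \<Omega>)" "f \<in> borel_measurable borel"
    using assms f_cont by (auto simp: Lp_space_def intro: borel_measurable_continuous_onI)
  show ii: "integrable (lebesgue_on \<Omega>) (\<lambda>x. f (u x) * w x)"
  proof (rule Bochner_Integration.integrable_bound[OF i1[of 1]])
    show "AE x in lebesgue_on \<Omega>. norm (f (u x) * w x) \<le> norm (C * (1 * (1 + \<bar>u x\<bar> powr p) + 2 * 1 powr (1 - p) * \<bar>w x\<bar> powr p))"
      using f_mult_bound[of 1] by (intro AE_I2) (simp add: order_trans[OF _ abs_ge_self])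
  qed measurable
  assume l: "l > 0"
  have "\<bar>pairing \<Omega> (\<lambda>x. f (u x)) w\<bar> \<le> (LINT x|lebesgue_on \<Omega>. \<bar>f (u x) * w x\<bar>)"
    unfolding pairing_def by (rule integral_abs_bound)
  also have "\<dots> \<le> (LINT x|lebesgue_on \<Omega>. C * (l * (1 + \<bar>u x\<bar> powr p) + 2 * l powr (1 - p) * \<bar>w x\<bar> powr p))"
    using ii i1 f_mult_bound[OF l] by (intro integral_mono) auto
  also have "\<dots> = C * (l * (vol + Q u) + 2 * l powr (1 - p) * Q w)"
    using i \<Omega>_lm by (simp add: Q_eq vol_def measure_restrict_space)
  finally show "\<bar>pairing \<Omega> (\<lambda>x. f (u x)) w\<bar> \<le> C * (l * (vol + Q u) + 2 * l powr (1 - p) * Q w)" .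
qed

lemma R_diff:
  assumes "u \<in> X" "\<phi> \<in> X" "\<psi> \<in> X"
  shows "R u (\<lambda>x. \<phi> x - \<psi> x) = R u \<phi> - R u \<psi>"
proof -
  have "pairing \<Omega> (\<lambda>x. f (u x)) (\<lambda>x. \<phi> x - \<psi> x) = pairing \<Omega> (\<lambda>x. f (u x)) \<phi> - pairing \<Omega> (\<lambda>x. f (u x)) \<psi>"
    unfolding pairing_def right_diff_distrib using assms X_D by (intro Bochner_Integration.integral_diff f_mult_integrable) auto
  then show ?thesis unfolding R_def
    using grad_pairing_diff_right[OF open_\<Omega> X_D(1)[OF assms(2)] X_D(1)[OF assms(3)] X_D(1)[OF assms(1)]]
    by (simp add: right_diff_distrib)
qed

lemma R_bound:
  assumes u: "u \<in> X" and w: "w \<in> X" and A: "a ((H u)\<^sup>2) \<le> A" and l: "l > 0"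
  shows "\<bar>R u w\<bar> \<le> l * (A * (H u)\<^sup>2 + C * (vol + Q u)) + (A / l * (H w)\<^sup>2 + 2 * C * l powr (1 - p) * Q w)"
proof -
  have a0: "a ((H u)\<^sup>2) \<ge> 0" by (rule a_nonneg) simp
  have "\<bar>a ((H u)\<^sup>2) * grad_pairing \<Omega> u w\<bar> \<le> A * (H u * H w)"
    unfolding abs_mult using a0 A grad_pairing_Cauchy_Schwarz[OF open_\<Omega>] X_D(1) u w by (intro mult_mono) auto
  also have "\<dots> \<le> A * (l * (H u)\<^sup>2 + (H w)\<^sup>2 / l)"
  proof (rule mult_left_mono)
    have "0 \<le> (l * H u - H w)\<^sup>2 / l" using l by simp
    also have "\<dots> = l * (H u)\<^sup>2 + (H w)\<^sup>2 / l - 2 * (H u * H w)"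
      using l by (simp add: power2_eq_square field_simps)
    finally show "H u * H w \<le> l * (H u)\<^sup>2 + (H w)\<^sup>2 / l"
      using mult_nonneg_nonneg[OF H10_norm_nonneg[of \<Omega> u] H10_norm_nonneg[of \<Omega> w]] by linarith
  qed (use a0 A in simp)
  finally have "\<bar>a ((H u)\<^sup>2) * grad_pairing \<Omega> u w\<bar> \<le> A * (l * (H u)\<^sup>2 + (H w)\<^sup>2 / l)" .
  moreover have "\<bar>pairing \<Omega> (\<lambda>x. f (u x)) w\<bar> \<le> C * (l * (vol + Q u) + 2 * l powr (1 - p) * Q w)"
    using u w X_D l by (intro f_mult_integrable) auto
  ultimately have "\<bar>R u w\<bar> \<le> A * (l * (H u)\<^sup>2 + (H w)\<^sup>2 / l) + C * (l * (vol + Q u) + 2 * l powr (1 - p) * Q w)"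
    unfolding R_def by linarith
  then show ?thesis by (simp add: algebra_simps)
qed

text \<open>The elliptic part contributes at most zero because of Cauchy-Schwarz and the monotonicity of
  \<open>s \<mapsto> a(s\<^sup>2) s\<close>, the reaction part at most \<open>\<eta> |u - v|\<^sup>2\<close>.\<close>
lemma R_monotone:
  assumes u: "u \<in> X" and v: "v \<in> X"
  shows "R u (\<lambda>x. u x - v x) - R v (\<lambda>x. u x - v x) \<le> \<eta> * (Lp_norm 2 \<Omega> (\<lambda>x. u x - v x))\<^sup>2"
proof -
  define w where "w x = u x - v x" for x
  have w: "w \<in> X" unfolding w_def by (rule X_diff[OF u v])
  note W = X_D(1)[OF u] X_D(1)[OF v]
  define g where "g = grad_pairing \<Omega> u v"
  let ?au = "a ((H u)\<^sup>2)" and ?av = "a ((H v)\<^sup>2)"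
  have a0: "?au \<ge> 0" "?av \<ge> 0" by (auto intro: a_nonneg)
  have h0: "H u \<ge> 0" "H v \<ge> 0" by (rule H10_norm_nonneg)+
  have g1: "grad_pairing \<Omega> u w = (H u)\<^sup>2 - g" "grad_pairing \<Omega> v w = g - (H v)\<^sup>2"
    unfolding w_def g_def using grad_pairing_diff_right[OF open_\<Omega>] W
    by (simp_all add: grad_pairing_self grad_pairing_commute[of \<Omega> v u])
  have "g \<le> H u * H v" using grad_pairing_Cauchy_Schwarz[OF open_\<Omega> W] by (simp add: g_def)
  then have "(?au + ?av) * g \<le> (?au + ?av) * (H u * H v)" using a0 by (intro mult_left_mono) auto
  moreover have "0 \<le> (?au * H u - ?av * H v) * (H u - H v)"
  proof (cases "H u \<le> H v")
    case True
    then have "?au * H u \<le> ?av * H v" using mono_onD[OF a_mono, of "H u" "H v"] h0 by auto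
    then show ?thesis using True by (simp add: mult_nonpos_nonpos)
  next
    case False
    then have "?av * H v \<le> ?au * H u" using mono_onD[OF a_mono, of "H v" "H u"] h0 by auto
    then show ?thesis using False by simp
  qed
  ultimately have ell: "- ?au * grad_pairing \<Omega> u w + ?av * grad_pairing \<Omega> v w \<le> 0"
    unfolding g1 by (simp add: algebra_simps power2_eq_square)
  have fi: "integrable (lebesgue_on \<Omega>) (\<lambda>x. f (u x) * w x)" "integrable (lebesgue_on \<Omega>) (\<lambda>x. f (v x) * w x)"
    using u v w X_D by (auto intro: f_mult_integrable)
  have "pairing \<Omega> (\<lambda>x. f (u x)) w - pairing \<Omega> (\<lambda>x. f (v x)) w = (LINT x|lebesgue_on \<Omega>. (f (u x) - f (v x)) * (u x - v x))"
    using fi by (simp add: pairing_def left_diff_distrib w_def)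
  also have "\<dots> \<le> (LINT x|lebesgue_on \<Omega>. \<eta> * (w x * w x))"
  proof (rule integral_mono)
    show "integrable (lebesgue_on \<Omega>) (\<lambda>x. (f (u x) - f (v x)) * (u x - v x))"
      using Bochner_Integration.integrable_diff[OF fi] by (simp add: left_diff_distrib w_def)
    show "integrable (lebesgue_on \<Omega>) (\<lambda>x. \<eta> * (w x * w x))"
      using L2_mult_integrable[OF X_D(2)[OF w] X_D(2)[OF w]] by simp
    show "(f (u x) - f (v x)) * (u x - v x) \<le> \<eta> * (w x * w x)" for x
      using f_incr[of "u x" "v x"] by (simp add: w_def power2_eq_square)
  qed
  also have "\<dots> = \<eta> * (Lp_norm 2 \<Omega> w)\<^sup>2" by (simp add: L2_norm_sq pairing_def)
  finally show ?thesis using ell unfolding R_def w_def[symmetric, abs_def] by simp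
qed

text \<open>Testing with \<open>\<phi>\<close> instead of \<open>u - v\<close>. The norms of \<open>u\<close> and \<open>v\<close> enter with the factor \<open>l\<close>, which
  will be chosen small; the defect \<open>\<psi>\<close> enters with a large factor, but will be small itself.\<close>
lemma R_gap_le:
  assumes u: "u \<in> X" and v: "v \<in> X" and \<phi>: "\<phi> \<in> X" and A: "a ((H u)\<^sup>2) \<le> A" "a ((H v)\<^sup>2) \<le> A" and l: "l > 0"
    and \<psi>: "\<psi> = (\<lambda>x. \<phi> x - (u x - v x))"
  shows "R u \<phi> - R v \<phi> \<le> \<eta> * (Lp_norm 2 \<Omega> (\<lambda>x. u x - v x))\<^sup>2
     + l * (A * ((H u)\<^sup>2 + (H v)\<^sup>2) + C * (2 * vol + Q u + Q v))
     + 2 * (A / l + 2 * C * l powr (1 - p)) * ((H \<psi>)\<^sup>2 + Q \<psi>)"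
proof -
  have w: "(\<lambda>x. u x - v x) \<in> X" by (rule X_diff[OF u v])
  have \<psi>X: "\<psi> \<in> X" unfolding \<psi> by (rule X_diff[OF \<phi> w])
  have A0: "A \<ge> 0" using A(1) a_nonneg[of "(H u)\<^sup>2"] by simp
  define c where "c = A / l" define c' where "c' = 2 * C * l powr (1 - p)"
  have cc: "c \<ge> 0" "c' \<ge> 0" using A0 l C by (auto simp: c_def c'_def)
  define E where "E = c * (H \<psi>)\<^sup>2 + c' * Q \<psi>"
  define Ku where "Ku = l * (A * (H u)\<^sup>2 + C * (vol + Q u))"
  define Kv where "Kv = l * (A * (H v)\<^sup>2 + C * (vol + Q v))"
  have "R u \<phi> - R v \<phi> = (R u (\<lambda>x. u x - v x) - R v (\<lambda>x. u x - v x)) + (R u \<psi> - R v \<psi>)"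
    unfolding \<psi> R_diff[OF u \<phi> w] R_diff[OF v \<phi> w] by simp
  moreover have "\<bar>R u \<psi>\<bar> \<le> Ku + E" "\<bar>R v \<psi>\<bar> \<le> Kv + E"
    using R_bound[OF u \<psi>X A(1) l] R_bound[OF v \<psi>X A(2) l] unfolding Ku_def Kv_def E_def c_def c'_def by auto
  moreover note R_monotone[OF u v]
  ultimately have "R u \<phi> - R v \<phi> \<le> \<eta> * (Lp_norm 2 \<Omega> (\<lambda>x. u x - v x))\<^sup>2 + Ku + Kv + 2 * E" by linarith
  moreover have "Ku + Kv = l * (A * ((H u)\<^sup>2 + (H v)\<^sup>2) + C * (2 * vol + Q u + Q v))"
    by (simp add: Ku_def Kv_def algebra_simps)
  moreover have "E \<le> (c + c') * ((H \<psi>)\<^sup>2 + Q \<psi>)"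
    using cc Q_nonneg[of \<psi>] by (simp add: E_def algebra_simps)
  ultimately show ?thesis unfolding c_def c'_def by linarith
qed

end

lemma AE_lebesgue_on_iff:
  "S \<in> sets lebesgue \<Longrightarrow> (AE x in lebesgue_on S. P x) \<longleftrightarrow> (AE x in lebesgue. x \<in> S \<longrightarrow> P x)"
  by (simp add: AE_restrict_space_iff)

context nonlocal_problem
begin

lemma seminorm_H: "seminorm_on (H10 \<Omega>) H"
  by (rule seminorm_H10[OF open_\<Omega>])

lemma seminorm_p: "seminorm_on (Lp_space p \<Omega>) (Lp_norm p \<Omega>)"
  using p by (intro seminorm_Lp) simp

lemma seminorm_2: "seminorm_on (Lp_space 2 \<Omega>) (Lp_norm 2 \<Omega>)"
  by (rule seminorm_Lp) simp

text \<open>The size of the defect \<open>\<psi>\<close> of the test function in the preceding estimate.\<close>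
definition cost where "cost w = (H w)\<^sup>2 + Q w"

lemma cost_diff_le:
  assumes "x \<in> X" "y \<in> X"
  shows "cost (\<lambda>t. x t - y t) \<le> 2 powr p * (cost x + cost y)"
proof -
  interpret S: seminorm_on "H10 \<Omega>" H by (rule seminorm_H)
  interpret L: seminorm_on "Lp_space p \<Omega>" "Lp_norm p \<Omega>" by (rule seminorm_p)
  have 4: "2 powr p \<ge> (2::real)" using powr_mono[of 1 p "2::real"] p by simp
  have "(H (\<lambda>t. x t - y t))\<^sup>2 \<le> (H x + H y)\<^sup>2"
    using assms X_D by (intro power_mono S.diff_le S.nonneg) auto
  also have "\<dots> \<le> 2 * ((H x)\<^sup>2 + (H y)\<^sup>2)"
    using sum_squares_bound[of "H x" "H y"] by (simp add: power2_sum)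
  also have "\<dots> \<le> 2 powr p * ((H x)\<^sup>2 + (H y)\<^sup>2)" using 4 by (intro mult_right_mono) auto
  finally have 1: "(H (\<lambda>t. x t - y t))\<^sup>2 \<le> 2 powr p * ((H x)\<^sup>2 + (H y)\<^sup>2)" .
  have "Q (\<lambda>t. x t - y t) \<le> (Lp_norm p \<Omega> x + Lp_norm p \<Omega> y) powr p"
    unfolding Q_def using assms X_D p by (intro powr_mono2 L.diff_le L.nonneg) auto
  also have "\<dots> \<le> 2 powr p * (Q x + Q y)"
    unfolding Q_def using p by (intro powr_add_le L.nonneg) auto
  finally show ?thesis using 1 by (simp add: cost_def algebra_simps)
qed

lemma solution_quasi_continuous:
  assumes u: "u \<in> bochner_Lp 2 {0<..<T} (H10 \<Omega>) H" "u \<in> bochner_Lp p {0<..<T} (Lp_space p \<Omega>) (Lp_norm p \<Omega>)"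
    and e: "e > 0"
  shows "\<exists>b d. almost_modulus {0<..<T} {t\<in>{0<..<T}. u t \<in> X} (\<lambda>t r. cost (\<lambda>x. u t x - u r x)) e b d"
proof -
  have e2: "e / 2 > 0" using e by simp
  have I: "{0<..<T} \<in> sets lebesgue" "bounded {0<..<T}" by auto
  have 2: "(2::real) \<ge> 1" "p \<ge> 1" using p by auto
  obtain b d where "almost_modulus {0<..<T} {t\<in>{0<..<T}. u t \<in> H10 \<Omega>} (\<lambda>t r. H (\<lambda>x. u t x - u r x) powr 2) (e / 2) b d"
    using bochner_Lp_quasi_continuous[OF seminorm_H I 2(1) u(1) e2] by blast
  note b = this[unfolded almost_modulus_def]
  obtain b' d' where "almost_modulus {0<..<T} {t\<in>{0<..<T}. u t \<in> Lp_space p \<Omega>} (\<lambda>t r. Lp_norm p \<Omega> (\<lambda>x. u t x - u r x) powr p) (e / 2) b' d'"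
    using bochner_Lp_quasi_continuous[OF seminorm_p I 2(2) u(2) e2] by blast
  note b' = this[unfolded almost_modulus_def]
  have "almost_modulus {0<..<T} {t\<in>{0<..<T}. u t \<in> X} (\<lambda>t r. cost (\<lambda>x. u t x - u r x)) e (\<lambda>t. b t + b' t) (min d d')"
    unfolding almost_modulus_def
  proof (intro conjI allI ballI impI)
    show "(LINT t|lebesgue_on {0<..<T}. b t + b' t) \<le> e" using b b' by simp
    show "0 \<le> b t + b' t" for t using b b' by (simp add: add_nonneg_nonneg)
    show "integrable (lebesgue_on {0<..<T}) (\<lambda>t. b t + b' t)" using b b' by simp
    show "0 < min d d'" using b b' by simp
    fix t r assume *: "t \<in> {t\<in>{0<..<T}. u t \<in> X}" "r \<in> {t\<in>{0<..<T}. u t \<in> X}" "\<bar>t - r\<bar> < min d d'"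
    have "H (\<lambda>x. u t x - u r x) powr 2 = (H (\<lambda>x. u t x - u r x))\<^sup>2"
      using H10_norm_nonneg[of \<Omega> "\<lambda>x. u t x - u r x"] by (simp add: powr_numeral)
    moreover have "H (\<lambda>x. u t x - u r x) powr 2 \<le> b t + b r + e / 2" using b * X_D by auto
    moreover have "Lp_norm p \<Omega> (\<lambda>x. u t x - u r x) powr p \<le> b' t + b' r + e / 2" using b' * X_D by auto
    ultimately show "cost (\<lambda>x. u t x - u r x) \<le> (b t + b' t) + (b r + b' r) + e"
      unfolding cost_def Q_def by linarith
  qed
  then show ?thesis by blast
qed

end

section \<open>The energy inequality for two solutions\<close>

text \<open>\<open>U\<close> and \<open>V\<close> are the representatives of the solutions that are continuous in \<open>L\<^sup>2\<close>. They carry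
  the initial values, whereas \<open>u\<close> and \<open>v\<close> carry the integrability in \<open>H\<^sub>0\<^sup>1\<close> and \<open>L\<^sup>p\<close>.\<close>
locale two_solutions = nonlocal_problem +
  fixes h u v U V :: "real \<Rightarrow> 'a \<Rightarrow> real"
  assumes wu: "weak_solution \<Omega> p a f h u" and wv: "weak_solution \<Omega> p a f h v"
    and U: "\<And>t. t \<ge> 0 \<Longrightarrow> U t \<in> Lp_space 2 \<Omega>" "\<And>t. t \<ge> 0 \<Longrightarrow> ((\<lambda>s. Lp_norm 2 \<Omega> (\<lambda>x. U s x - U t x)) \<longlongrightarrow> 0) (at t within {0..})"
      "ae_equal_on \<Omega> U u"
    and V: "\<And>t. t \<ge> 0 \<Longrightarrow> V t \<in> Lp_space 2 \<Omega>" "\<And>t. t \<ge> 0 \<Longrightarrow> ((\<lambda>s. Lp_norm 2 \<Omega> (\<lambda>x. V s x - V t x)) \<longlongrightarrow> 0) (at t within {0..})"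
      "ae_equal_on \<Omega> V v"
    and init: "AE x in lebesgue_on \<Omega>. U 0 x = V 0 x"
    and a_bdd_u: "\<And>\<epsilon> T. 0 < \<epsilon> \<Longrightarrow> \<epsilon> < T \<Longrightarrow> \<exists>A. AE t in lebesgue_on {\<epsilon><..<T}. a ((H10_norm \<Omega> (u t))\<^sup>2) \<le> A"
    and a_bdd_v: "\<And>\<epsilon> T. 0 < \<epsilon> \<Longrightarrow> \<epsilon> < T \<Longrightarrow> \<exists>A. AE t in lebesgue_on {\<epsilon><..<T}. a ((H10_norm \<Omega> (v t))\<^sup>2) \<le> A"
begin

definition W where "W t x = U t x - V t x"
definition y where "y t = (Lp_norm 2 \<Omega> (W t))\<^sup>2"
definition regular_time where
  "regular_time t \<longleftrightarrow> u t \<in> X \<and> v t \<in> X \<and>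
     (AE x in lebesgue_on \<Omega>. U t x = u t x) \<and> (AE x in lebesgue_on \<Omega>. V t x = v t x)"

lemma W_L2: "t \<ge> 0 \<Longrightarrow> W t \<in> Lp_space 2 \<Omega>"
  unfolding W_def using Lp_space_diff[of 2, OF _ U(1) V(1)] by simp

lemma W_continuous: assumes t: "t \<ge> 0" shows "((\<lambda>s. Lp_norm 2 \<Omega> (\<lambda>x. W s x - W t x)) \<longlongrightarrow> 0) (at t within {0..})"
proof (rule tendsto_sandwich[OF _ _ tendsto_const])
  interpret L: seminorm_on "Lp_space 2 \<Omega>" "Lp_norm 2 \<Omega>" by (rule seminorm_2)
  show "((\<lambda>s. Lp_norm 2 \<Omega> (\<lambda>x. U s x - U t x) + Lp_norm 2 \<Omega> (\<lambda>x. V s x - V t x)) \<longlongrightarrow> 0) (at t within {0..})"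
    using tendsto_add[OF U(2)[OF t] V(2)[OF t]] by simp
  show "\<forall>\<^sub>F s in at t within {0..}. Lp_norm 2 \<Omega> (\<lambda>x. W s x - W t x) \<le> Lp_norm 2 \<Omega> (\<lambda>x. U s x - U t x) + Lp_norm 2 \<Omega> (\<lambda>x. V s x - V t x)"
    unfolding eventually_at_filter
  proof (intro always_eventually allI impI)
    fix s assume "s \<in> {0::real..}"
    then have "(\<lambda>x. U s x - U t x) \<in> Lp_space 2 \<Omega>" "(\<lambda>x. V s x - V t x) \<in> Lp_space 2 \<Omega>"
      using U(1) V(1) t by (auto intro!: L.diff_mem)
    from L.diff_le[OF this] show "Lp_norm 2 \<Omega> (\<lambda>x. W s x - W t x) \<le> Lp_norm 2 \<Omega> (\<lambda>x. U s x - U t x) + Lp_norm 2 \<Omega> (\<lambda>x. V s x - V t x)"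
      by (simp add: W_def algebra_simps)
  qed
qed (auto simp: Lp_norm_nonneg)

lemma y_continuous: "continuous_on {0..} y"
  unfolding y_def
proof (intro continuous_on_power, unfold continuous_on_def, intro ballI)
  interpret L: seminorm_on "Lp_space 2 \<Omega>" "Lp_norm 2 \<Omega>" by (rule seminorm_2)
  fix t assume t: "t \<in> {0::real..}"
  have "((\<lambda>s. Lp_norm 2 \<Omega> (W s) - Lp_norm 2 \<Omega> (W t)) \<longlongrightarrow> 0) (at t within {0..})"
  proof (rule Lim_null_comparison[OF _ W_continuous])
    show "\<forall>\<^sub>F s in at t within {0..}. norm (Lp_norm 2 \<Omega> (W s) - Lp_norm 2 \<Omega> (W t)) \<le> Lp_norm 2 \<Omega> (\<lambda>x. W s x - W t x)"
      unfolding eventually_at_filter using t W_L2 L.abs_diff_le by (intro always_eventually) auto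
  qed (use t in auto)
  then show "((\<lambda>s. Lp_norm 2 \<Omega> (W s)) \<longlongrightarrow> Lp_norm 2 \<Omega> (W t)) (at t within {0..})" by (simp add: LIM_zero_iff)
qed

lemma pairing_W_continuous:
  assumes "\<phi> \<in> Lp_space 2 \<Omega>" shows "continuous_on {0..} (\<lambda>t. pairing \<Omega> (W t) \<phi>)"
  unfolding continuous_on_def
proof
  fix t assume t: "t \<in> {0::real..}"
  have "((\<lambda>s. pairing \<Omega> (W s) \<phi> - pairing \<Omega> (W t) \<phi>) \<longlongrightarrow> 0) (at t within {0..})"
  proof (rule Lim_null_comparison)
    show "((\<lambda>s. Lp_norm 2 \<Omega> (\<lambda>x. W s x - W t x) * Lp_norm 2 \<Omega> \<phi>) \<longlongrightarrow> 0) (at t within {0..})"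
      using W_continuous[of t] t by (intro tendsto_mult_left_zero) auto
    show "\<forall>\<^sub>F s in at t within {0..}. norm (pairing \<Omega> (W s) \<phi> - pairing \<Omega> (W t) \<phi>) \<le> Lp_norm 2 \<Omega> (\<lambda>x. W s x - W t x) * Lp_norm 2 \<Omega> \<phi>"
      unfolding eventually_at_filter
    proof (intro always_eventually allI impI)
      fix s assume "s \<in> {0::real..}"
      then have s: "W s \<in> Lp_space 2 \<Omega>" "W t \<in> Lp_space 2 \<Omega>" using W_L2 t by auto
      then have "(\<lambda>x. W s x - W t x) \<in> Lp_space 2 \<Omega>" by (intro Lp_space_diff) auto
      from pairing_Cauchy_Schwarz[OF this assms]
      show "norm (pairing \<Omega> (W s) \<phi> - pairing \<Omega> (W t) \<phi>) \<le> Lp_norm 2 \<Omega> (\<lambda>x. W s x - W t x) * Lp_norm 2 \<Omega> \<phi>"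
        by (simp add: pairing_diff_left[OF s assms])
    qed
  qed
  then show "((\<lambda>s. pairing \<Omega> (W s) \<phi>) \<longlongrightarrow> pairing \<Omega> (W t) \<phi>) (at t within {0..})" by (simp add: LIM_zero_iff)
qed

lemma bochner_u: "T > 0 \<Longrightarrow> u \<in> bochner_Lp 2 {0<..<T} (H10 \<Omega>) H" "T > 0 \<Longrightarrow> u \<in> bochner_Lp p {0<..<T} (Lp_space p \<Omega>) (Lp_norm p \<Omega>)"
  and bochner_v: "T > 0 \<Longrightarrow> v \<in> bochner_Lp 2 {0<..<T} (H10 \<Omega>) H" "T > 0 \<Longrightarrow> v \<in> bochner_Lp p {0<..<T} (Lp_space p \<Omega>) (Lp_norm p \<Omega>)"
  using wu wv by (auto simp: weak_solution_def)

lemma AE_bochner: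
  assumes "w \<in> bochner_Lp q I Y N" shows "AE t in lebesgue_on I. w t \<in> Y"
  using assms unfolding bochner_Lp_def strongly_measurable_def by (auto elim: AE_mp)

lemma AE_regular_time_interval:
  assumes "0 \<le> \<epsilon>" "\<epsilon> < T"
  shows "AE t in lebesgue_on {\<epsilon><..<T}. regular_time t"
proof -
  have T: "T > 0" using assms by simp
  have sub: "{\<epsilon><..<T} \<subseteq> {0<..<T}" "{\<epsilon><..<T} \<subseteq> {0<..}" using assms by auto
  note s = AE_lebesgue_on_subset[OF _ sub(1)] AE_lebesgue_on_subset[OF _ sub(2)]
  have "AE t in lebesgue_on {\<epsilon><..<T}. u t \<in> H10 \<Omega>" by (rule s(1)[OF AE_bochner[OF bochner_u(1)[OF T]]]) auto
  moreover have "AE t in lebesgue_on {\<epsilon><..<T}. u t \<in> Lp_space p \<Omega>" by (rule s(1)[OF AE_bochner[OF bochner_u(2)[OF T]]]) auto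
  moreover have "AE t in lebesgue_on {\<epsilon><..<T}. v t \<in> H10 \<Omega>" by (rule s(1)[OF AE_bochner[OF bochner_v(1)[OF T]]]) auto
  moreover have "AE t in lebesgue_on {\<epsilon><..<T}. v t \<in> Lp_space p \<Omega>" by (rule s(1)[OF AE_bochner[OF bochner_v(2)[OF T]]]) auto
  moreover have "AE t in lebesgue_on {\<epsilon><..<T}. AE x in lebesgue_on \<Omega>. U t x = u t x"
    by (rule s(2)[OF U(3)[unfolded ae_equal_on_def]]) auto
  moreover have "AE t in lebesgue_on {\<epsilon><..<T}. AE x in lebesgue_on \<Omega>. V t x = v t x"
    by (rule s(2)[OF V(3)[unfolded ae_equal_on_def]]) auto
  ultimately show ?thesis by eventually_elim (auto simp: X_def regular_time_def)
qed

lemma AE_regular_time: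
  "AE t in lebesgue_on {0<..}. regular_time t"
proof -
  have "AE t in lebesgue. t \<in> {0<..<real (Suc n)} \<longrightarrow> regular_time t" for n
    using AE_regular_time_interval[of 0 "real (Suc n)"] by (subst AE_lebesgue_on_iff[symmetric]) auto
  then have "AE t in lebesgue. \<forall>n. t \<in> {0<..<real (Suc n)} \<longrightarrow> regular_time t"
    by (subst AE_all_countable) blast
  then have "AE t in lebesgue. t \<in> {0<..} \<longrightarrow> regular_time t"
  proof eventually_elim
    case (elim t)
    obtain n where "t < real n" using reals_Archimedean2 by blast
    then have "t < real (Suc n)" by simp
    then show ?case using elim[rule_format, of n] by simp
  qed
  then show ?thesis by (subst AE_restrict_space_iff) auto
qed

text \<open>The pairing of \<open>W\<close> with \<open>\<phi>\<close> is a continuous representative of a function whose distributional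
  derivative is known; the forcing term has dropped out.\<close>
lemma pairing_increment:
  assumes \<phi>: "\<phi> \<in> X" and st: "0 < s" "s < t"
  shows "pairing \<Omega> (W t) \<phi> - pairing \<Omega> (W s) \<phi> = (LINT r|lebesgue_on {s..t}. R (u r) \<phi> - R (v r) \<phi>)"
    and "integrable (lebesgue_on {s..t}) (\<lambda>r. R (u r) \<phi> - R (v r) \<phi>)"
proof -
  have "scalar_distr_deriv (\<lambda>t. pairing \<Omega> (u t) \<phi> - pairing \<Omega> (v t) \<phi>)
    (\<lambda>t. (- a ((H (u t))\<^sup>2) * grad_pairing \<Omega> (u t) \<phi> + pairing \<Omega> (\<lambda>x. f (u t x)) \<phi> + pairing \<Omega> (h t) \<phi>)
      - (- a ((H (v t))\<^sup>2) * grad_pairing \<Omega> (v t) \<phi> + pairing \<Omega> (\<lambda>x. f (v t x)) \<phi> + pairing \<Omega> (h t) \<phi>))"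
    using wu wv \<phi> by (intro scalar_distr_deriv_diff) (auto simp: weak_solution_def X_def)
  then have sd: "scalar_distr_deriv (\<lambda>t. pairing \<Omega> (u t) \<phi> - pairing \<Omega> (v t) \<phi>) (\<lambda>r. R (u r) \<phi> - R (v r) \<phi>)"
    by (simp add: R_def)
  have \<phi>2: "\<phi> \<in> Lp_space 2 \<Omega>" by (rule X_D(2)[OF \<phi>])
  have "AE t in lebesgue_on {0<..}. t > 0" by (rule AE_I2) simp
  with AE_regular_time have ae: "AE t in lebesgue_on {0<..}. pairing \<Omega> (u t) \<phi> - pairing \<Omega> (v t) \<phi> = pairing \<Omega> (W t) \<phi>"
  proof eventually_elim
    case (elim t)
    note elim = elim[unfolded regular_time_def]
    have "pairing \<Omega> (W t) \<phi> = pairing \<Omega> (U t) \<phi> - pairing \<Omega> (V t) \<phi>"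
      unfolding W_def using U(1) V(1) elim \<phi>2 by (intro pairing_diff_left) auto
    moreover have "pairing \<Omega> (U t) \<phi> = pairing \<Omega> (u t) \<phi>" "pairing \<Omega> (V t) \<phi> = pairing \<Omega> (v t) \<phi>"
      using U(1)[of t] V(1)[of t] elim \<phi>2 open_\<Omega> by (auto intro!: pairing_cong_AE)
    ultimately show ?case by simp
  qed
  have "continuous_on {0<..} (\<lambda>t. pairing \<Omega> (W t) \<phi>)"
    by (rule continuous_on_subset[OF pairing_W_continuous[OF \<phi>2]]) auto
  from scalar_distr_deriv_increment[OF sd ae this st]
  show "pairing \<Omega> (W t) \<phi> - pairing \<Omega> (W s) \<phi> = (LINT r|lebesgue_on {s..t}. R (u r) \<phi> - R (v r) \<phi>)"
    "integrable (lebesgue_on {s..t}) (\<lambda>r. R (u r) \<phi> - R (v r) \<phi>)" .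
qed

text \<open>From \<open>0 \<le> |W(t) - W(s)|\<^sup>2\<close>, using the value of \<open>w\<close> at the later time as the test function. The
  discarded square has the sign that an upper bound allows.\<close>
lemma y_increment_le:
  assumes reg: "regular_time t"
    and st: "0 < s" "s < t"
  shows "y t - y s \<le> 2 * (LINT r|lebesgue_on {s..t}. R (u r) (\<lambda>x. u t x - v t x) - R (v r) (\<lambda>x. u t x - v t x))"
proof -
  have t: "u t \<in> X" "v t \<in> X" "AE x in lebesgue_on \<Omega>. U t x = u t x" "AE x in lebesgue_on \<Omega>. V t x = v t x"
    using reg by (auto simp: regular_time_def)
  define \<phi> where "\<phi> x = u t x - v t x" for x
  have \<phi>: "\<phi> \<in> X" unfolding \<phi>_def by (rule X_diff[OF t(1,2)])
  have L: "W t \<in> Lp_space 2 \<Omega>" "W s \<in> Lp_space 2 \<Omega>" "\<phi> \<in> Lp_space 2 \<Omega>" using W_L2 st X_D(2)[OF \<phi>] by auto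
  have W\<phi>: "AE x in lebesgue_on \<Omega>. W t x = \<phi> x" using t(3,4) by eventually_elim (simp add: W_def \<phi>_def)
  have cong: "pairing \<Omega> w (W t) = pairing \<Omega> w \<phi>" if "w \<in> Lp_space 2 \<Omega>" for w
    using that L W\<phi> open_\<Omega> by (intro pairing_cong_AE) auto
  have Ld: "(\<lambda>x. W t x - W s x) \<in> Lp_space 2 \<Omega>" using L by (intro Lp_space_diff) auto
  have "0 \<le> (Lp_norm 2 \<Omega> (\<lambda>x. W t x - W s x))\<^sup>2" by simp
  also have "\<dots> = pairing \<Omega> (W t) (W t) - 2 * pairing \<Omega> (W s) (W t) + pairing \<Omega> (W s) (W s)"
    unfolding L2_norm_sq using L
    by (simp add: pairing_diff_left[OF L(1,2) Ld] pairing_diff_right pairing_commute[of _ "W t" "W s"])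
  finally have "y t - y s \<le> 2 * (pairing \<Omega> (W t) (W t) - pairing \<Omega> (W s) (W t))"
    by (simp add: y_def L2_norm_sq)
  also have "\<dots> = 2 * (pairing \<Omega> (W t) \<phi> - pairing \<Omega> (W s) \<phi>)" using L by (simp add: cong)
  also have "\<dots> = 2 * (LINT r|lebesgue_on {s..t}. R (u r) \<phi> - R (v r) \<phi>)"
    using pairing_increment[OF \<phi> st] by simp
  finally show ?thesis by (simp add: \<phi>_def[abs_def])
qed

lemma bochner_integrable:
  assumes "T > 0"
  shows "integrable (lebesgue_on {0<..<T}) (\<lambda>t. (H (u t))\<^sup>2)" "integrable (lebesgue_on {0<..<T}) (\<lambda>t. (H (v t))\<^sup>2)"
    "integrable (lebesgue_on {0<..<T}) (\<lambda>t. Q (u t))" "integrable (lebesgue_on {0<..<T}) (\<lambda>t. Q (v t))"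
  using bochner_u[OF assms] bochner_v[OF assms] H10_norm_nonneg[of \<Omega>]
  by (simp_all add: bochner_Lp_def Q_def powr_numeral)

text \<open>The defect of the test function \<open>w(t)\<close> at time \<open>r\<close> is controlled by the almost moduli of
  continuity of \<open>u\<close> and \<open>v\<close>. First \<open>l\<close> is chosen small, then \<open>e\<close> small in dependence on the factor
  \<open>D\<close> that \<open>l\<close> produces.\<close>
lemma energy_inequality:
  assumes s: "0 < s" "s < \<tau>"
  shows "y \<tau> - y s \<le> 2 * max \<eta> 0 * (LINT t|lebesgue_on {s..\<tau>}. y t)"
proof (rule field_le_epsilon)
  fix \<epsilon> :: real assume \<epsilon>: "\<epsilon> > 0"
  define T where "T = \<tau> + 1"
  have T: "T > 0" using s by (simp add: T_def)
  \<comment> \<open>All times that occur below are at least \<open>s / 2\<close>, hence in the interior of the interval \<open>?J\<close>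
    on which the coefficients are bounded.\<close>
  let ?I = "{0<..<T}" and ?J = "{s/4<..<T}"
  have sJ: "s / 4 < T" "0 < s / 4" using s by (auto simp: T_def)
  obtain Au where Au: "AE t in lebesgue_on ?J. a ((H (u t))\<^sup>2) \<le> Au" using a_bdd_u[OF sJ(2,1)] by blast
  obtain Av where Av: "AE t in lebesgue_on ?J. a ((H (v t))\<^sup>2) \<le> Av" using a_bdd_v[OF sJ(2,1)] by blast
  define A where "A = max 0 (max Au Av)"
  define good where "good t \<longleftrightarrow> t \<in> ?J \<and> regular_time t
     \<and> a ((H (u t))\<^sup>2) \<le> A \<and> a ((H (v t))\<^sup>2) \<le> A" for t
  have "AE t in lebesgue_on ?J. t \<in> ?J" by (rule AE_I2) simp
  moreover have "0 \<le> s / 4" using s by simp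
  note AE_regular_time_interval[OF this sJ(1)]
  ultimately have "AE t in lebesgue_on ?J. good t" using Au Av
  proof eventually_elim
    case (elim t)
    then show ?case by (auto simp: good_def A_def le_max_iff_disj)
  qed
  then have AEgood: "AE t in lebesgue_on {x..z}. good t" if "s / 2 \<le> x" "z \<le> \<tau>" for x z
    using that s by (elim AE_lebesgue_on_subset) (auto simp: T_def)
  define K where "K r = A * ((H (u r))\<^sup>2 + (H (v r))\<^sup>2) + C * (2 * vol + Q (u r) + Q (v r))" for r
  have A0: "A \<ge> 0" by (simp add: A_def)
  have K0: "K r \<ge> 0" for r
    unfolding K_def using A0 C vol_nonneg Q_nonneg[of "u r"] Q_nonneg[of "v r"] by (intro add_nonneg_nonneg mult_nonneg_nonneg) auto
  interpret fm: finite_measure "lebesgue_on ?I" by (rule finite_measure_lebesgue_on) simp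
  have iK: "integrable (lebesgue_on ?I) K"
    unfolding K_def using bochner_integrable[OF T] by simp
  define K1 where "K1 = (LINT r|lebesgue_on ?I. K r)"
  have K1: "K1 \<ge> 0" unfolding K1_def using K0 by (simp add: integral_nonneg)
  define l where "l = \<epsilon> / (4 * (K1 + 1))"
  have l: "l > 0" "2 * l * K1 \<le> \<epsilon> / 2" using \<epsilon> K1 by (auto simp: l_def field_simps)
  define D where "D = 2 * (A / l + 2 * C * l powr (1 - p)) * 2 powr p"
  have D: "D \<ge> 0" unfolding D_def using A0 l C by simp
  define e where "e = \<epsilon> / (8 * (D + 1) * (\<tau> - s + 2))"
  have e: "e > 0" using \<epsilon> D s by (simp add: e_def)
  have De: "4 * D * e * (\<tau> - s + 2) \<le> \<epsilon> / 2"
  proof -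
    have "8 * (D + 1) * (\<tau> - s + 2) * e = \<epsilon>" using D s by (simp add: e_def)
    moreover have "8 * D * (\<tau> - s + 2) * e \<le> 8 * (D + 1) * (\<tau> - s + 2) * e"
      using D s e by (intro mult_right_mono) auto
    ultimately show ?thesis by (simp add: mult_ac)
  qed
  obtain b1 d1 where bd1: "almost_modulus ?I {t\<in>?I. u t \<in> X} (\<lambda>t r. cost (\<lambda>x. u t x - u r x)) e b1 d1"
    using solution_quasi_continuous[OF bochner_u[OF T] e] by blast
  have b1: "\<And>t. b1 t \<ge> 0" "integrable (lebesgue_on ?I) b1" "(LINT t|lebesgue_on ?I. b1 t) \<le> e" "d1 > 0"
    "\<And>t r. t \<in> ?I \<Longrightarrow> r \<in> ?I \<Longrightarrow> u t \<in> X \<Longrightarrow> u r \<in> X \<Longrightarrow> \<bar>t - r\<bar> < d1 \<Longrightarrow> cost (\<lambda>x. u t x - u r x) \<le> b1 t + b1 r + e"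
    using bd1 unfolding almost_modulus_def by auto
  obtain b2 d2 where bd2: "almost_modulus ?I {t\<in>?I. v t \<in> X} (\<lambda>t r. cost (\<lambda>x. v t x - v r x)) e b2 d2"
    using solution_quasi_continuous[OF bochner_v[OF T] e] by blast
  have b2: "\<And>t. b2 t \<ge> 0" "integrable (lebesgue_on ?I) b2" "(LINT t|lebesgue_on ?I. b2 t) \<le> e" "d2 > 0"
    "\<And>t r. t \<in> ?I \<Longrightarrow> r \<in> ?I \<Longrightarrow> v t \<in> X \<Longrightarrow> v r \<in> X \<Longrightarrow> \<bar>t - r\<bar> < d2 \<Longrightarrow> cost (\<lambda>x. v t x - v r x) \<le> b2 t + b2 r + e"
    using bd2 unfolding almost_modulus_def by auto
  define B where "B t = b1 t + b2 t" for t
  have B: "B t \<ge> 0" "integrable (lebesgue_on ?I) B" "(LINT t|lebesgue_on ?I. B t) \<le> 2 * e" for t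
    unfolding B_def using b1 b2 by auto
  have gap: "R (u r) (\<lambda>x. u t x - v t x) - R (v r) (\<lambda>x. u t x - v t x) \<le> max \<eta> 0 * y r + l * K r + D * (B t + B r + 2 * e)"
    if t: "good t" and r: "good r" and tr: "\<bar>t - r\<bar> < min d1 d2" for t r
  proof -
    have I: "t \<in> ?I" "r \<in> ?I" using t r s by (auto simp: good_def)
    have X: "u t \<in> X" "v t \<in> X" "u r \<in> X" "v r \<in> X" using t r by (auto simp: good_def regular_time_def)
    define \<psi> where "\<psi> x = (u t x - v t x) - (u r x - v r x)" for x
    have \<psi>': "\<psi> = (\<lambda>x. (u t x - u r x) - (v t x - v r x))" by (auto simp: \<psi>_def)
    have "cost \<psi> \<le> 2 powr p * (cost (\<lambda>x. u t x - u r x) + cost (\<lambda>x. v t x - v r x))"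
      unfolding \<psi>' by (intro cost_diff_le X_diff X)
    also have "\<dots> \<le> 2 powr p * (B t + B r + 2 * e)"
      using b1(5)[OF I X(1,3)] b2(5)[OF I X(2,4)] tr by (intro mult_left_mono) (auto simp: B_def)
    finally have c\<psi>: "cost \<psi> \<le> 2 powr p * (B t + B r + 2 * e)" .
    have yr: "y r = (Lp_norm 2 \<Omega> (\<lambda>x. u r x - v r x))\<^sup>2"
    proof -
      have "AE x in lebesgue_on \<Omega>. U r x = u r x" "AE x in lebesgue_on \<Omega>. V r x = v r x" using r by (auto simp: good_def regular_time_def)
      then have "AE x in lebesgue_on \<Omega>. W r x = u r x - v r x" by eventually_elim (simp add: W_def)
      then show ?thesis unfolding y_def using W_L2[of r] I open_\<Omega> by (subst Lp_norm_cong_AE[of \<Omega> "W r"]) auto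
    qed
    have "R (u r) (\<lambda>x. u t x - v t x) - R (v r) (\<lambda>x. u t x - v t x) \<le> \<eta> * (Lp_norm 2 \<Omega> (\<lambda>x. u r x - v r x))\<^sup>2
       + l * K r + 2 * (A / l + 2 * C * l powr (1 - p)) * cost \<psi>"
      unfolding K_def cost_def using r l
      by (intro R_gap_le X X_diff) (auto simp: good_def \<psi>_def)
    also have "2 * (A / l + 2 * C * l powr (1 - p)) * cost \<psi> \<le> 2 * (A / l + 2 * C * l powr (1 - p)) * (2 powr p * (B t + B r + 2 * e))"
      using A0 l C by (intro mult_left_mono c\<psi>) auto
    also have "\<dots> = D * (B t + B r + 2 * e)" by (simp add: D_def)
    also have "\<eta> * (Lp_norm 2 \<Omega> (\<lambda>x. u r x - v r x))\<^sup>2 \<le> max \<eta> 0 * y r" unfolding yr by (intro mult_right_mono) auto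
    finally show ?thesis by simp
  qed
  define k where "k r = 2 * (max \<eta> 0 * y r + l * K r + D * (B r + 2 * e))" for r
  have yI: "continuous_on {x..z} y" if "0 \<le> x" for x z
    using y_continuous that by (auto elim!: continuous_on_subset)
  have sub: "{x..z} \<subseteq> ?I" if "s / 2 \<le> x" "z \<le> \<tau>" for x z using that s by (auto simp: T_def)
  have iI: "integrable (lebesgue_on {x..z}) g" if "s / 2 \<le> x" "z \<le> \<tau>" "integrable (lebesgue_on ?I) g" for x z and g :: "real \<Rightarrow> real"
    using sub[OF that(1,2)] by (intro lebesgue_on_integrable_subset[OF that(3)]) auto
  have iy: "integrable (lebesgue_on {x..z}) y" if "0 \<le> x" for x z
    by (intro continuous_imp_integrable_real yI that)
  have ic: "integrable (lebesgue_on {x..z}) (\<lambda>_. c)" for x z c :: real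
    by (intro continuous_imp_integrable_real continuous_intros)
  have ik: "integrable (lebesgue_on {x..z}) k" if "s / 2 \<le> x" "z \<le> \<tau>" for x z
    unfolding k_def using that s by (intro integrable_mult_right Bochner_Integration.integrable_add iI[OF _ _ iK] iI[OF _ _ B(2)] iy ic) auto
  have "y \<tau> - y s \<le> (LINT t|lebesgue_on {s..\<tau>}. k t) + (LINT t|lebesgue_on {s..\<tau>}. 2 * D * B t)"
  proof (rule increment_le_integral[where \<alpha>="s/2" and d="min d1 d2"])
    show "continuous_on {s/2..\<tau>} y" using s by (intro yI) auto
    show "integrable (lebesgue_on {s/2..\<tau>}) k" by (intro ik) auto
    show "integrable (lebesgue_on {s..\<tau>}) (\<lambda>t. 2 * D * B t)" using s by (intro integrable_mult_right iI B) auto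
    fix \<delta> assume \<delta>: "0 < \<delta>" "\<delta> < min d1 d2" "\<delta> \<le> s - s / 2"
    have "AE t in lebesgue_on {s..\<tau>}. t \<in> {s..\<tau>}" by (rule AE_I2) simp
    moreover have "AE t in lebesgue_on {s..\<tau>}. good t" using s by (intro AEgood) auto
    ultimately show "AE t in lebesgue_on {s..\<tau>}. y t - y (t - \<delta>) \<le> (LINT r|lebesgue_on {t - \<delta>..t}. k r) + \<delta> * (2 * D * B t)"
    proof eventually_elim
      case (elim t)
      define \<phi> where "\<phi> x = u t x - v t x" for x
      have reg: "regular_time t" and t: "u t \<in> X" "v t \<in> X"
        using elim by (auto simp: good_def regular_time_def)
      have td: "0 < t - \<delta>" "t - \<delta> < t" "s / 2 \<le> t - \<delta>" "t \<le> \<tau>" using elim \<delta> s by auto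
      have "y t - y (t - \<delta>) \<le> 2 * (LINT r|lebesgue_on {t - \<delta>..t}. R (u r) \<phi> - R (v r) \<phi>)"
        using y_increment_le[OF reg td(1,2)] by (simp add: \<phi>_def[abs_def])
      also have "\<dots> = (LINT r|lebesgue_on {t - \<delta>..t}. 2 * (R (u r) \<phi> - R (v r) \<phi>))"
        by (simp only: integral_mult_right_zero)
      also have "\<dots> \<le> (LINT r|lebesgue_on {t - \<delta>..t}. k r + 2 * D * B t)"
      proof (rule integral_mono_AE)
        have "\<phi> \<in> X" unfolding \<phi>_def by (rule X_diff[OF t(1,2)])
        from pairing_increment(2)[OF this td(1,2)]
        show "integrable (lebesgue_on {t - \<delta>..t}) (\<lambda>r. 2 * (R (u r) \<phi> - R (v r) \<phi>))"
          by (rule integrable_mult_right)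
        show "integrable (lebesgue_on {t - \<delta>..t}) (\<lambda>r. k r + 2 * D * B t)"
          using td by (intro Bochner_Integration.integrable_add ik ic)
        have "AE r in lebesgue_on {t - \<delta>..t}. r \<in> {t - \<delta>..t}" by (rule AE_I2) simp
        moreover have "AE r in lebesgue_on {t - \<delta>..t}. good r" using td by (intro AEgood)
        ultimately show "AE r in lebesgue_on {t - \<delta>..t}. 2 * (R (u r) \<phi> - R (v r) \<phi>) \<le> k r + 2 * D * B t"
        proof eventually_elim
          case (elim r)
          have "\<bar>t - r\<bar> < min d1 d2" using elim \<delta> by auto
          from gap[OF \<open>good t\<close> \<open>good r\<close> this] show ?case
            by (simp add: k_def \<phi>_def[abs_def] algebra_simps)
        qed
      qed
      also have "\<dots> = (LINT r|lebesgue_on {t - \<delta>..t}. k r) + \<delta> * (2 * D * B t)"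
        using ik[OF td(3,4)] ic[of "t - \<delta>" t "2 * D * B t"] \<delta> by (simp add: measure_restrict_space)
      finally show ?case .
    qed
  qed (use s b1 b2 in auto)
  also have "(LINT t|lebesgue_on {s..\<tau>}. k t) = 2 * (max \<eta> 0 * (LINT t|lebesgue_on {s..\<tau>}. y t) + l * (LINT t|lebesgue_on {s..\<tau>}. K t)
      + D * ((LINT t|lebesgue_on {s..\<tau>}. B t) + 2 * e * (\<tau> - s)))"
    unfolding k_def using s iI[OF _ _ iK, of s \<tau>] iI[OF _ _ B(2), of s \<tau>] iy[of s \<tau>] ic[of s \<tau> "2 * e"]
    by (simp add: measure_restrict_space)
  also have "(LINT t|lebesgue_on {s..\<tau>}. 2 * D * B t) = 2 * D * (LINT t|lebesgue_on {s..\<tau>}. B t)" by simp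
  finally have fin: "y \<tau> - y s \<le> 2 * max \<eta> 0 * (LINT t|lebesgue_on {s..\<tau>}. y t) + 2 * l * (LINT t|lebesgue_on {s..\<tau>}. K t)
      + 4 * D * (LINT t|lebesgue_on {s..\<tau>}. B t) + 4 * D * e * (\<tau> - s)"
    by (simp add: algebra_simps)
  have "(LINT t|lebesgue_on {s..\<tau>}. K t) \<le> K1" unfolding K1_def
    using sub[of s \<tau>] s K0 by (intro integral_mono_lebesgue_on_AE[OF iK]) auto
  then have 1: "2 * l * (LINT t|lebesgue_on {s..\<tau>}. K t) \<le> 2 * l * K1" using l by (intro mult_left_mono) auto
  have "(LINT t|lebesgue_on {s..\<tau>}. B t) \<le> (LINT t|lebesgue_on ?I. B t)"
    using sub[of s \<tau>] s B(1) by (intro integral_mono_lebesgue_on_AE[OF B(2)]) auto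
  then have "4 * D * (LINT t|lebesgue_on {s..\<tau>}. B t) \<le> 4 * D * (2 * e)" using B(3) D by (intro mult_left_mono) auto
  then have "4 * D * (LINT t|lebesgue_on {s..\<tau>}. B t) + 4 * D * e * (\<tau> - s) \<le> 4 * D * e * (\<tau> - s + 2)"
    by (simp add: algebra_simps)
  then show "y \<tau> - y s \<le> 2 * max \<eta> 0 * (LINT t|lebesgue_on {s..\<tau>}. y t) + \<epsilon>"
    using fin 1 l(2) De by linarith
qed

lemma solutions_equal: "ae_equal_on \<Omega> u v"
proof -
  have y0: "y t = 0" if t: "t \<ge> 0" for t
  proof (rule Gronwall_zero[OF y_continuous _ _ _ _ t])
    have "AE x in lebesgue_on \<Omega>. W 0 x = 0" using init by eventually_elim (simp add: W_def)
    then have "Lp_norm 2 \<Omega> (W 0) = Lp_norm 2 \<Omega> (\<lambda>x. 0)" using W_L2[of 0] open_\<Omega> by (intro Lp_norm_cong_AE) auto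
    then show "y 0 = 0" by (simp add: y_def Lp_norm_def)
    show "y t \<ge> 0" for t by (simp add: y_def)
    show "2 * max \<eta> 0 \<ge> 0" by simp
  qed (rule energy_inequality)
  have eq: "AE x in lebesgue_on \<Omega>. U t x = V t x" if t: "t \<ge> 0" for t
  proof -
    have i: "integrable (lebesgue_on \<Omega>) (\<lambda>x. W t x * W t x)" using W_L2[OF t] W_L2[OF t] by (rule L2_mult_integrable)
    have "(LINT x|lebesgue_on \<Omega>. W t x * W t x) = 0" using y0[OF t] unfolding y_def L2_norm_sq pairing_def .
    then have "AE x in lebesgue_on \<Omega>. W t x * W t x = 0"
      using integral_nonneg_eq_0_iff_AE[OF i] by simp
    then show ?thesis by eventually_elim (simp add: W_def)
  qed
  have "AE t in lebesgue_on {0<..}. t > 0" by (rule AE_I2) simp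
  with AE_regular_time show ?thesis unfolding ae_equal_on_def
  proof eventually_elim
    case (elim t)
    have "AE x in lebesgue_on \<Omega>. U t x = V t x" using elim by (intro eq) auto
    moreover have "AE x in lebesgue_on \<Omega>. U t x = u t x" "AE x in lebesgue_on \<Omega>. V t x = v t x" using elim by (auto simp: regular_time_def)
    ultimately show ?case by eventually_elim simp
  qed
qed

end

section \<open>Uniqueness\<close>

text \<open>The two-sided bound on \<open>f(s) s\<close> may be divided by \<open>|s|\<close> where \<open>|s| > 1\<close>; on the remaining
  compact interval \<open>f\<close> is bounded.\<close>
lemma f_growth_of_dissipativity:
  fixes f :: "real \<Rightarrow> real"
  assumes f: "continuous_on UNIV f" and "\<kappa> \<ge> 0" "\<alpha>\<^sub>1 > 0" "\<alpha>\<^sub>2 > 0"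
    and lo: "\<And>s. - \<kappa> - \<alpha>\<^sub>2 * \<bar>s\<bar> powr p \<le> f s * s" and up: "\<And>s. f s * s \<le> \<kappa> - \<alpha>\<^sub>1 * \<bar>s\<bar> powr p"
  shows "\<exists>C>0. \<forall>s. \<bar>f s\<bar> \<le> C * (1 + \<bar>s\<bar> powr (p - 1))"
proof -
  have "bounded (f ` {-1..1})"
    using f by (intro compact_imp_bounded compact_continuous_image) (auto elim: continuous_on_subset)
  then obtain F where F: "F > 0" "\<And>s. s \<in> {-1..1} \<Longrightarrow> \<bar>f s\<bar> \<le> F" unfolding bounded_pos by auto
  have "\<bar>f s\<bar> \<le> (F + \<kappa> + \<alpha>\<^sub>2) * (1 + \<bar>s\<bar> powr (p - 1))" for s
  proof (cases "\<bar>s\<bar> \<le> 1")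
    case True
    then have "s \<in> {-1..1}" by auto
    then have "\<bar>f s\<bar> \<le> F * 1" using F(2) by simp
    also have "\<dots> \<le> (F + \<kappa> + \<alpha>\<^sub>2) * (1 + \<bar>s\<bar> powr (p - 1))"
      using F assms by (intro mult_mono) auto
    finally show ?thesis .
  next
    case False
    then have s: "\<bar>s\<bar> > 1" by simp
    have "f s * s \<le> \<kappa>" using up[of s] assms by (smt (verit) mult_nonneg_nonneg powr_ge_zero)
    moreover have "\<alpha>\<^sub>2 * \<bar>s\<bar> powr p \<ge> 0" using assms by simp
    ultimately have "\<bar>f s * s\<bar> \<le> \<kappa> + \<alpha>\<^sub>2 * \<bar>s\<bar> powr p" using lo[of s] by linarith
    then have "\<bar>f s\<bar> \<le> (\<kappa> + \<alpha>\<^sub>2 * \<bar>s\<bar> powr p) / \<bar>s\<bar>" using s by (simp add: pos_le_divide_eq abs_mult)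
    also have "\<dots> = \<kappa> / \<bar>s\<bar> + \<alpha>\<^sub>2 * \<bar>s\<bar> powr (p - 1)" using s by (simp add: add_divide_distrib powr_diff)
    also have "\<dots> \<le> \<kappa> + \<alpha>\<^sub>2 * \<bar>s\<bar> powr (p - 1)" using s assms by (simp add: divide_le_eq mult_le_cancel_left1)
    also have "\<dots> \<le> (F + \<kappa> + \<alpha>\<^sub>2) * (1 + \<bar>s\<bar> powr (p - 1))"
      using F assms by (simp add: algebra_simps)
    finally show ?thesis .
  qed
  moreover have "F + \<kappa> + \<alpha>\<^sub>2 > 0" using F assms by simp
  ultimately show ?thesis by blast
qed

lemma one_sided_Lipschitz_of_deriv_le:
  fixes f :: "real \<Rightarrow> real"
  assumes d: "\<And>x. (f has_real_derivative deriv f x) (at x)" and le: "\<And>s. deriv f s \<le> \<eta>"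
  shows "(f x - f y) * (x - y) \<le> \<eta> * (x - y)\<^sup>2"
proof -
  have *: "(f x - f y) * (x - y) \<le> \<eta> * (x - y)\<^sup>2" if yx: "y < x" for x y
  proof -
    obtain z where "f x - f y = (x - y) * deriv f z" using MVT2[OF yx, of f "deriv f"] d by blast
    then have "(f x - f y) * (x - y) = deriv f z * (x - y)\<^sup>2" by (simp add: power2_eq_square)
    also have "\<dots> \<le> \<eta> * (x - y)\<^sup>2" using le by (intro mult_right_mono) auto
    finally show ?thesis .
  qed
  consider "x = y" | "y < x" | "x < y" by linarith
  then show ?thesis
  proof cases
    case 3
    then show ?thesis using *[of x y] by (simp add: algebra_simps power2_commute)
  qed (use * in auto)
qed

text \<open>An essential bound on the norm confines the argument of \<open>a\<close> to a compact interval.\<close>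
lemma AE_coefficient_bounded:
  assumes a: "continuous_on {0..} a" and c: "AE t in M. 0 \<le> n t \<and> n t \<le> (c::real)"
  shows "\<exists>A. AE t in M. a ((n t)\<^sup>2) \<le> (A::real)"
proof -
  have "bounded (a ` {0..c\<^sup>2})"
    using a by (intro compact_imp_bounded compact_continuous_image) (auto elim: continuous_on_subset)
  then obtain A where A: "\<forall>s\<in>{0..c\<^sup>2}. \<bar>a s\<bar> \<le> A" unfolding bounded_iff by auto
  have "AE t in M. a ((n t)\<^sup>2) \<le> A" using c
  proof eventually_elim
    case (elim t)
    then have "(n t)\<^sup>2 \<in> {0..c\<^sup>2}" by (auto intro: power_mono)
    with A show ?case by (meson abs_ge_self order_trans)
  qed
  then show ?thesis by blast
qed

lemma has_initial_value_H10_imp_L2: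
  fixes \<Omega> :: "'a::euclidean_space set"
  assumes \<Omega>: "open \<Omega>" "bounded \<Omega>" and iv: "has_initial_value \<Omega> (H10 \<Omega>) (H10_norm \<Omega>) u u\<^sub>0"
  shows "has_initial_value \<Omega> (Lp_space 2 \<Omega>) (Lp_norm 2 \<Omega>) u u\<^sub>0"
proof -
  obtain U where U: "\<And>t. t \<ge> 0 \<Longrightarrow> U t \<in> H10 \<Omega>"
    "\<And>t. t \<ge> 0 \<Longrightarrow> ((\<lambda>s. H10_norm \<Omega> (\<lambda>x. U s x - U t x)) \<longlongrightarrow> 0) (at t within {0..})"
    "ae_equal_on \<Omega> U u" "AE x in lebesgue_on \<Omega>. U 0 x = u\<^sub>0 x"
    using iv unfolding has_initial_value_def by blast
  obtain R where R: "R > 0" "\<And>x. x \<in> \<Omega> \<Longrightarrow> norm x \<le> R" using \<Omega>(2) unfolding bounded_pos by blast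
  have "((\<lambda>s. Lp_norm 2 \<Omega> (\<lambda>x. U s x - U t x)) \<longlongrightarrow> 0) (at t within {0..})" if t: "t \<ge> 0" for t
  proof (rule tendsto_sandwich[OF _ _ tendsto_const])
    show "((\<lambda>s. 2 * R * H10_norm \<Omega> (\<lambda>x. U s x - U t x)) \<longlongrightarrow> 0) (at t within {0..})"
      using tendsto_mult_left[OF U(2)[OF t], of "2 * R"] by simp
    show "\<forall>\<^sub>F s in at t within {0..}. Lp_norm 2 \<Omega> (\<lambda>x. U s x - U t x) \<le> 2 * R * H10_norm \<Omega> (\<lambda>x. U s x - U t x)"
      unfolding eventually_at_filter
    proof (intro always_eventually allI impI)
      fix s assume "s \<in> {0::real..}"
      then have "(\<lambda>x. U s x - U t x) \<in> H10 \<Omega>" using U(1) t by (intro H10_diff[OF \<Omega>(1)]) auto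
      from Poincare[OF \<Omega>(1) this R(2)] show "Lp_norm 2 \<Omega> (\<lambda>x. U s x - U t x) \<le> 2 * R * H10_norm \<Omega> (\<lambda>x. U s x - U t x)"
        using R(1) by simp
    qed
  qed (auto simp: Lp_norm_nonneg)
  moreover have "U t \<in> Lp_space 2 \<Omega>" if "t \<ge> 0" for t
    using U(1)[OF that] H10_subset_W1 W1_D(1)[OF \<Omega>(1)] by blast
  ultimately show ?thesis using U(3,4) unfolding has_initial_value_def by blast
qed

lemma (in nonlocal_problem) weak_solutions_unique:
  assumes sol: "weak_solution \<Omega> p a f h u" "weak_solution \<Omega> p a f h v"
    and iv: "has_initial_value \<Omega> (Lp_space 2 \<Omega>) (Lp_norm 2 \<Omega>) u u\<^sub>0"
      "has_initial_value \<Omega> (Lp_space 2 \<Omega>) (Lp_norm 2 \<Omega>) v u\<^sub>0"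
    and bd: "\<And>\<epsilon> T. 0 < \<epsilon> \<Longrightarrow> \<epsilon> < T \<Longrightarrow> \<exists>A. AE t in lebesgue_on {\<epsilon><..<T}. a ((H10_norm \<Omega> (u t))\<^sup>2) \<le> A"
      "\<And>\<epsilon> T. 0 < \<epsilon> \<Longrightarrow> \<epsilon> < T \<Longrightarrow> \<exists>A. AE t in lebesgue_on {\<epsilon><..<T}. a ((H10_norm \<Omega> (v t))\<^sup>2) \<le> A"
  shows "ae_equal_on \<Omega> u v"
proof -
  obtain U where U: "\<And>t. t \<ge> 0 \<Longrightarrow> U t \<in> Lp_space 2 \<Omega>"
    "\<And>t. t \<ge> 0 \<Longrightarrow> ((\<lambda>s. Lp_norm 2 \<Omega> (\<lambda>x. U s x - U t x)) \<longlongrightarrow> 0) (at t within {0..})"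
    "ae_equal_on \<Omega> U u" "AE x in lebesgue_on \<Omega>. U 0 x = u\<^sub>0 x"
    using iv(1) unfolding has_initial_value_def by blast
  obtain V where V: "\<And>t. t \<ge> 0 \<Longrightarrow> V t \<in> Lp_space 2 \<Omega>"
    "\<And>t. t \<ge> 0 \<Longrightarrow> ((\<lambda>s. Lp_norm 2 \<Omega> (\<lambda>x. V s x - V t x)) \<longlongrightarrow> 0) (at t within {0..})"
    "ae_equal_on \<Omega> V v" "AE x in lebesgue_on \<Omega>. V 0 x = u\<^sub>0 x"
    using iv(2) unfolding has_initial_value_def by blast
  have "AE x in lebesgue_on \<Omega>. U 0 x = V 0 x" using U(4) V(4) by eventually_elim simp
  then interpret two_solutions \<Omega> f a p \<eta> C h u v U V
    using sol U V bd by unfold_locales auto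
  show ?thesis by (rule solutions_equal)
qed

lemma bochner_Linf_norm_AE:
  assumes "u \<in> bochner_Linf I X N"
  obtains c where "AE t in lebesgue_on I. N (u t) \<le> c"
  using assms unfolding bochner_Linf_def by blast

theorem theorem13:
  fixes \<Omega> :: "(real ^ 'n) set"
    and f a :: "real \<Rightarrow> real"
    and h :: "real \<Rightarrow> real ^ 'n \<Rightarrow> real"
    and \<eta> m \<kappa> \<alpha>\<^sub>1 \<alpha>\<^sub>2 p :: real
  assumes "open \<Omega>" and "bounded \<Omega>" and "smooth_boundary \<Omega>"
    and "f C1_differentiable_on UNIV" and "\<And>s. deriv f s \<le> \<eta>"
    and "\<And>T. T > 0 \<Longrightarrow> h \<in> bochner_Lp 2 {0<..<T} (Lp_space 2 \<Omega>) (Lp_norm 2 \<Omega>)"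
    and "continuous_on {0..} a" and "m > 0" and "\<And>s. s \<ge> 0 \<Longrightarrow> a s \<ge> m"
    and "\<alpha>\<^sub>1 > 0" and "\<alpha>\<^sub>2 > 0" and "\<kappa> \<ge> 0" and "p \<ge> 2"
    and "\<And>s. - \<kappa> - \<alpha>\<^sub>2 * \<bar>s\<bar> powr p \<le> f s * s"
    and "\<And>s. f s * s \<le> \<kappa> - \<alpha>\<^sub>1 * \<bar>s\<bar> powr p"
    and "mono_on {0..} (\<lambda>s. a (s\<^sup>2) * s)"
  shows
    "((\<exists>M\<^sub>1\<ge>0. \<exists>M\<^sub>2\<ge>0. \<forall>s\<ge>0. a s \<le> M\<^sub>1 + M\<^sub>2 * s) \<longrightarrow>
        (\<forall>u\<^sub>0 \<in> Lp_space 2 \<Omega>. \<forall>u v.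
           regular_solution \<Omega> p a f h u \<and> has_initial_value \<Omega> (Lp_space 2 \<Omega>) (Lp_norm 2 \<Omega>) u u\<^sub>0 \<and>
           regular_solution \<Omega> p a f h v \<and> has_initial_value \<Omega> (Lp_space 2 \<Omega>) (Lp_norm 2 \<Omega>) v u\<^sub>0 \<longrightarrow>
           ae_equal_on \<Omega> u v)) \<and>
     ((\<exists>M\<^sub>1\<ge>0. \<forall>s\<ge>0. a s \<le> M\<^sub>1) \<longrightarrow>
        (\<forall>u\<^sub>0 \<in> Lp_space 2 \<Omega>. \<forall>u v.
           weak_solution \<Omega> p a f h u \<and> has_initial_value \<Omega> (Lp_space 2 \<Omega>) (Lp_norm 2 \<Omega>) u u\<^sub>0 \<and>
           weak_solution \<Omega> p a f h v \<and> has_initial_value \<Omega> (Lp_space 2 \<Omega>) (Lp_norm 2 \<Omega>) v u\<^sub>0 \<longrightarrow>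
           ae_equal_on \<Omega> u v)) \<and>
     (\<forall>u\<^sub>0 \<in> H10 \<Omega> \<inter> Lp_space p \<Omega>. \<forall>u v.
           strong_solution \<Omega> p a f h u \<and> has_initial_value \<Omega> (H10 \<Omega>) (H10_norm \<Omega>) u u\<^sub>0 \<and>
           strong_solution \<Omega> p a f h v \<and> has_initial_value \<Omega> (H10 \<Omega>) (H10_norm \<Omega>) v u\<^sub>0 \<longrightarrow>
           ae_equal_on \<Omega> u v)"
proof -
  have fd: "(f has_real_derivative deriv f x) (at x)" for x
    using \<open>f C1_differentiable_on UNIV\<close> unfolding C1_differentiable_on_eq
    by (auto simp: DERIV_deriv_iff_real_differentiable)
  have fc: "continuous_on UNIV f" using fd by (auto intro!: continuous_at_imp_continuous_on DERIV_isCont)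
  obtain C where C: "C > 0" "\<And>s. \<bar>f s\<bar> \<le> C * (1 + \<bar>s\<bar> powr (p - 1))"
    using f_growth_of_dissipativity[OF fc \<open>\<kappa> \<ge> 0\<close> \<open>\<alpha>\<^sub>1 > 0\<close> \<open>\<alpha>\<^sub>2 > 0\<close> assms(14,15)] by blast
  have a0: "a s \<ge> 0" if "s \<ge> 0" for s using assms(9)[OF that] \<open>m > 0\<close> by simp
  interpret nonlocal_problem \<Omega> f a p \<eta> C
    using assms(1,2,13,16) fc C a0 one_sided_Lipschitz_of_deriv_le[OF fd assms(5)] by unfold_locales auto
  have bd: "\<exists>A. AE t in lebesgue_on I. a ((H10_norm \<Omega> (u t))\<^sup>2) \<le> A"
    if "AE t in lebesgue_on I. H10_norm \<Omega> (u t) \<le> c" for I u c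
    using that by (intro AE_coefficient_bounded[OF assms(7), where c=c]) (auto simp: H10_norm_nonneg)
  have reg: "\<exists>A. AE t in lebesgue_on {\<epsilon><..<T}. a ((H10_norm \<Omega> (u t))\<^sup>2) \<le> A"
    if "regular_solution \<Omega> p a f h u" "0 < \<epsilon>" "\<epsilon> < T" for u \<epsilon> T
  proof -
    have "u \<in> bochner_Linf {\<epsilon><..<T} (H10 \<Omega>) (H10_norm \<Omega>)" using that by (auto simp: regular_solution_def)
    then show ?thesis by (rule bochner_Linf_norm_AE) (rule bd)
  qed
  have str: "\<exists>A. AE t in lebesgue_on {\<epsilon><..<T}. a ((H10_norm \<Omega> (u t))\<^sup>2) \<le> A"
    if "strong_solution \<Omega> p a f h u" "0 < \<epsilon>" "\<epsilon> < T" for u \<epsilon> T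
  proof -
    have "T > 0" using that by simp
    then have "u \<in> bochner_Linf {0<..<T} (H10 \<Omega> \<inter> Lp_space p \<Omega>) (\<lambda>w. H10_norm \<Omega> w + Lp_norm p \<Omega> w)"
      using that(1) by (auto simp: strong_solution_def)
    then obtain c where "AE t in lebesgue_on {0<..<T}. H10_norm \<Omega> (u t) + Lp_norm p \<Omega> (u t) \<le> c"
      by (rule bochner_Linf_norm_AE)
    then have "AE t in lebesgue_on {0<..<T}. H10_norm \<Omega> (u t) \<le> c"
    proof eventually_elim
      case (elim t)
      then show ?case using Lp_norm_nonneg[of p \<Omega> "u t"] by linarith
    qed
    then have "AE t in lebesgue_on {\<epsilon><..<T}. H10_norm \<Omega> (u t) \<le> c"
      using that by (elim AE_lebesgue_on_subset) auto
    then show ?thesis by (rule bd)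
  qed
  show ?thesis
  proof (intro conjI impI ballI allI; (elim conjE)?)
    fix u\<^sub>0 u v
    assume "regular_solution \<Omega> p a f h u" "has_initial_value \<Omega> (Lp_space 2 \<Omega>) (Lp_norm 2 \<Omega>) u u\<^sub>0"
      "regular_solution \<Omega> p a f h v" "has_initial_value \<Omega> (Lp_space 2 \<Omega>) (Lp_norm 2 \<Omega>) v u\<^sub>0"
    then show "ae_equal_on \<Omega> u v"
      by (intro weak_solutions_unique[of h u v u\<^sub>0] reg) (auto simp: regular_solution_def)
  next
    fix u\<^sub>0 u v
    assume "\<exists>M\<^sub>1\<ge>0. \<forall>s\<ge>0. a s \<le> M\<^sub>1"
    then obtain M where M: "\<And>s. s \<ge> 0 \<Longrightarrow> a s \<le> M" by blast
    have b: "\<exists>A. AE t in lebesgue_on {\<epsilon><..<T}. a ((H10_norm \<Omega> (w t))\<^sup>2) \<le> A" for w :: "real \<Rightarrow> real ^ 'n \<Rightarrow> real" and \<epsilon> T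
      using M by (intro exI[of _ M] AE_I2) auto
    assume "weak_solution \<Omega> p a f h u" "has_initial_value \<Omega> (Lp_space 2 \<Omega>) (Lp_norm 2 \<Omega>) u u\<^sub>0"
      "weak_solution \<Omega> p a f h v" "has_initial_value \<Omega> (Lp_space 2 \<Omega>) (Lp_norm 2 \<Omega>) v u\<^sub>0"
    then show "ae_equal_on \<Omega> u v" by (intro weak_solutions_unique[of h u v u\<^sub>0] b)
  next
    fix u\<^sub>0 u v
    assume "strong_solution \<Omega> p a f h u" "has_initial_value \<Omega> (H10 \<Omega>) (H10_norm \<Omega>) u u\<^sub>0"
      "strong_solution \<Omega> p a f h v" "has_initial_value \<Omega> (H10 \<Omega>) (H10_norm \<Omega>) v u\<^sub>0"
    then show "ae_equal_on \<Omega> u v"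
      by (intro weak_solutions_unique[of h u v u\<^sub>0] str has_initial_value_H10_imp_L2 assms(1,2))
        (auto simp: strong_solution_def)
  qed
qed

end
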